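(* Let $p$ be a weight (of class $C^2$ on $\{|z|>R_0\}$ for some $R_0\ge 0$) such that $p(z)=O(\Delta p(z))$ as $|z|\to\infty$, and let $V=\{(z_j,m_j)\}_{j\in\mathbb{N}}$ be a multiplicity variety. Then $V$ is an interpolating variety for $A_p(\mathbb{C})$ if and only if there exist constants $A,B>0$ such that for all $j\in\mathbb{N}$ $$N(z_j,e)\le A\,p(z_j)+B.$$
   Context: A weight is a subharmonic function $p:\mathbb{C}\to[0,\infty)$ such that (a) $\ln(1+|z|^2)=O(p(z))$ as $|z|\to\infty$; (b) there exist constants $C_1,C_2>0$ such that $|z-w|\le 1$ implies $p(w)\le C_1p(z)+C_2$. $\Delta=4\partial\bar\partial$ is the Laplacian. $A_p(\mathbb{C})$ is the space of entire functions $f$ for which there exist $A,B>0$ with $|f(z)|\le Ae^{Bp(z)}$ for all $z\in\mathbb{C}$. A multiplicity variety $V=\{(z_j,m_j)\}_{j\in\mathbb{N}}$ consists of a sequence of (pairwise distinct) points $z_j\in\mathbb{C}$ with $|z_j|\to\infty$ and a sequence of positive integers $m_j$. $V$ is an interpolating variety for $A_p(\mathbb{C})$ if for every family $\{w_{j,l}\}_{j\in\mathbb{N},\,0\le l<m_j}$ of complex numbers for which there exist $A,B>0$ with $\sum_{l=0}^{m_j-1}|w_{j,l}|\le Ae^{Bp(z_j)}$ for all $j$, there is $f\in A_p(\mathbb{C})$ with $f^{(l)}(z_j)/l!=w_{j,l}$ for all $j\in\mathbb{N}$ and $0\le l<m_j$. For $z\in\mathbb{C}$ and $r>0$, $n(z,r)=\sum_{|z-z_j|\le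 r}m_j$ (and $n(z,0)$ is $m_j$ if $z=z_j$ for some $j$, and $0$ otherwise), and $$N(z,r)=\int_0^r\frac{n(z,t)-n(z,0)}{t}\,dt+n(z,0)\ln r=\sum_{0<|z-z_j|\le r}m_j\ln\frac{r}{|z-z_j|}+n(z,0)\ln r.$$ Here $e$ is the base of natural logarithms. *)

theory Defs
  imports "HOL-Complex_Analysis.Complex_Analysis" "HOL-Library.Landau_Symbols"
begin

section \<open>Weights\<close>

text \<open>
  Only finite-valued subharmonic functions on the whole plane are needed, so the value
  minus infinity does not occur.  For the functions considered here (nonnegative and upper
  semicontinuous, hence bounded and Borel measurable on every circle) the circle integral
  always exists.
\<close>

definition subharmonic :: "(complex \<Rightarrow> real) \<Rightarrow> bool" where
  "subharmonic p \<longleftrightarrow>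
     (\<forall>a. open {z. p z < a}) \<and>
     (\<forall>z. \<forall>r>0. p z \<le> 1 / (2 * pi) * (LBINT t:{0..2*pi}. p (z + of_real r * cis t)))"

definition weight :: "(complex \<Rightarrow> real) \<Rightarrow> bool" where
  "weight p \<longleftrightarrow>
     subharmonic p \<and> (\<forall>z. 0 \<le> p z) \<and>
     (\<lambda>z. ln (1 + (cmod z)\<^sup>2)) \<in> O[at_infinity](p) \<and>
     (\<exists>C1>0. \<exists>C2>0. \<forall>z w. cmod (z - w) \<le> 1 \<longrightarrow> p w \<le> C1 * p z + C2)"

section \<open>The Laplacian\<close>

definition C2_on :: "(complex \<Rightarrow> real) \<Rightarrow> complex set \<Rightarrow> bool" where
  "C2_on p S \<longleftrightarrow>
     (\<exists>(p' :: complex \<Rightarrow> complex \<Rightarrow>\<^sub>L real) (p'' :: complex \<Rightarrow> complex \<Rightarrow>\<^sub>L complex \<Rightarrow>\<^sub>L real).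
        (\<forall>z\<in>S. (p has_derivative blinfun_apply (p' z)) (at z)) \<and>
        (\<forall>z\<in>S. (p' has_derivative blinfun_apply (p'' z)) (at z)) \<and>
        continuous_on S p'')"

text \<open>
  The Wirtinger operators: the partial derivatives in \<open>x\<close> and \<open>y\<close> are the values of the
  real Frechet derivative on \<open>1\<close> and \<open>\<i>\<close>.
\<close>

definition wirtinger :: "(complex \<Rightarrow> complex) \<Rightarrow> complex \<Rightarrow> complex" where
  "wirtinger f z =
     (frechet_derivative f (at z) 1 - \<i> * frechet_derivative f (at z) \<i>) / 2"

definition wirtinger_bar :: "(complex \<Rightarrow> complex) \<Rightarrow> complex \<Rightarrow> complex" where
  "wirtinger_bar f z =
     (frechet_derivative f (at z) 1 + \<i> * frechet_derivative f (at z) \<i>) / 2"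

text \<open>
  The real part only serves to obtain a real-valued function; for real functions of
  class \<open>C\<^sup>2\<close> the imaginary part vanishes.
\<close>

definition laplacian :: "(complex \<Rightarrow> real) \<Rightarrow> complex \<Rightarrow> real" where
  "laplacian p z = Re (4 * wirtinger (wirtinger_bar (\<lambda>w. complex_of_real (p w))) z)"

lemma laplacian_eq:
  fixes p' :: "complex \<Rightarrow> complex \<Rightarrow>\<^sub>L real"
    and p'' :: "complex \<Rightarrow>\<^sub>L complex \<Rightarrow>\<^sub>L real"
  assumes S: "open S" "z \<in> S"
    and p': "\<And>w. w \<in> S \<Longrightarrow> (p has_derivative blinfun_apply (p' w)) (at w)"
    and p'': "(p' has_derivative blinfun_apply p'') (at z)"
  shows "laplacian p z = p'' 1 1 + p'' \<i> \<i>"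
proof -
  let ?g = "\<lambda>w. (complex_of_real (p' w 1) + \<i> * complex_of_real (p' w \<i>)) / 2"
  let ?D = "\<lambda>h. (complex_of_real (p'' h 1) + \<i> * complex_of_real (p'' h \<i>)) / 2"
  have g: "wirtinger_bar (\<lambda>w. complex_of_real (p w)) w = ?g w" if "w \<in> S" for w
  proof -
    have "((\<lambda>w. complex_of_real (p w)) has_derivative (\<lambda>h. complex_of_real (p' w h))) (at w)"
      using p'[OF that] by (rule has_derivative_of_real)
    from frechet_derivative_at[OF this, symmetric] show ?thesis
      by (simp add: wirtinger_bar_def)
  qed
  have "(?g has_derivative ?D) (at z)"
    by (auto intro!: derivative_eq_intros p'' simp: field_simps)
  then have "(wirtinger_bar (\<lambda>w. complex_of_real (p w)) has_derivative ?D) (at z)"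
    by (rule has_derivative_transform_within_open[OF _ S]) (simp add: g)
  from frechet_derivative_at[OF this, symmetric] show ?thesis
    by (simp add: laplacian_def wirtinger_def field_simps)
qed

section \<open>Interpolation\<close>

definition A_space :: "(complex \<Rightarrow> real) \<Rightarrow> (complex \<Rightarrow> complex) set" where
  "A_space p = {f. f holomorphic_on UNIV \<and>
     (\<exists>A>0. \<exists>B>0. \<forall>z. cmod (f z) \<le> A * exp (B * p z))}"

definition multiplicity_variety :: "(nat \<Rightarrow> complex) \<Rightarrow> (nat \<Rightarrow> nat) \<Rightarrow> bool" where
  "multiplicity_variety \<zeta> m \<longleftrightarrow>
     inj \<zeta> \<and> filterlim (\<lambda>j. cmod (\<zeta> j)) at_top sequentially \<and> (\<forall>j. 0 < m j)"

definition interpolating_variety ::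
    "(complex \<Rightarrow> real) \<Rightarrow> (nat \<Rightarrow> complex) \<Rightarrow> (nat \<Rightarrow> nat) \<Rightarrow> bool" where
  "interpolating_variety p \<zeta> m \<longleftrightarrow>
     (\<forall>w :: nat \<Rightarrow> nat \<Rightarrow> complex.
        (\<exists>A>0. \<exists>B>0. \<forall>j. (\<Sum>l<m j. cmod (w j l)) \<le> A * exp (B * p (\<zeta> j))) \<longrightarrow>
        (\<exists>f\<in>A_space p. \<forall>j. \<forall>l<m j. (deriv ^^ l) f (\<zeta> j) / fact l = w j l))"

section \<open>Counting functions\<close>

text \<open>
  For a multiplicity variety the index set is finite, and for \<open>r = 0\<close> the sum is the
  multiplicity of \<open>z\<close> (zero if \<open>z\<close> is not a point of the variety).
\<close>

definition n_count :: "(nat \<Rightarrow> complex) \<Rightarrow> (nat \<Rightarrow> nat) \<Rightarrow> complex \<Rightarrow> real \<Rightarrow> nat" where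
  "n_count \<zeta> m z r = (\<Sum>j | cmod (z - \<zeta> j) \<le> r. m j)"

definition N_count :: "(nat \<Rightarrow> complex) \<Rightarrow> (nat \<Rightarrow> nat) \<Rightarrow> complex \<Rightarrow> real \<Rightarrow> real" where
  "N_count \<zeta> m z r =
     (LBINT t:{0..r}. (real (n_count \<zeta> m z t) - real (n_count \<zeta> m z 0)) / t)
       + real (n_count \<zeta> m z 0) * ln r"

lemma finite_close_points:
  assumes "multiplicity_variety \<zeta> m"
  shows "finite {j. cmod (z - \<zeta> j) \<le> r}"
proof -
  have "eventually (\<lambda>j. cmod (\<zeta> j) > cmod z + r) sequentially"
    using assms by (auto simp: multiplicity_variety_def filterlim_at_top_dense)
  then obtain n where n: "\<And>j. j \<ge> n \<Longrightarrow> cmod (\<zeta> j) > cmod z + r"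
    by (auto simp: eventually_sequentially)
  have "j < n" if "cmod (z - \<zeta> j) \<le> r" for j
  proof (rule ccontr)
    assume "\<not> j < n"
    with n[of j] have "cmod (\<zeta> j) > cmod z + r" by simp
    moreover have "cmod (\<zeta> j) \<le> cmod z + cmod (z - \<zeta> j)"
      by (metis norm_minus_commute norm_triangle_sub)
    ultimately show False using that by simp
  qed
  then have "{j. cmod (z - \<zeta> j) \<le> r} \<subseteq> {..<n}" by auto
  then show ?thesis using finite_subset by blast
qed

lemma N_count_eq_sum:
  assumes V: "multiplicity_variety \<zeta> m" and r: "r > 0"
  shows "N_count \<zeta> m z r =
    (\<Sum>j | 0 < cmod (z - \<zeta> j) \<and> cmod (z - \<zeta> j) \<le> r. real (m j) * ln (r / cmod (z - \<zeta> j)))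
      + real (n_count \<zeta> m z 0) * ln r"
proof -
  define J where "J = {j. 0 < cmod (z - \<zeta> j) \<and> cmod (z - \<zeta> j) \<le> r}"
  define d where "d = (\<lambda>j. cmod (z - \<zeta> j))"
  have finJ: "finite J"
    by (rule finite_subset[OF _ finite_close_points[OF V, of z r]]) (auto simp: J_def)
  have dJ: "0 < d j" "d j \<le> r" if "j \<in> J" for j
    using that by (auto simp: J_def d_def)
  have one: "has_bochner_integral lborel (\<lambda>t. indicator {d j..r} t *\<^sub>R (1 / t)) (ln (r / d j))"
    if "j \<in> J" for j
  proof -
    have "has_bochner_integral lborel (\<lambda>t. indicator {d j..r} t *\<^sub>R (1 / t)) (ln r - ln (d j))"
    proof (rule has_bochner_integral_FTC_Icc)
      show "d j \<le> r" using dJ[OF that] by simp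
      show "(ln has_vector_derivative 1 / t) (at t within {d j..r})" if "d j \<le> t" "t \<le> r" for t
        using that dJ[OF \<open>j \<in> J\<close>]
        by (auto simp: has_real_derivative_iff_has_vector_derivative [symmetric]
            intro!: derivative_eq_intros)
      show "continuous_on {d j..r} (\<lambda>t. 1 / t)"
        using dJ[OF that] by (auto intro!: continuous_intros)
    qed
    then show ?thesis using dJ[OF that] r by (simp add: ln_div)
  qed
  have diff: "real (n_count \<zeta> m z t) - real (n_count \<zeta> m z 0)
      = (\<Sum>j\<in>J. real (m j) * indicator {d j..r} t)" if "0 \<le> t" "t \<le> r" for t
  proof -
    let ?A = "{j. d j \<le> t}" and ?Z = "{j. d j \<le> 0}"
    have fin: "finite ?A"
      using finite_close_points[OF V] by (simp add: d_def)
    have sub: "?Z \<subseteq> ?A" using that by auto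
    have "(\<Sum>j\<in>J. real (m j) * indicator {d j..r} t) = (\<Sum>j\<in>?A - ?Z. real (m j))"
      using that finJ by (intro sum.mono_neutral_cong_right)
        (auto simp: J_def d_def indicator_def)
    also have "\<dots> = (\<Sum>j\<in>?A. real (m j)) - (\<Sum>j\<in>?Z. real (m j))"
      by (rule sum_diff[OF fin sub])
    finally show ?thesis by (simp add: n_count_def d_def)
  qed
  have "(LBINT t:{0..r}. (real (n_count \<zeta> m z t) - real (n_count \<zeta> m z 0)) / t)
      = (LBINT t. \<Sum>j\<in>J. real (m j) * (indicator {d j..r} t *\<^sub>R (1 / t)))"
    unfolding set_lebesgue_integral_def
  proof (rule Bochner_Integration.integral_cong[OF refl])
    fix t :: real
    show "indicator {0..r} t *\<^sub>R ((real (n_count \<zeta> m z t) - real (n_count \<zeta> m z 0)) / t)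
      = (\<Sum>j\<in>J. real (m j) * (indicator {d j..r} t *\<^sub>R (1 / t)))"
    proof (cases "t \<in> {0..r}")
      case True
      then show ?thesis by (simp add: diff sum_divide_distrib)
    next
      case False
      then have "indicator {d j..r} t = (0::real)" if "j \<in> J" for j
        using dJ[OF that] by (auto simp: indicator_def)
      with False show ?thesis by simp
    qed
  qed
  also have "\<dots> = (\<Sum>j\<in>J. real (m j) * ln (r / d j))"
    using one
    by (intro has_bochner_integral_integral_eq has_bochner_integral_sum
        has_bochner_integral_mult_right) auto
  finally show ?thesis by (simp add: N_count_def J_def d_def)
qed

end

theory Submission
  imports Defs
begin

text \<open>
  Put \<open>q = p + 1\<close>. The values of \<open>q\<close> at points of distance at
  most 1 are comparable, so it does not matter at which nearby point a bound
  \<open>exp (O(q))\<close> is evaluated.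

  The counting bound is necessary. If it fails, it fails along a sequence of points
  \<open>\<zeta>\<^sub>j\<close> with mutual distances larger than \<open>e\<close> and
  \<open>N(\<zeta>\<^sub>j, e) / q(\<zeta>\<^sub>j)\<close> unbounded. Interpolate the
  value 1 for the Taylor coefficient of order \<open>m\<^sub>j - 1\<close> at these points
  and 0 for all other data. Dividing the interpolating function by its prescribed zeros in
  the disc of radius \<open>e\<close> about \<open>\<zeta>\<^sub>j\<close> and applying the
  maximum principle on the concentric disc of radius \<open>2 e\<close> bounds
  \<open>N(\<zeta>\<^sub>j, e)\<close> by 1 plus the logarithm of its maximum modulus
  (\<open>Jensen_counting_bound\<close>), which is \<open>O(q(\<zeta>\<^sub>j))\<close>.
  This contradicts the choice of the sequence.

  The counting bound is sufficient. It keeps the points apart at distances not much smaller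
  than \<open>exp (- O(q))\<close>, so the prescribed Taylor polynomials can be glued by
  cutoff functions to a smooth \<open>F\<close> with the right jets, with
  \<open>\<omega>\<close>, the dbar derivative of \<open>F\<close>, zero near the points
  (\<open>smooth_interpolant\<close>). Let \<open>G\<close> be an entire function whose
  divisor is the variety. Then \<open>f = F - G u\<close> interpolates and is entire as
  soon as the dbar derivative of \<open>u\<close> is \<open>a = \<omega> / G\<close>,
  and what is needed is a solution \<open>u\<close> for which \<open>G u\<close> is of size
  \<open>exp (O(q))\<close>. Nothing is known about the size of \<open>G\<close>, a
  Weierstrass product. Therefore sizes are measured by
  \<open>M(z) = exp (\<beta> \<Phi>(z)) / \<bar>Q(z)\<bar>\<close>, where
  \<open>Q\<close> is what remains of \<open>G\<close> after removal of the zeros at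
  distance at most 1/4 from \<open>z\<close>; then
  \<open>\<bar>G\<bar> M \<le> exp (\<beta> \<Phi>)\<close>, and for different
  \<open>z\<close> in a small disc these \<open>Q\<close> differ by explicit polynomial
  factors, under control by the counting bound (\<open>zero_poly_difference_bounds\<close>).

  The dbar equation is solved by a parametrix (\<open>dbar_solve\<close>). On a small cell
  with centre \<open>c\<close> solve it for \<open>a\<close> times a cutoff, divided by a
  holomorphic function \<open>E\<close> without zeros, by the Cauchy transform; multiply by
  \<open>E\<close>, cut off and add over all cells. The error comes from the second cutoff,
  which acts in an annulus about the cell. If \<open>\<bar>E\<bar> / M\<close> is much
  smaller there than it is on the cell, the error is at most half of \<open>a\<close> in the
  norm given by \<open>M\<close>, and the procedure can be iterated. A suitable choice is
  \<open>E = exp (\<beta> h) / Q\<close> with \<open>\<beta>\<close> large, provided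
  that there are a function \<open>\<Phi>\<close> comparable to \<open>q\<close> and, for
  each \<open>c\<close>, a holomorphic \<open>h\<close> near \<open>c\<close> such that
  \<open>\<Phi> - Re h\<close> is at most \<open>\<gamma> q(c)\<close> on the cell and
  at least \<open>2 \<gamma> q(c)\<close> on the annulus.

  The existence of \<open>\<Phi>\<close> and \<open>h\<close>
  (\<open>weight_local_peaks\<close>) is where \<open>p = O(\<Delta> p)\<close> enters.
  Convolution of \<open>q\<close> with a fixed kernel gives a smooth \<open>P\<close>,
  comparable to \<open>q\<close>, with third derivatives \<open>O(q)\<close> and
  \<open>\<Delta> P \<ge> c q\<close> far out. Up to the real part of a holomorphic
  quadratic polynomial, \<open>P(c + z)\<close> is \<open>\<Delta> P(c) / 4\<close>
  times \<open>\<bar>z\<bar>\<close> squared, with an error that is small compared with this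
  if \<open>\<bar>z\<bar>\<close> is small. In a bounded set, where nothing is known about
  \<open>\<Delta> P\<close> beyond nonnegativity, a multiple of the strictly subharmonic
  function \<open>ln (1 + \<bar>z\<bar>\<^sup>2)\<close> helps, which is
  \<open>O(q)\<close> because a weight dominates the logarithm.
\<close>

section \<open>The dbar operator\<close>

text \<open>
  Every real-linear map of the plane has the form \<open>a * h + b * cnj h\<close>;
  the coefficient \<open>b\<close> is the dbar derivative. A relation, unlike the total
  function \<open>wirtinger_bar\<close>, includes differentiability.
\<close>

definition has_dbar :: "(complex \<Rightarrow> complex) \<Rightarrow> complex \<Rightarrow> complex \<Rightarrow> bool" where
  "has_dbar f b z \<longleftrightarrow> (\<exists>a. (f has_derivative (\<lambda>h. a * h + b * cnj h)) (at z))"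

definition C1_on :: "complex set \<Rightarrow> (complex \<Rightarrow> complex) \<Rightarrow> bool" where
  "C1_on S f \<longleftrightarrow> (\<forall>z\<in>S. f differentiable (at z)) \<and>
     continuous_on S (wirtinger f) \<and> continuous_on S (wirtinger_bar f)"

lemma wirtinger_eq:
  assumes "(f has_derivative (\<lambda>h. a * h + b * cnj h)) (at z)"
  shows "wirtinger f z = a" "wirtinger_bar f z = b"
  using frechet_derivative_at[OF assms, symmetric]
  by (simp_all add: wirtinger_def wirtinger_bar_def algebra_simps)

lemma linear_complex_decomp:
  assumes "linear (D :: complex \<Rightarrow> complex)"
  shows "D h = (D 1 - \<i> * D \<i>) / 2 * h + (D 1 + \<i> * D \<i>) / 2 * cnj h"
proof -
  have "h = Re h *\<^sub>R 1 + Im h *\<^sub>R \<i>" by (simp add: complex_eq_iff)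
  then have "D h = D (Re h *\<^sub>R 1 + Im h *\<^sub>R \<i>)" by simp
  also have "\<dots> = Re h *\<^sub>R D 1 + Im h *\<^sub>R D \<i>"
    using assms by (simp add: linear_add linear_scale)
  finally have *: "D h = of_real (Re h) * D 1 + of_real (Im h) * D \<i>"
    by (simp add: scaleR_conv_of_real)
  show ?thesis unfolding * by (simp add: complex_eq_iff field_simps)
qed

lemma differentiable_wirtinger:
  assumes "f differentiable (at z)"
  shows "(f has_derivative (\<lambda>h. wirtinger f z * h + wirtinger_bar f z * cnj h)) (at z)"
proof -
  have D: "(f has_derivative frechet_derivative f (at z)) (at z)"
    using assms frechet_derivative_works by blast
  have "frechet_derivative f (at z) = (\<lambda>h. wirtinger f z * h + wirtinger_bar f z * cnj h)"
    unfolding wirtinger_def wirtinger_bar_def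
    by (intro ext) (rule linear_complex_decomp[OF has_derivative_linear[OF D]])
  then show ?thesis by (rule subst[where P="\<lambda>g. (f has_derivative g) (at z)"]) (rule D)
qed

lemma has_dbar_iff: "has_dbar f b z \<longleftrightarrow> f differentiable (at z) \<and> wirtinger_bar f z = b"
proof
  assume "has_dbar f b z"
  then obtain a where a: "(f has_derivative (\<lambda>h. a * h + b * cnj h)) (at z)"
    by (auto simp: has_dbar_def)
  show "f differentiable (at z) \<and> wirtinger_bar f z = b"
    using differentiableI[OF a] wirtinger_eq(2)[OF a] by blast
next
  assume "f differentiable (at z) \<and> wirtinger_bar f z = b"
  then show "has_dbar f b z"
    using differentiable_wirtinger[of f z] unfolding has_dbar_def by metis
qed

lemma wirtinger_bar_eqI: "has_dbar f b z \<Longrightarrow> wirtinger_bar f z = b"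
  by (simp add: has_dbar_iff)

lemma has_dbar_add: "has_dbar f b z \<Longrightarrow> has_dbar g c z \<Longrightarrow> has_dbar (\<lambda>w. f w + g w) (b + c) z"
  unfolding has_dbar_def
  apply clarify
  subgoal for a a'
    by (rule exI[of _ "a + a'"]) (auto intro!: derivative_eq_intros simp: algebra_simps)
  done

lemma has_dbar_mult:
  "has_dbar f b z \<Longrightarrow> has_dbar g c z \<Longrightarrow> has_dbar (\<lambda>w. f w * g w) (f z * c + b * g z) z"
  unfolding has_dbar_def
  apply clarify
  subgoal for a a'
    by (rule exI[of _ "f z * a' + a * g z"]) (auto intro!: derivative_eq_intros simp: algebra_simps)
  done

lemma has_dbar_field_derivative:
  assumes "(f has_field_derivative d) (at z)" shows "has_dbar f 0 z"
  unfolding has_dbar_def using assms by (auto simp: has_field_derivative_def)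

lemma has_dbar_holomorphic: "f holomorphic_on S \<Longrightarrow> open S \<Longrightarrow> z \<in> S \<Longrightarrow> has_dbar f 0 z"
  using has_dbar_field_derivative holomorphic_derivI by blast

lemma has_dbar_zero_imp_holomorphic:
  assumes "open S" "\<And>z. z \<in> S \<Longrightarrow> has_dbar f 0 z" shows "f holomorphic_on S"
proof -
  have "f field_differentiable (at z)" if "z \<in> S" for z
    using assms(2)[OF that] unfolding has_dbar_def field_differentiable_def has_field_derivative_def
    by auto
  then show ?thesis using assms(1) by (simp add: holomorphic_on_open field_differentiable_def)
qed

lemma has_dbar_const: "has_dbar (\<lambda>w. c) 0 z"
  by (rule has_dbar_field_derivative) (rule DERIV_const)

lemma has_dbar_cmult: "has_dbar f b z \<Longrightarrow> has_dbar (\<lambda>w. c * f w) (c * b) z"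
  using has_dbar_mult[OF has_dbar_const, of f b z c] by simp

lemma has_dbar_diff: "has_dbar f b z \<Longrightarrow> has_dbar g c z \<Longrightarrow> has_dbar (\<lambda>w. f w - g w) (b - c) z"
  using has_dbar_add[OF _ has_dbar_cmult[of g c z "-1"], of f b] by simp

lemma has_dbar_sum:
  "(\<And>i. i \<in> I \<Longrightarrow> has_dbar (f i) (b i) z) \<Longrightarrow> has_dbar (\<lambda>w. \<Sum>i\<in>I. f i w) (\<Sum>i\<in>I. b i) z"
  by (induction I rule: infinite_finite_induct) (auto intro!: has_dbar_const has_dbar_add)

lemma has_dbar_transform:
  assumes "has_dbar f b z" "open S" "z \<in> S" "\<And>w. w \<in> S \<Longrightarrow> f w = g w"
  shows "has_dbar g b z"
  using assms unfolding has_dbar_def by (blast intro: has_derivative_transform_within_open)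

lemma has_dbar_isCont: "has_dbar f b z \<Longrightarrow> isCont f z"
  unfolding has_dbar_def using has_derivative_continuous by blast

lemma C1_onI:
  assumes "\<And>z. z \<in> S \<Longrightarrow> (f has_derivative (\<lambda>h. a z * h + b z * cnj h)) (at z)"
    and "continuous_on S a" "continuous_on S b"
  shows "C1_on S f"
  unfolding C1_on_def
proof (intro conjI ballI)
  show "f differentiable (at z)" if "z \<in> S" for z using assms(1)[OF that] differentiable_def by blast
  show "continuous_on S (wirtinger f)"
    by (rule continuous_on_eq[OF assms(2)]) (simp add: wirtinger_eq[OF assms(1)])
  show "continuous_on S (wirtinger_bar f)"
    by (rule continuous_on_eq[OF assms(3)]) (simp add: wirtinger_eq[OF assms(1)])
qed

lemma C1_onD:
  assumes "C1_on S f" "z \<in> S"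
  shows "(f has_derivative (\<lambda>h. wirtinger f z * h + wirtinger_bar f z * cnj h)) (at z)"
    and "has_dbar f (wirtinger_bar f z) z"
  using assms differentiable_wirtinger has_dbar_iff by (auto simp: C1_on_def)

lemma C1_on_imp_continuous: "C1_on S f \<Longrightarrow> continuous_on S f"
  by (meson C1_on_def continuous_at_imp_continuous_on differentiable_imp_continuous_within)

lemma C1_on_subset: "C1_on S f \<Longrightarrow> T \<subseteq> S \<Longrightarrow> C1_on T f"
  by (meson C1_on_def continuous_on_subset subsetD)

lemma C1_on_add: assumes f: "C1_on S f" and g: "C1_on S g" shows "C1_on S (\<lambda>z. f z + g z)"
proof (rule C1_onI)
  show "((\<lambda>z. f z + g z) has_derivative (\<lambda>h. (wirtinger f z + wirtinger g z) * h
      + (wirtinger_bar f z + wirtinger_bar g z) * cnj h)) (at z)" if "z \<in> S" for z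
    by (rule has_derivative_eq_rhs[OF has_derivative_add[OF C1_onD(1)[OF f that] C1_onD(1)[OF g that]]])
      (simp add: algebra_simps)
qed (use f g in \<open>auto simp: C1_on_def intro!: continuous_intros\<close>)

lemma C1_on_mult: assumes f: "C1_on S f" and g: "C1_on S g" shows "C1_on S (\<lambda>z. f z * g z)"
proof (rule C1_onI)
  show "((\<lambda>z. f z * g z) has_derivative (\<lambda>h. (f z * wirtinger g z + wirtinger f z * g z) * h
      + (f z * wirtinger_bar g z + wirtinger_bar f z * g z) * cnj h)) (at z)" if "z \<in> S" for z
    by (rule has_derivative_eq_rhs[OF has_derivative_mult[OF C1_onD(1)[OF f that] C1_onD(1)[OF g that]]])
      (simp add: algebra_simps)
qed (use f g C1_on_imp_continuous[OF f] C1_on_imp_continuous[OF g] in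
  \<open>auto simp: C1_on_def intro!: continuous_intros\<close>)

lemma C1_on_const: "C1_on S (\<lambda>z. c)"
  by (rule C1_onI[where a="\<lambda>_. 0" and b="\<lambda>_. 0"]) (auto intro!: derivative_eq_intros)

lemma C1_on_cnj: "C1_on S cnj"
  by (rule C1_onI[where a="\<lambda>_. 0" and b="\<lambda>_. 1"]) (auto intro!: derivative_eq_intros)

lemma C1_on_holomorphic: assumes "f holomorphic_on S" "open S" shows "C1_on S f"
proof (rule C1_onI[where a="deriv f" and b="\<lambda>_. 0"])
  show "(f has_derivative (\<lambda>h. deriv f z * h + 0 * cnj h)) (at z)" if "z \<in> S" for z
    using holomorphic_derivI[OF assms that] by (simp add: has_field_derivative_def)
  show "continuous_on S (deriv f)"
    using assms holomorphic_deriv holomorphic_on_imp_continuous_on by blast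
qed auto

lemma C1_on_diff: assumes "C1_on S f" "C1_on S g" shows "C1_on S (\<lambda>z. f z - g z)"
  using C1_on_add[OF assms(1) C1_on_mult[OF C1_on_const[of S "-1"] assms(2)]] by simp

lemma C1_on_sum: "(\<And>i. i \<in> I \<Longrightarrow> C1_on S (f i)) \<Longrightarrow> C1_on S (\<lambda>z. \<Sum>i\<in>I. f i z)"
  by (induction I rule: infinite_finite_induct) (auto intro!: C1_on_const C1_on_add)

lemma C1_on_cong:
  assumes "C1_on S f" "open S" "\<And>z. z \<in> S \<Longrightarrow> f z = g z" shows "C1_on S g"
proof (rule C1_onI[where a="wirtinger f" and b="wirtinger_bar f"])
  show "(g has_derivative (\<lambda>h. wirtinger f z * h + wirtinger_bar f z * cnj h)) (at z)" if "z \<in> S" for z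
    by (rule has_derivative_transform_within_open[OF C1_onD(1)[OF assms(1) that] assms(2) that assms(3)])
qed (use assms in \<open>auto simp: C1_on_def\<close>)

lemma C1_on_local:
  assumes "\<And>z. z \<in> S \<Longrightarrow> \<exists>U. open U \<and> z \<in> U \<and> C1_on U f"
  shows "C1_on S f"
  unfolding C1_on_def
proof (intro conjI ballI)
  show "f differentiable (at z)" if "z \<in> S" for z
    using assms[OF that] by (auto simp: C1_on_def)
  have "isCont (wirtinger f) z \<and> isCont (wirtinger_bar f) z" if zS: "z \<in> S" for z
  proof -
    obtain U where "open U" "z \<in> U" "C1_on U f" using assms[OF zS] by blast
    then show ?thesis by (auto simp: C1_on_def continuous_on_eq_continuous_at)
  qed
  then show "continuous_on S (wirtinger f)" "continuous_on S (wirtinger_bar f)"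
    by (auto intro: continuous_at_imp_continuous_on)
qed

text \<open>
  For a real-valued function the form \<open>a * h + b * cnj h\<close> takes real
  values only, so the real chain rule multiplies both coefficients by \<open>g'\<close>.
\<close>

lemma C1_on_real_compose:
  fixes r :: "complex \<Rightarrow> real"
  assumes r: "C1_on S (\<lambda>z. of_real (r z))"
    and d: "\<And>t. (g has_real_derivative g' t) (at t)" and c: "continuous_on UNIV g'"
  shows "C1_on S (\<lambda>z. of_real (g (r z)))"
    and "z \<in> S \<Longrightarrow> has_dbar (\<lambda>z. of_real (r z)) b z \<Longrightarrow>
      has_dbar (\<lambda>z. of_real (g (r z))) (of_real (g' (r z)) * b) z"
proof -
  have key: "((\<lambda>z. of_real (g (r z))) has_derivative
     (\<lambda>h. (of_real (g' (r z)) * a) * h + (of_real (g' (r z)) * b) * cnj h)) (at z)"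
    if D: "((\<lambda>z. complex_of_real (r z)) has_derivative (\<lambda>h. a * h + b * cnj h)) (at z)" for z a b
  proof -
    have "(r has_derivative (\<lambda>h. Re (a * h + b * cnj h))) (at z)"
      using has_derivative_Re[OF D] by simp
    moreover have "(g has_derivative (*) (g' (r z))) (at (r z))"
      using d by (simp add: has_field_derivative_def)
    ultimately have 1: "((\<lambda>z. g (r z)) has_derivative (\<lambda>h. g' (r z) * Re (a * h + b * cnj h))) (at z)"
      by (rule has_derivative_compose)
    have im: "Im (a * h + b * cnj h) = 0" for h
    proof -
      have "((\<lambda>z. 0::real) has_derivative (\<lambda>h. Im (a * h + b * cnj h))) (at z)"
        using has_derivative_Im[OF D] by simp
      from has_derivative_unique[OF this has_derivative_const] show ?thesis by metis
    qed
    then have eq: "complex_of_real (Re (a * h + b * cnj h)) = a * h + b * cnj h" for h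
      by (simp only: complex_eq_iff Re_complex_of_real Im_complex_of_real)
    have "((\<lambda>z. complex_of_real (g (r z))) has_derivative
        (\<lambda>h. of_real (g' (r z)) * (a * h + b * cnj h))) (at z)"
    proof -
      have "((\<lambda>z. complex_of_real (g (r z))) has_derivative
        (\<lambda>h. complex_of_real (g' (r z) * Re (a * h + b * cnj h)))) (at z)"
        by (rule has_derivative_of_real[OF 1])
      then show ?thesis by (simp only: of_real_mult eq)
    qed
    then show ?thesis by (simp only: distrib_left mult.assoc)
  qed
  have cr: "continuous_on S r"
    using continuous_on_Re[OF C1_on_imp_continuous[OF r]] by simp
  then have cg: "continuous_on S (\<lambda>z. g' (r z))"
    using continuous_on_compose2[OF c, of S r] by auto
  show "C1_on S (\<lambda>z. of_real (g (r z)))"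
    by (rule C1_onI[OF key[OF C1_onD(1)[OF r]]])
      (use r cg in \<open>auto simp: C1_on_def intro!: continuous_intros\<close>)
  show "z \<in> S \<Longrightarrow> has_dbar (\<lambda>z. of_real (r z)) b z \<Longrightarrow>
      has_dbar (\<lambda>z. of_real (g (r z))) (of_real (g' (r z)) * b) z"
    unfolding has_dbar_def using key by blast
qed

section \<open>Limits of functions with small dbar derivative\<close>

text \<open>
  The local step of Goursat's argument: near \<open>x\<close> the function is a holomorphic
  affine function, which has integral 0 over the boundary of a triangle, up to an error of
  at most \<open>(e + \<eta>) * cmod (y - x)\<close>.
\<close>

lemma norm_triangle_integral_dbar_point:
  assumes D: "has_dbar f b x" and b: "cmod b \<le> e" and eta: "0 < \<eta>" and contf: "continuous_on S f"
  shows "\<exists>k>0. \<forall>K a b c. dist a b \<le> K \<and> dist b c \<le> K \<and> dist c a \<le> K \<and> K \<le> k \<and>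
      x \<in> convex hull {a,b,c} \<and> convex hull {a,b,c} \<subseteq> S \<longrightarrow>
      cmod (contour_integral (linepath a b) f + contour_integral (linepath b c) f
        + contour_integral (linepath c a) f) \<le> 3 * (e + \<eta>) * K\<^sup>2"
proof -
  obtain d where D': "(f has_derivative (\<lambda>h. d * h + b * cnj h)) (at x)"
    using D by (auto simp: has_dbar_def)
  obtain k where k: "k > 0"
    and kb: "\<And>y. cmod (y - x) < k \<Longrightarrow> cmod (f y - f x - (d * (y - x) + b * cnj (y - x))) \<le> \<eta> * cmod (y - x)"
    using D' eta unfolding has_derivative_at_alt by blast
  have *: "cmod (f y - f x - d * (y - x)) \<le> (e + \<eta>) * cmod (y - x)" if "cmod (y - x) < k" for y
  proof -
    have "f y - f x - d * (y - x) = (f y - f x - (d * (y - x) + b * cnj (y - x))) + b * cnj (y - x)"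
      by simp
    also have "cmod \<dots> \<le> \<eta> * cmod (y - x) + cmod b * cmod (y - x)"
      using norm_triangle_le[OF add_right_mono[OF kb[OF that]]]
      by (metis (no_types, lifting) add_mono complex_mod_cnj kb norm_mult norm_triangle_le order_refl that)
    also have "\<dots> \<le> (e + \<eta>) * cmod (y - x)"
      using mult_right_mono[OF b, of "cmod (y - x)"] by (simp add: algebra_simps)
    finally show ?thesis .
  qed
  have "0 \<le> e" using b norm_ge_zero order_trans by blast
  show ?thesis
  proof (intro exI[of _ "k/2"] conjI allI impI)
    show "k / 2 > 0" using k by simp
    fix K a b c
    assume A: "dist a b \<le> K \<and> dist b c \<le> K \<and> dist c a \<le> K \<and> K \<le> k / 2 \<and>
       x \<in> convex hull {a, b, c} \<and> convex hull {a, b, c} \<subseteq> S"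
    let ?g = "\<lambda>y. f y - f x - d * (y - x)"
    have K0: "K \<ge> 0" using A zero_le_dist order_trans by blast
    have gb: "cmod (?g y) \<le> (e + \<eta>) * K" if "y \<in> convex hull {a,b,c}" for y
    proof -
      have "cmod (y - x) \<le> K"
      proof -
        have "x \<in> convex hull {a,b,c}" using A by blast
        from triangle_points_closer[OF this that] A show ?thesis
          by (auto simp: dist_norm norm_minus_commute)
      qed
      moreover have "cmod (y - x) < k" using calculation A k by linarith
      moreover have "(e + \<eta>) * cmod (y - x) \<le> (e + \<eta>) * K"
        by (rule mult_left_mono) (use calculation \<open>0 \<le> e\<close> eta in auto)
      ultimately show ?thesis using *[of y] by linarith
    qed
    have cont: "continuous_on (convex hull {a,b,c}) ?g"
      using continuous_on_subset[OF contf] A by (intro continuous_intros) auto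
    have seg: "closed_segment a b \<subseteq> convex hull {a,b,c}" "closed_segment b c \<subseteq> convex hull {a,b,c}"
        "closed_segment c a \<subseteq> convex hull {a,b,c}"
      by (rule segments_subset_convex_hull)+
    have fi: "f contour_integrable_on linepath u v" if "closed_segment u v \<subseteq> convex hull {a,b,c}" for u v
      using that A contf by (meson continuous_on_subset contour_integrable_continuous_linepath subset_trans)
    have ib: "cmod (contour_integral (linepath u v) ?g) \<le> (e + \<eta>) * K * K"
      if s: "closed_segment u v \<subseteq> convex hull {a,b,c}" and d: "dist u v \<le> K" for u v
    proof -
      have "?g contour_integrable_on linepath u v"
        by (rule contour_integrable_continuous_linepath) (rule continuous_on_subset[OF cont s])
      then have "cmod (contour_integral (linepath u v) ?g) \<le> (e + \<eta>) * K * cmod (v - u)"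
        using has_contour_integral_bound_linepath[OF has_contour_integral_integral, of ?g u v "(e+\<eta>)*K"]
          s gb \<open>0 \<le> e\<close> eta K0 by auto
      also have "\<dots> \<le> (e + \<eta>) * K * K"
        using d \<open>0 \<le> e\<close> eta K0 by (intro mult_left_mono) (auto simp: dist_norm norm_minus_commute)
      finally show ?thesis .
    qed
    have lin: "contour_integral (linepath a b) (\<lambda>y. f x + d * (y - x)) +
        contour_integral (linepath b c) (\<lambda>y. f x + d * (y - x)) +
        contour_integral (linepath c a) (\<lambda>y. f x + d * (y - x)) = 0"
    proof -
      have "((\<lambda>y. f x + d * (y - x)) has_contour_integral 0) (linepath a b +++ linepath b c +++ linepath c a)"
        by (rule Cauchy_theorem_triangle) (intro holomorphic_intros)
      then show ?thesis
        by (simp add: has_chain_integral_chain_integral3)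
    qed
    have sp: "contour_integral (linepath u v) ?g =
       contour_integral (linepath u v) f - contour_integral (linepath u v) (\<lambda>y. f x + d * (y - x))"
      if "closed_segment u v \<subseteq> convex hull {a,b,c}" for u v
    proof -
      have "contour_integral (linepath u v) ?g = contour_integral (linepath u v) (\<lambda>y. f y - (f x + d * (y - x)))"
        by (simp add: algebra_simps)
      also have "\<dots> = contour_integral (linepath u v) f - contour_integral (linepath u v) (\<lambda>y. f x + d * (y - x))"
        by (intro contour_integral_diff fi[OF that] contour_integrable_continuous_linepath continuous_intros)
      finally show ?thesis .
    qed
    have "contour_integral (linepath a b) f + contour_integral (linepath b c) f + contour_integral (linepath c a) f
      = contour_integral (linepath a b) ?g + contour_integral (linepath b c) ?g + contour_integral (linepath c a) ?g"
      unfolding sp[OF seg(1)] sp[OF seg(2)] sp[OF seg(3)] using lin by algebra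
    also have "cmod \<dots> \<le> (e + \<eta>) * K * K + (e + \<eta>) * K * K + (e + \<eta>) * K * K"
      using ib seg A by (intro norm_triangle_mono) auto
    finally show "cmod (contour_integral (linepath a b) f + contour_integral (linepath b c) f
        + contour_integral (linepath c a) f) \<le> 3 * (e + \<eta>) * K\<^sup>2"
      by (simp add: power2_eq_square algebra_simps)
  qed
qed

text \<open>
  Goursat's argument with a quantitative conclusion: if the bound fails for a triangle, it
  fails by the same factor for one of the four triangles of half the size, and so on, until
  the local estimate at the common point is violated.
\<close>

lemma norm_triangle_integral_dbar:
  assumes contf: "\<And>z. z \<in> convex hull {a,b,c} \<Longrightarrow> has_dbar f (\<beta> z) z \<and> cmod (\<beta> z) \<le> e"
    and K0: "0 < K" and dK: "dist a b \<le> K" "dist b c \<le> K" "dist c a \<le> K"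
  shows "cmod (contour_integral (linepath a b) f + contour_integral (linepath b c) f
        + contour_integral (linepath c a) f) \<le> 3 * e * K\<^sup>2"
proof (rule ccontr)
  let ?pathint = "\<lambda>x y. contour_integral(linepath x y) f"
  assume neg: "\<not> ?thesis"
  \<comment> \<open>The quotient of the integral by the square of the size does not decrease
    on passing to a suitable quarter.\<close>
  define e' where "e' = cmod (?pathint a b + ?pathint b c + ?pathint c a) / K\<^sup>2"
  have e': "e' > 3 * e" using neg K0 by (simp add: e'_def field_simps)
  have cf: "continuous_on (convex hull {a,b,c}) f"
    using contf has_dbar_isCont continuous_at_imp_continuous_on by blast
  define tri where "tri = (\<lambda>(x, y, z). convex hull {x, y, z :: complex})"
  define I where "I = (\<lambda>(x, y, z). ?pathint x y + ?pathint y z + ?pathint z x)"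
  define small where "small n = (\<lambda>(x, y, z :: complex). dist x y \<le> K / 2 ^ n \<and> dist y z \<le> K / 2 ^ n \<and> dist z x \<le> K / 2 ^ n)"
    for n :: nat
  define good where "good n t \<longleftrightarrow> tri t \<subseteq> tri (a, b, c) \<and> small n t \<and> e' * (K / 2 ^ n)\<^sup>2 \<le> cmod (I t)" for n t
  have step: "\<exists>t'. good (Suc n) t' \<and> tri t' \<subseteq> tri t" if t: "good n t" for n t
  proof -
    obtain x y z where xyz: "t = (x, y, z)" by (cases t)
    have sub: "convex hull {x, y, z} \<subseteq> convex hull {a, b, c}" using t by (simp add: good_def tri_def xyz)
    have "\<exists>x' y' z'. x' \<in> convex hull {x, y, z} \<and> y' \<in> convex hull {x, y, z} \<and> z' \<in> convex hull {x, y, z} \<and>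
        dist x' y' \<le> K / 2 ^ n / 2 \<and> dist y' z' \<le> K / 2 ^ n / 2 \<and> dist z' x' \<le> K / 2 ^ n / 2 \<and>
        e' * (K / 2 ^ n / 2)\<^sup>2 \<le> cmod (?pathint x' y' + ?pathint y' z' + ?pathint z' x')"
      by (rule Cauchy_theorem_quadrisection[OF continuous_on_subset[OF cf sub]])
        (use t in \<open>auto simp: good_def small_def I_def xyz\<close>)
    then obtain x' y' z' where new: "x' \<in> convex hull {x, y, z}" "y' \<in> convex hull {x, y, z}" "z' \<in> convex hull {x, y, z}"
      "dist x' y' \<le> K / 2 ^ Suc n" "dist y' z' \<le> K / 2 ^ Suc n" "dist z' x' \<le> K / 2 ^ Suc n"
      "e' * (K / 2 ^ Suc n)\<^sup>2 \<le> cmod (?pathint x' y' + ?pathint y' z' + ?pathint z' x')"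
      by (auto simp: mult.commute)
    have "convex hull {x', y', z'} \<subseteq> convex hull {x, y, z}"
      by (rule hull_minimal) (use new in \<open>auto intro: convex_convex_hull\<close>)
    then have "good (Suc n) (x', y', z') \<and> tri (x', y', z') \<subseteq> tri t"
      using new sub unfolding good_def small_def I_def tri_def xyz by auto
    then show ?thesis by blast
  qed
  have "good 0 (a, b, c)" using K0 dK by (simp add: good_def small_def I_def e'_def)
  then obtain T where good: "\<And>n. good n (T n)" and nested: "\<And>n. tri (T (Suc n)) \<subseteq> tri (T n)"
    using dependent_nat_choice[of good "\<lambda>n t t'. tri t' \<subseteq> tri t"] step by blast
  define fa fb fc where "fa n = fst (T n)" and "fb n = fst (snd (T n))" and "fc n = snd (snd (T n))" for n
  have T: "T n = (fa n, fb n, fc n)" for n by (simp add: fa_def fb_def fc_def)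
  have cosb: "convex hull {fa n, fb n, fc n} \<subseteq> convex hull {a, b, c}"
    and dist: "dist (fa n) (fb n) \<le> K / 2 ^ n" "dist (fb n) (fc n) \<le> K / 2 ^ n" "dist (fc n) (fa n) \<le> K / 2 ^ n"
    and no: "e' * (K / 2 ^ n)\<^sup>2 \<le> cmod (?pathint (fa n) (fb n) + ?pathint (fb n) (fc n) + ?pathint (fc n) (fa n))" for n
    using good[of n] by (simp_all add: good_def small_def tri_def I_def T)
  obtain x where x: "\<And>n. x \<in> convex hull {fa n, fb n, fc n}"
  proof (rule bounded_closed_nest)
    show "closed (convex hull {fa n, fb n, fc n})" for n
      by (simp add: compact_imp_closed finite_imp_compact_convex_hull)
    have "decseq (\<lambda>n. convex hull {fa n, fb n, fc n})"
      using nested by (intro decseq_SucI) (simp add: tri_def T)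
    then show "k \<le> n \<Longrightarrow> convex hull {fa n, fb n, fc n} \<subseteq> convex hull {fa k, fb k, fc k}" for k n
      by (rule decseqD)
  qed (auto simp: bounded_convex_hull)
  then have xin: "x \<in> convex hull {a,b,c}" using cosb by blast
  \<comment> \<open>The local estimate is applied with half of the gap between
    \<open>e\<close> and \<open>e' / 3\<close>.\<close>
  define \<eta> where "\<eta> = (e' / 3 - e) / 2"
  have \<eta>: "\<eta> > 0" using e' by (simp add: \<eta>_def)
  obtain k where "k > 0" and k: "\<And>K a' b' c'. \<lbrakk>dist a' b' \<le> K; dist b' c' \<le> K; dist c' a' \<le> K; K \<le> k;
      x \<in> convex hull {a',b',c'}; convex hull {a',b',c'} \<subseteq> convex hull {a,b,c}\<rbrakk> \<Longrightarrow>
      cmod (?pathint a' b' + ?pathint b' c' + ?pathint c' a') \<le> 3 * (e + \<eta>) * K\<^sup>2"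
    using norm_triangle_integral_dbar_point[of f "\<beta> x" x e \<eta> "convex hull {a,b,c}"] contf[OF xin] \<eta> cf
    by metis
  obtain n where "K / k < 2 ^ n" using real_arch_pow[of 2 "K/k"] by auto
  then have "K / 2 ^ n \<le> k" using \<open>k > 0\<close> by (simp add: field_simps)
  from k[OF dist[of n] this x cosb] no[of n]
  have "e' * (K/2^n)^2 \<le> 3 * (e + \<eta>) * (K/2^n)\<^sup>2" by linarith
  then have "e' \<le> 3 * (e + \<eta>)" using K0 by (simp add: mult_le_cancel_right)
  moreover have "6 * \<eta> = e' - 3 * e" by (simp add: \<eta>_def field_simps)
  ultimately show False using e' by argo
qed

text \<open>
  The integrals over triangles converge, and they are bounded by the dbar derivatives, so
  those of the limit are 0 and Morera's theorem applies. This is how the sum of a series of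
  corrections is recognised as holomorphic without any information on the derivatives of the
  sum.
\<close>

lemma holomorphic_limit_dbar:
  assumes d: "\<And>k z. has_dbar (F k) (\<beta> k z) z"
    and F: "\<And>R. uniform_limit (cball 0 R) F f sequentially"
    and \<beta>: "\<And>R. uniform_limit (cball 0 R) \<beta> (\<lambda>_. 0) sequentially"
  shows "f holomorphic_on UNIV"
proof -
  have cF: "continuous_on S (F k)" for k S
    using d has_dbar_isCont continuous_at_imp_continuous_on by blast
  have cf: "continuous_on (cball 0 R) f" for R
    by (rule uniform_limit_theorem[OF _ F]) (auto simp: cF)
  have cU: "continuous_on UNIV f"
  proof -
    have "isCont f z" for z
    proof -
      have "continuous_on (ball 0 (cmod z + 1)) f"
        using cf[of "cmod z + 1"] ball_subset_cball continuous_on_subset by blast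
      then show ?thesis by (simp add: continuous_on_eq_continuous_at)
    qed
    then show ?thesis by (simp add: continuous_at_imp_continuous_on)
  qed
  have "f analytic_on UNIV"
  proof (rule Morera_triangle[OF cU open_UNIV], rule impI)
    fix a b c :: complex
    let ?T = "convex hull {a,b,c}"
    let ?I = "\<lambda>g. contour_integral (linepath a b) g + contour_integral (linepath b c) g
        + contour_integral (linepath c a) g"
    have "bounded ?T" by (simp add: bounded_convex_hull)
    then obtain R where R: "?T \<subseteq> cball 0 R"
      using bounded_subset_ballD ball_subset_cball subset_trans by metis
    define K where "K = 1 + max (dist a b) (max (dist b c) (dist c a))"
    have K: "K > 0" "dist a b \<le> K" "dist b c \<le> K" "dist c a \<le> K"
      by (auto simp: K_def max_def intro: add_pos_nonneg)
    have lim1: "(\<lambda>k. contour_integral (linepath u v) (F k)) \<longlonglongrightarrow> contour_integral (linepath u v) f"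
      for u v
    proof (rule contour_integral_uniform_limit(2))
      show "\<forall>\<^sub>F k in sequentially. F k contour_integrable_on linepath u v"
        by (simp add: cF contour_integrable_continuous_linepath)
      have "bounded (closed_segment u v)" by (rule compact_imp_bounded[OF compact_segment])
      then obtain R where R: "closed_segment u v \<subseteq> cball 0 R"
        using bounded_subset_ballD ball_subset_cball subset_trans by metis
      show "uniform_limit (path_image (linepath u v)) F f sequentially"
        using uniform_limit_on_subset[OF F R] by simp
      show "norm (vector_derivative (linepath u v) (at t)) \<le> cmod (v - u)" for t by simp
    qed auto
    have lim: "(\<lambda>k. ?I (F k)) \<longlonglongrightarrow> ?I f"
      by (intro tendsto_add lim1)
    have small: "cmod (?I f) \<le> 3 * e * K\<^sup>2" if "e > 0" for e
    proof (rule tendsto_upperbound[OF tendsto_norm[OF lim]])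
      have "\<forall>\<^sub>F k in sequentially. \<forall>z\<in>cball 0 R. dist (\<beta> k z) 0 < e"
        using \<beta>[of R] that unfolding uniform_limit_iff by blast
      then show "\<forall>\<^sub>F k in sequentially. cmod (?I (F k)) \<le> 3 * e * K\<^sup>2"
      proof eventually_elim
        case (elim k)
        show ?case
          by (rule norm_triangle_integral_dbar[where \<beta>="\<beta> k", OF _ K]) (use elim d R in \<open>force simp: dist_norm\<close>)
      qed
    qed auto
    have "cmod (?I f) \<le> 0"
    proof (rule field_le_epsilon)
      fix e :: real assume "e > 0"
      then show "cmod (?I f) \<le> 0 + e"
        using small[of "e / (3 * K\<^sup>2)"] K by (simp add: field_simps)
    qed
    then show "?I f = 0" by simp
  qed
  then show ?thesis by (rule analytic_imp_holomorphic)
qed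

section \<open>Cutoff functions\<close>

lemma DERIV_max_power:
  "((\<lambda>x. max 0 x ^ (n + 2)) has_real_derivative real (n + 2) * max 0 x ^ (n + 1)) (at x)"
proof -
  consider "x < 0" | "x > 0" | "x = 0" by linarith
  then show ?thesis
  proof cases
    case 1
    have "((\<lambda>x. 0) has_real_derivative 0) (at x)" by simp
    then have "((\<lambda>x. max 0 x ^ (n + 2)) has_real_derivative 0) (at x)"
      by (rule has_field_derivative_transform_within_open[where S="{..<0}"]) (use 1 in \<open>auto simp: max_def\<close>)
    then show ?thesis using 1 by (simp add: max_def)
  next
    case 2
    have "((\<lambda>x. x ^ (n + 2)) has_real_derivative real (n + 2) * x ^ (n + 1)) (at x)"
      by (rule derivative_eq_intros | simp)+
    then have "((\<lambda>x. max 0 x ^ (n + 2)) has_real_derivative real (n + 2) * x ^ (n + 1)) (at x)"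
      by (rule has_field_derivative_transform_within_open[where S="{0<..}"]) (use 2 in \<open>auto simp: max_def\<close>)
    then show ?thesis using 2 by (simp add: max_def)
  next
    case 3
    have "(\<lambda>h. max 0 h ^ (n + 2) / h) \<midarrow>0\<rightarrow> (0::real)"
    proof (rule Lim_null_comparison[where g="\<lambda>h. max 0 h ^ (n + 1)"])
      show "\<forall>\<^sub>F h in at 0. norm (max 0 h ^ (n + 2) / h) \<le> max 0 h ^ (n + 1)"
        by (rule always_eventually) (auto simp: max_def)
      have "(\<lambda>h. max 0 h ^ (n + 1)) \<midarrow>0\<rightarrow> max 0 (0::real) ^ (n + 1)"
        by (intro tendsto_intros)
      then show "(\<lambda>h. max 0 h ^ (n + 1)) \<midarrow>0\<rightarrow> (0::real)" by simp
    qed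
    then show ?thesis using 3 by (simp add: DERIV_def)
  qed
qed

text \<open>
  Truncated cubes make this a function of class \<open>C\<^sup>2\<close>, equal to 1 on
  \<open>s \<le> 1/4\<close> and to 0 on \<open>s \<ge> 1\<close>; the cutoff of a disc
  has to be of class \<open>C\<^sup>2\<close>, because its dbar derivative must be of class
  \<open>C\<^sup>1\<close>.
\<close>

definition cutoff :: "real \<Rightarrow> real" where
  "cutoff s = max 0 (1 - s) ^ 3 / (max 0 (1 - s) ^ 3 + max 0 (s - 1/4) ^ 3)"

definition cutoff' :: "real \<Rightarrow> real" where
  "cutoff' s = - 3 * (max 0 (1 - s) ^ 2 * max 0 (s - 1/4) ^ 3 + max 0 (1 - s) ^ 3 * max 0 (s - 1/4) ^ 2)
     / (max 0 (1 - s) ^ 3 + max 0 (s - 1/4) ^ 3)\<^sup>2"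

lemma cutoff_denom: "max 0 (1 - s) ^ 3 + max 0 (s - 1/4) ^ 3 > (0::real)"
proof (cases "s < 1")
  case True then show ?thesis by (intro add_pos_nonneg) (auto simp: max_def)
next
  case False then show ?thesis by (intro add_nonneg_pos) (auto simp: max_def)
qed

lemma DERIV_max_power_left:
  "((\<lambda>s. max 0 (1 - s) ^ (n + 2)) has_real_derivative - (real (n + 2) * max 0 (1 - s) ^ (n + 1))) (at s)"
proof -
  have "((\<lambda>s::real. 1 - s) has_real_derivative -1) (at s)"
    by (rule derivative_eq_intros | simp)+
  then show ?thesis by (rule DERIV_cong[OF DERIV_chain2[OF DERIV_max_power]]) simp
qed

lemma DERIV_max_power_right:
  "((\<lambda>s. max 0 (s - 1/4) ^ (n + 2)) has_real_derivative real (n + 2) * max 0 (s - 1/4) ^ (n + 1) * 1) (at s)"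
proof -
  have "((\<lambda>s::real. s - 1/4) has_real_derivative 1) (at s)"
    by (rule derivative_eq_intros | simp)+
  from DERIV_chain2[OF DERIV_max_power this] show ?thesis .
qed

lemma DERIV_max_cube:
  "((\<lambda>s. max 0 (1 - s) ^ 3) has_real_derivative - (3 * (max 0 (1 - s))\<^sup>2)) (at s)"
  "((\<lambda>s. max 0 (s - 1/4) ^ 3) has_real_derivative 3 * (max 0 (s - 1/4))\<^sup>2) (at s)"
  "((\<lambda>s. max 0 (1 - s) ^ 2) has_real_derivative - (2 * max 0 (1 - s))) (at s)"
  "((\<lambda>s. max 0 (s - 1/4) ^ 2) has_real_derivative 2 * max 0 (s - 1/4)) (at s)"
  using DERIV_max_power_left[of 1 s] DERIV_max_power_right[of 1 s]
    DERIV_max_power_left[of 0 s] DERIV_max_power_right[of 0 s]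
  by (simp_all add: numeral_2_eq_2 numeral_3_eq_3)

lemma DERIV_cutoff: "(cutoff has_real_derivative cutoff' s) (at s)"
proof -
  let ?a = "max 0 (1 - s)" and ?b = "max 0 (s - 1/4)"
  have "((\<lambda>s. max 0 (1 - s) ^ 3 / (max 0 (1 - s) ^ 3 + max 0 (s - 1/4) ^ 3)) has_real_derivative
    (- (3 * ?a\<^sup>2) * (?a ^ 3 + ?b ^ 3) - ?a ^ 3 * (- (3 * ?a\<^sup>2) + 3 * ?b\<^sup>2)) / ((?a ^ 3 + ?b ^ 3) * (?a ^ 3 + ?b ^ 3))) (at s)"
    by (rule DERIV_divide[OF DERIV_max_cube(1)
        DERIV_add[OF DERIV_max_cube(1,2)]])
      (use cutoff_denom[of s] in auto)
  moreover have "(- (3 * ?a\<^sup>2) * (?a ^ 3 + ?b ^ 3) - ?a ^ 3 * (- (3 * ?a\<^sup>2) + 3 * ?b\<^sup>2)) / ((?a ^ 3 + ?b ^ 3) * (?a ^ 3 + ?b ^ 3))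
      = cutoff' s"
    unfolding cutoff'_def power2_eq_square[of "?a^3 + ?b^3"] by (rule arg_cong2[where f="(/)"], algebra, rule refl)
  ultimately show ?thesis unfolding cutoff_def[abs_def] by simp
qed

lemma cutoff'_C1: "\<exists>c. (\<forall>s. (cutoff' has_real_derivative c s) (at s)) \<and> continuous_on UNIV c"
proof -
  define a b where "a s = max 0 (1 - s)" and "b s = max 0 (s - 1/4)" for s :: real
  define N where "N s = - 3 * (a s ^ 2 * b s ^ 3 + a s ^ 3 * b s ^ 2)" for s
  define D where "D s = (a s ^ 3 + b s ^ 3)\<^sup>2" for s
  define N' where "N' s = - 3 * ((- (2 * a s) * b s ^ 3 + (3 * (b s)\<^sup>2) * a s ^ 2)
      + (- (3 * (a s)\<^sup>2) * b s ^ 2 + (2 * b s) * a s ^ 3))" for s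
  define D' where "D' s = 2 * (a s ^ 3 + b s ^ 3) * (- (3 * (a s)\<^sup>2) + 3 * (b s)\<^sup>2)" for s
  have ca: "continuous_on UNIV a" "continuous_on UNIV b"
    by (auto simp: a_def[abs_def] b_def[abs_def] intro!: continuous_intros)
  have D0: "D s \<noteq> 0" for s using cutoff_denom[of s] by (simp add: D_def a_def b_def)
  have da: "((\<lambda>s. a s ^ 3) has_real_derivative - (3 * (a s)\<^sup>2)) (at s)"
      "((\<lambda>s. b s ^ 3) has_real_derivative 3 * (b s)\<^sup>2) (at s)"
      "((\<lambda>s. a s ^ 2) has_real_derivative - (2 * a s)) (at s)"
      "((\<lambda>s. b s ^ 2) has_real_derivative 2 * b s) (at s)" for s
    unfolding a_def b_def by (rule DERIV_max_cube)+
  have dN: "(N has_real_derivative N' s) (at s)" for s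
    unfolding N_def[abs_def] N'_def by (intro DERIV_cmult DERIV_add DERIV_mult da)
  have dD: "(D has_real_derivative D' s) (at s)" for s
    unfolding D_def[abs_def] D'_def
    using DERIV_power[OF DERIV_add[OF da(1) da(2)], where n=2] by (simp add: algebra_simps)
  have e: "cutoff' s = N s / D s" for s
    by (simp only: cutoff'_def N_def D_def a_def b_def)
  show ?thesis
  proof (intro exI[of _ "\<lambda>s. (N' s * D s - N s * D' s) / (D s * D s)"] conjI allI)
    show "(cutoff' has_real_derivative (N' s * D s - N s * D' s) / (D s * D s)) (at s)" for s
      using DERIV_divide[OF dN dD D0, of s] unfolding e[abs_def] by simp
    show "continuous_on UNIV (\<lambda>s. (N' s * D s - N s * D' s) / (D s * D s))"
      using ca D0 unfolding N_def N'_def D'_def D_def by (intro continuous_intros) auto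
  qed
qed

lemma continuous_cutoff': "continuous_on UNIV cutoff'"
  using cutoff'_C1 by (meson DERIV_isCont continuous_at_imp_continuous_on)

lemma cutoff_eq_1: assumes "s \<le> 1/4" shows "cutoff s = 1"
proof -
  have "max 0 (s - 1/4) = 0" "max 0 (1 - s) \<noteq> 0" using assms by (auto simp: max_def)
  then show ?thesis by (simp add: cutoff_def)
qed

lemma cutoff_eq_0: "s \<ge> 1 \<Longrightarrow> cutoff s = 0"
  by (simp add: cutoff_def max_def)

lemma cutoff_bounds: "0 \<le> cutoff s" "cutoff s \<le> 1"
  using cutoff_denom[of s] by (auto simp: cutoff_def)

lemma cutoff'_eq_0: assumes "s \<le> 1/4 \<or> s \<ge> 1" shows "cutoff' s = 0"
proof -
  have "max 0 (s - 1/4) = 0 \<or> max 0 (1 - s) = 0" using assms by (auto simp: max_def)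
  then show ?thesis by (auto simp: cutoff'_def)
qed

text \<open>
  The constant sign of the derivative, and its strict sign at one point, keep the
  normalising constant of the Cauchy transform away from 0.
\<close>

lemma cutoff'_nonpos: "cutoff' s \<le> 0"
proof -
  have "0 \<le> max 0 (1 - s) ^ 2 * max 0 (s - 1/4) ^ 3 + max 0 (1 - s) ^ 3 * max 0 (s - 1/4) ^ 2"
    by (intro add_nonneg_nonneg mult_nonneg_nonneg zero_le_power) auto
  then have "- 3 * (max 0 (1 - s) ^ 2 * max 0 (s - 1/4) ^ 3 + max 0 (1 - s) ^ 3 * max 0 (s - 1/4) ^ 2) \<le> 0"
    by (intro mult_nonpos_nonneg) auto
  then show ?thesis unfolding cutoff'_def by (intro divide_nonpos_nonneg) auto
qed

lemma cutoff'_half: "cutoff' (1/2) < 0"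
  by (simp add: cutoff'_def max_def power2_eq_square power3_eq_cube)

lemma cutoff'_bounded: "\<exists>D>0. \<forall>s. \<bar>cutoff' s\<bar> \<le> D"
proof -
  have "compact (cutoff' ` {0..1})"
    by (intro compact_continuous_image continuous_on_subset[OF continuous_cutoff']) auto
  then obtain D where D: "D > 0" "\<forall>s\<in>{0..1}. \<bar>cutoff' s\<bar> \<le> D"
    using bounded_pos compact_imp_bounded by (metis (no_types, lifting) image_eqI real_norm_def)
  have "\<bar>cutoff' s\<bar> \<le> D" for s
    using D cutoff'_eq_0[of s] by (cases "s \<in> {0..1}") auto
  then show ?thesis using D(1) by blast
qed

definition bump :: "complex \<Rightarrow> real \<Rightarrow> complex \<Rightarrow> complex" where
  "bump c r z = of_real (cutoff ((cmod (z - c))\<^sup>2 / r\<^sup>2))"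

definition dbump :: "complex \<Rightarrow> real \<Rightarrow> complex \<Rightarrow> complex" where
  "dbump c r z = of_real (cutoff' ((cmod (z - c))\<^sup>2 / r\<^sup>2)) * ((z - c) / of_real (r\<^sup>2))"

lemma C1_on_ident: "C1_on S (\<lambda>z. z)"
  by (rule C1_onI[where a="\<lambda>_. 1" and b="\<lambda>_. 0"]) (auto intro!: derivative_eq_intros)

lemma of_real_norm_square_divide:
  "complex_of_real ((cmod (z - c))\<^sup>2 / r\<^sup>2) = (1 / of_real (r\<^sup>2)) * ((z - c) * (cnj z - cnj c))"
  by (simp add: complex_norm_square[symmetric] flip: complex_cnj_diff)

lemma C1_norm_square: "C1_on UNIV (\<lambda>z. of_real ((cmod (z - c))\<^sup>2 / r\<^sup>2))"
  unfolding of_real_norm_square_divide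
  by (intro C1_on_mult C1_on_diff C1_on_const C1_on_ident C1_on_cnj)

lemma has_dbar_cnj: "has_dbar cnj 1 z"
  unfolding has_dbar_def by (rule exI[of _ 0]) (auto intro!: derivative_eq_intros)

lemma has_dbar_ident: "has_dbar (\<lambda>z. z) 0 z"
  by (rule has_dbar_field_derivative) (rule DERIV_ident)

lemma has_dbar_norm_square: "has_dbar (\<lambda>z. of_real ((cmod (z - c))\<^sup>2 / r\<^sup>2)) ((z - c) / of_real (r\<^sup>2)) z"
  unfolding of_real_norm_square_divide
  using has_dbar_cmult[OF has_dbar_mult[OF has_dbar_diff[OF has_dbar_ident has_dbar_const[of c z]]
      has_dbar_diff[OF has_dbar_cnj has_dbar_const[of "cnj c" z]]], of "1 / of_real (r\<^sup>2)"]
  by simp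

lemma has_dbar_bump: "has_dbar (bump c r) (dbump c r z) z"
  unfolding bump_def[abs_def] dbump_def
  by (rule C1_on_real_compose(2)[OF C1_norm_square DERIV_cutoff continuous_cutoff' UNIV_I has_dbar_norm_square])

lemma C1_bump: "C1_on UNIV (bump c r)"
  unfolding bump_def[abs_def]
  by (rule C1_on_real_compose(1)[OF C1_norm_square DERIV_cutoff continuous_cutoff'])

lemma C1_dbump: "C1_on UNIV (dbump c r)"
proof -
  obtain c2 where "\<And>s. (cutoff' has_real_derivative c2 s) (at s)" "continuous_on UNIV c2"
    using cutoff'_C1 by blast
  from C1_on_real_compose(1)[OF C1_norm_square this]
  show ?thesis
    unfolding dbump_def[abs_def] divide_inverse[of _ "of_real (r\<^sup>2)"]
    by (intro C1_on_mult C1_on_diff C1_on_const C1_on_ident)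
qed

lemma norm_square_quotient_le: "r > 0 \<Longrightarrow> cmod (z - c) \<le> r / 2 \<Longrightarrow> (cmod (z - c))\<^sup>2 / r\<^sup>2 \<le> 1/4"
  using power_mono[of "cmod (z - c)" "r/2" 2] by (simp add: power2_eq_square field_simps)

lemma norm_square_quotient_ge: "r > 0 \<Longrightarrow> cmod (z - c) \<ge> r \<Longrightarrow> (cmod (z - c))\<^sup>2 / r\<^sup>2 \<ge> 1"
  using power_mono[of r "cmod (z - c)" 2] by (simp add: field_simps)

lemma bump_eq_1: "r > 0 \<Longrightarrow> cmod (z - c) \<le> r / 2 \<Longrightarrow> bump c r z = 1"
  using norm_square_quotient_le by (simp add: bump_def cutoff_eq_1)

lemma bump_eq_0: "r > 0 \<Longrightarrow> cmod (z - c) \<ge> r \<Longrightarrow> bump c r z = 0"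
  using norm_square_quotient_ge by (simp add: bump_def cutoff_eq_0)

lemma norm_bump_le: "cmod (bump c r z) \<le> 1"
  using cutoff_bounds by (simp add: bump_def)

lemma dbump_eq_0: "r > 0 \<Longrightarrow> cmod (z - c) \<le> r / 2 \<or> cmod (z - c) \<ge> r \<Longrightarrow> dbump c r z = 0"
  using norm_square_quotient_le[of r z c] norm_square_quotient_ge[of r z c]
  by (auto simp: dbump_def cutoff'_eq_0)

lemma norm_dbump_le: "\<exists>D>0. \<forall>c r z. r > 0 \<longrightarrow> cmod (dbump c r z) \<le> D / r"
proof -
  obtain D where D: "D > 0" "\<And>s. \<bar>cutoff' s\<bar> \<le> D" using cutoff'_bounded by blast
  have "cmod (dbump c r z) \<le> D / r" if r: "r > 0" for c r z
  proof (cases "cmod (z - c) \<ge> r")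
    case True
    then show ?thesis using dbump_eq_0 r D(1) by simp
  next
    case False
    have "cmod (dbump c r z) = \<bar>cutoff' ((cmod (z - c))\<^sup>2 / r\<^sup>2)\<bar> * (cmod (z - c) / r\<^sup>2)"
      by (simp add: dbump_def norm_mult norm_divide norm_power)
    also have "\<dots> \<le> D * (r / r\<^sup>2)"
      using False r D by (intro mult_mono divide_right_mono) auto
    finally show ?thesis using r by (simp add: power2_eq_square)
  qed
  with D(1) show ?thesis by blast
qed

section \<open>The Cauchy transform\<close>

text \<open>
  Dyadic annuli: on the \<open>k\<close>-th one the integrand is at most
  \<open>2 ^ (k + 1) / R\<close>, and its area is a constant times
  \<open>R\<^sup>2 / 4 ^ k\<close> at most, which leaves a geometric series.
\<close>

lemma set_integrable_inverse: "set_integrable lborel (cball 0 R) (\<lambda>w::complex. 1 / w)"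
proof (cases "R > 0")
  case False
  have "(\<lambda>w::complex. indicator (cball 0 R) w *\<^sub>R (1 / w)) = (\<lambda>w. 0)"
  proof
    fix w :: complex
    show "indicator (cball 0 R) w *\<^sub>R (1 / w) = 0"
      using False by (cases "w = 0") (auto simp: indicator_def dest: order_trans[of "cmod w" R 0])
  qed
  then show ?thesis unfolding set_integrable_def by simp
next
  case True
  let ?V = "unit_ball_vol (real DIM(complex))"
  show ?thesis unfolding set_integrable_def
  proof (rule integrableI_bounded)
    show "(\<lambda>w::complex. indicator (cball 0 R) w *\<^sub>R (1 / w)) \<in> borel_measurable lborel"
    proof (intro borel_measurable_scaleR borel_measurable_indicator borel_measurable_divide)
      show "cball (0::complex) R \<in> sets lborel" by simp
      show "(\<lambda>w::complex. w) \<in> borel_measurable lborel" by simp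
    qed simp
    let ?t = "\<lambda>k::nat. \<lambda>x::complex. ennreal (2 ^ (k + 1) / R) * indicator (cball 0 (R / 2 ^ k)) x"
    have le: "ennreal (cmod (indicator (cball 0 R) x *\<^sub>R (1 / x))) \<le> (\<Sum>k. ?t k x)" for x :: complex
    proof (cases "x = 0 \<or> x \<notin> cball 0 R")
      case True then show ?thesis by auto
    next
      case False
      then have x: "cmod x > 0" "cmod x \<le> R" by auto
      define n where "n = (LEAST n. R / 2 ^ (n + 1) < cmod x)"
      have ex: "\<exists>n. R / 2 ^ (n + 1) < cmod x"
      proof -
        obtain n where "R / cmod x < 2 ^ n" using real_arch_pow[of 2 "R / cmod x"] by auto
        also have "(2::real) ^ n \<le> 2 ^ (n + 1)" by simp
        finally show ?thesis using x by (intro exI[of _ n]) (simp add: field_simps)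
      qed
      have n1: "R / 2 ^ (n + 1) < cmod x" unfolding n_def by (rule LeastI_ex[OF ex])
      have n2: "cmod x \<le> R / 2 ^ n"
      proof (cases n)
        case 0 then show ?thesis using x by simp
      next
        case (Suc k)
        then have "\<not> R / 2 ^ (k + 1) < cmod x" using not_less_Least[of k "\<lambda>n. R / 2 ^ (n + 1) < cmod x"] unfolding n_def by simp
        then show ?thesis using Suc by simp
      qed
      have "ennreal (cmod (indicator (cball 0 R) x *\<^sub>R (1 / x))) = ennreal (1 / cmod x)"
        using x by (simp add: norm_divide)
      also have "\<dots> \<le> ?t n x"
        using n1 n2 x True by (simp add: field_simps ennreal_leI)
      also have "\<dots> = (\<Sum>k\<in>{n}. ?t k x)"
        by (simp only: sum.insert finite.emptyI empty_iff sum.empty add_0_right not_False_eq_True)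
      also have "\<dots> \<le> (\<Sum>k. ?t k x)"
        by (rule sum_le_suminf) auto
      finally show ?thesis .
    qed
    have "(\<integral>\<^sup>+ x. ennreal (cmod (indicator (cball 0 R) x *\<^sub>R (1 / x))) \<partial>lborel)
        \<le> (\<integral>\<^sup>+ x. (\<Sum>k. ?t k x) \<partial>lborel)"
      by (rule nn_integral_mono) (rule le)
    also have "\<dots> = (\<Sum>k. \<integral>\<^sup>+ x. ?t k x \<partial>lborel)"
      by (rule nn_integral_suminf)
        (intro borel_measurable_times_ennreal borel_measurable_const borel_measurable_indicator, simp)
    also have "\<dots> = (\<Sum>k. ennreal ((2 * ?V * R) * (1/2) ^ k))"
    proof (rule suminf_cong)
      fix k
      have "(\<integral>\<^sup>+ x. ?t k x \<partial>lborel) = ennreal (2 ^ (k + 1) / R) * emeasure lborel (cball (0::complex) (R / 2 ^ k))"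
        by (rule nn_integral_cmult_indicator) simp
      also have "\<dots> = ennreal (2 ^ (k + 1) / R) * ennreal (?V * (R / 2 ^ k) ^ 2)"
        using True by (subst emeasure_cball) auto
      also have "\<dots> = ennreal ((2 * ?V * R) * (1/2) ^ k)"
        using True by (subst ennreal_mult[symmetric])
          (auto simp: field_simps power2_eq_square intro!: arg_cong[where f=ennreal])
      finally show "(\<integral>\<^sup>+ x. ?t k x \<partial>lborel) = \<dots>" .
    qed
    also have "\<dots> = ennreal ((2 * ?V * R) * (1 / (1 - 1/2)))"
    proof (rule suminf_ennreal_eq)
      show "(\<lambda>k. (2 * ?V * R) * (1/2) ^ k) sums ((2 * ?V * R) * (1 / (1 - 1/2)))"
        by (intro sums_mult geometric_sums) simp
    qed (use True in auto)
    also have "\<dots> < \<infinity>" by simp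
    finally show "(\<integral>\<^sup>+ x. ennreal (cmod (indicator (cball 0 R) x *\<^sub>R (1 / x))) \<partial>lborel) < \<infinity>" .
  qed
qed

definition convol :: "(complex \<Rightarrow> complex) \<Rightarrow> (complex \<Rightarrow> complex) \<Rightarrow> complex \<Rightarrow> complex" where
  "convol G k z = (LINT w|lborel. G (z - w) * k w)"

lemma compact_support_bounded:
  assumes "continuous_on UNIV G" "\<And>w. cmod w \<ge> \<rho> \<Longrightarrow> G w = (0::complex)"
  obtains B where "B > 0" "\<And>w. cmod (G w) \<le> B"
proof -
  have "compact (G ` cball 0 \<rho>)"
    by (intro compact_continuous_image continuous_on_subset[OF assms(1)]) auto
  then obtain B where B: "B > 0" "\<forall>w\<in>cball 0 \<rho>. cmod (G w) \<le> B"
    using bounded_pos compact_imp_bounded by (metis (no_types, lifting) image_eqI)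
  have "cmod (G w) \<le> B" for w
    using B assms(2)[of w] by (cases "cmod w \<le> \<rho>") auto
  then show ?thesis using B(1) that by blast
qed

lemma convol_integrable_bound:
  assumes c: "continuous_on UNIV G" and s: "\<And>w. cmod w \<ge> \<rho> \<Longrightarrow> G w = 0"
    and k: "\<And>R. set_integrable lborel (cball 0 R) k" and R: "cmod z + \<rho> \<le> R"
  shows "integrable lborel (\<lambda>w. G (z - w) * k w)"
    and "(\<And>w. cmod (G w) \<le> B) \<Longrightarrow> cmod (convol G k z) \<le> B * (LINT w|lborel. cmod (indicator (cball 0 R) w *\<^sub>R k w))"
proof -
  have eq: "G (z - w) * k w = G (z - w) * (indicator (cball 0 R) w *\<^sub>R k w)" for w
  proof (cases "cmod w \<le> R")
    case False
    have "cmod w - cmod z \<le> cmod (z - w)" by (metis norm_minus_commute norm_triangle_ineq2)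
    then have "G (z - w) = 0" using R False by (intro s) auto
    then show ?thesis by simp
  qed auto
  have m: "(\<lambda>w. G (z - w)) \<in> borel_measurable lborel"
    using c by (auto intro!: borel_measurable_continuous_onI continuous_intros elim: continuous_on_compose2)
  have ki: "integrable lborel (\<lambda>w. indicator (cball 0 R) w *\<^sub>R k w)"
    using k unfolding set_integrable_def .
  have ib: "integrable lborel (\<lambda>w. G (z - w) * (indicator (cball 0 R) w *\<^sub>R k w)) \<and>
     cmod (LINT w|lborel. G (z - w) * (indicator (cball 0 R) w *\<^sub>R k w))
      \<le> B * (LINT w|lborel. cmod (indicator (cball 0 R) w *\<^sub>R k w))"
    if B: "\<And>w. cmod (G w) \<le> B" for B
  proof
    have B0: "B \<ge> 0" using B[of 0] norm_ge_zero order_trans by blast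
    have dom: "integrable lborel (\<lambda>w. B * cmod (indicator (cball 0 R) w *\<^sub>R k w))"
      using ki by (intro integrable_mult_right integrable_norm)
    have le: "cmod (G (z - w) * (indicator (cball 0 R) w *\<^sub>R k w)) \<le> B * cmod (indicator (cball 0 R) w *\<^sub>R k w)" for w
      unfolding norm_mult by (intro mult_right_mono B) auto
    show i: "integrable lborel (\<lambda>w. G (z - w) * (indicator (cball 0 R) w *\<^sub>R k w))"
      by (rule Bochner_Integration.integrable_bound[OF dom])
        (use borel_measurable_times[OF m borel_measurable_integrable[OF ki]] order_trans[OF le abs_ge_self] in auto)
    have "cmod (LINT w|lborel. G (z - w) * (indicator (cball 0 R) w *\<^sub>R k w))
       \<le> (LINT w|lborel. B * cmod (indicator (cball 0 R) w *\<^sub>R k w))"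
      by (rule Bochner_Integration.integral_norm_bound_integral[OF i dom le])
    then show "cmod (LINT w|lborel. G (z - w) * (indicator (cball 0 R) w *\<^sub>R k w))
      \<le> B * (LINT w|lborel. cmod (indicator (cball 0 R) w *\<^sub>R k w))" by simp
  qed
  obtain B' where "\<And>w. cmod (G w) \<le> B'" using compact_support_bounded[OF c s] by metis
  from ib[OF this] show "integrable lborel (\<lambda>w. G (z - w) * k w)" unfolding eq by blast
  show "(\<And>w. cmod (G w) \<le> B) \<Longrightarrow> cmod (convol G k z) \<le> B * (LINT w|lborel. cmod (indicator (cball 0 R) w *\<^sub>R k w))"
    unfolding convol_def eq using ib by blast
qed

lemma compact_support_uniformly_continuous:
  assumes c: "continuous_on UNIV G" and s: "\<And>w. cmod w \<ge> \<rho> \<Longrightarrow> G w = (0::complex)" and e: "e > 0"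
  obtains d where "d > 0" "\<And>x y. cmod (x - y) < d \<Longrightarrow> cmod (G x - G y) < e"
proof -
  have "uniformly_continuous_on (cball 0 (\<rho> + 1)) G"
    by (intro compact_uniformly_continuous continuous_on_subset[OF c]) auto
  then obtain d where d: "d > 0"
    "\<And>x y. x \<in> cball 0 (\<rho> + 1) \<Longrightarrow> y \<in> cball 0 (\<rho> + 1) \<Longrightarrow> dist y x < d \<Longrightarrow> dist (G y) (G x) < e"
    unfolding uniformly_continuous_on_def using e by meson
  have "cmod (G x - G y) < e" if xy: "cmod (x - y) < min d 1" for x y
  proof (cases "cmod x < \<rho> \<or> cmod y < \<rho>")
    case True
    have "cmod x \<le> cmod y + cmod (x - y)" "cmod y \<le> cmod x + cmod (x - y)"
      by (metis norm_triangle_sub, metis norm_minus_commute norm_triangle_sub)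
    then show ?thesis using True xy d(2)[of y x] by (auto simp: dist_norm)
  next
    case False then show ?thesis using s[of x] s[of y] e by simp
  qed
  then show ?thesis using d(1) that[of "min d 1"] by auto
qed

definition C1c :: "(complex \<Rightarrow> complex) \<Rightarrow> bool" where
  "C1c g \<longleftrightarrow> C1_on UNIV g \<and> (\<exists>\<rho>. \<forall>w. cmod w \<ge> \<rho> \<longrightarrow> g w = 0)"

lemma wirtinger_support:
  assumes s: "\<And>w. cmod w \<ge> \<rho> \<Longrightarrow> g w = 0" and w: "cmod w \<ge> \<rho> + 1"
  shows "wirtinger g w = 0" "wirtinger_bar g w = 0"
proof -
  have "((\<lambda>_. 0) has_derivative (\<lambda>h. 0 * h + 0 * cnj h)) (at w)" by simp
  then have "(g has_derivative (\<lambda>h. 0 * h + 0 * cnj h)) (at w)"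
    by (rule has_derivative_transform_within_open[where s="- cball 0 \<rho>"]) (use s w in auto)
  from wirtinger_eq[OF this] show "wirtinger g w = 0" "wirtinger_bar g w = 0" by auto
qed

text \<open>
  The first derivatives are uniformly continuous. Uniformity in \<open>x\<close> is what
  allows differentiation under the integral sign in a convolution.
\<close>

lemma C1c_uniform_linearization:
  assumes g: "C1c g" and e: "e > 0"
  obtains d where "d > 0" "\<And>x h. cmod h < d \<Longrightarrow>
    cmod (g (x + h) - g x - (wirtinger g x * h + wirtinger_bar g x * cnj h)) \<le> e * cmod h"
proof -
  obtain \<rho> where \<rho>: "\<And>w. cmod w \<ge> \<rho> \<Longrightarrow> g w = 0" and C1: "C1_on UNIV g"
    using g by (auto simp: C1c_def)
  have ca: "continuous_on UNIV (wirtinger g)" "continuous_on UNIV (wirtinger_bar g)"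
    using C1 by (auto simp: C1_on_def)
  have e2: "e / 2 > 0" using e by simp
  obtain d1 where d1: "d1 > 0" "\<And>x y. cmod (x - y) < d1 \<Longrightarrow> cmod (wirtinger g x - wirtinger g y) < e / 2"
    using compact_support_uniformly_continuous[OF ca(1) wirtinger_support(1)[of \<rho>, OF \<rho>] e2] by metis
  obtain d2 where d2: "d2 > 0" "\<And>x y. cmod (x - y) < d2 \<Longrightarrow> cmod (wirtinger_bar g x - wirtinger_bar g y) < e / 2"
    using compact_support_uniformly_continuous[OF ca(2) wirtinger_support(2)[of \<rho>, OF \<rho>] e2] by metis
  define f' where "f' x = (\<lambda>h. wirtinger g x * h + wirtinger_bar g x * cnj h)" for x
  have der: "(g has_derivative f' x) (at x within S)" for x S
    using C1_onD(1)[OF C1, of x] has_derivative_at_withinI unfolding f'_def by blast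
  have "cmod (g (x + h) - g x - f' x h) \<le> e * cmod h" if h: "cmod h < min d1 d2" for x h
  proof -
    have "norm (g (x + h) - g x - f' x (x + h - x)) \<le> norm (x + h - x) * e"
    proof (rule differentiable_bound_linearization[where S="ball x (min d1 d2)" and f'=f'])
      show "x + t *\<^sub>R (x + h - x) \<in> ball x (min d1 d2)" if t: "t \<in> {0..1}" for t
      proof -
        have "cmod (t *\<^sub>R h) \<le> 1 * cmod h"
          unfolding norm_scaleR using t by (intro mult_right_mono) auto
        then show ?thesis using h by (simp add: dist_norm)
      qed
      show "(g has_derivative f' y) (at y within ball x (min d1 d2))" for y by (rule der)
      show "x \<in> ball x (min d1 d2)" using d1 d2 by simp
      show "onorm (f' y - f' x) \<le> e" if y: "y \<in> ball x (min d1 d2)" for y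
      proof (rule onorm_le)
        fix v
        have "f' y v - f' x v = (wirtinger g y - wirtinger g x) * v + (wirtinger_bar g y - wirtinger_bar g x) * cnj v"
          by (simp add: f'_def algebra_simps)
        also have "cmod \<dots> \<le> e / 2 * cmod v + e / 2 * cmod v"
          using y less_imp_le[OF d1(2)[of y x]] less_imp_le[OF d2(2)[of y x]]
          by (intro norm_triangle_mono; unfold norm_mult complex_mod_cnj; intro mult_right_mono)
            (auto simp: dist_norm norm_minus_commute)
        finally show "cmod ((f' y - f' x) v) \<le> e * cmod v" by simp
      qed
    qed
    then show ?thesis by (simp add: mult.commute)
  qed
  then show ?thesis using d1(1) d2(1) that[of "min d1 d2"] unfolding f'_def by auto
qed

text \<open>
  The derivatives fall on the smooth factor, so the kernel may be singular; it is applied to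
  \<open>1 / w\<close>.
\<close>

lemma has_derivative_convol:
  assumes g: "C1c g" and k: "\<And>R. set_integrable lborel (cball 0 R) k"
  shows "(convol g k has_derivative (\<lambda>h. convol (wirtinger g) k z * h + convol (wirtinger_bar g) k z * cnj h)) (at z)"
proof -
  obtain \<rho> where \<rho>: "\<And>w. cmod w \<ge> \<rho> \<Longrightarrow> g w = 0" and C1: "C1_on UNIV g"
    using g by (auto simp: C1c_def)
  have \<rho>': "\<And>w. cmod w \<ge> \<rho> + 1 \<Longrightarrow> g w = 0" using \<rho> by auto
  have cg: "continuous_on UNIV g" by (rule C1_on_imp_continuous[OF C1])
  have ca: "continuous_on UNIV (wirtinger g)" "continuous_on UNIV (wirtinger_bar g)"
    using C1 by (auto simp: C1_on_def)
  note int = convol_integrable_bound(1)[OF cg \<rho>' k order_refl]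
    convol_integrable_bound(1)[OF ca(1) wirtinger_support(1)[of \<rho>, OF \<rho>] k order_refl]
    convol_integrable_bound(1)[OF ca(2) wirtinger_support(2)[of \<rho>, OF \<rho>] k order_refl]
  define R where "R = cmod z + \<rho> + 2"
  define J where "J = (LINT w|lborel. cmod (indicator (cball 0 R) w *\<^sub>R k w))"
  have J0: "J \<ge> 0" unfolding J_def by (rule integral_nonneg_AE) auto
  show ?thesis unfolding has_derivative_at_alt
  proof (intro conjI allI impI)
    show "bounded_linear (\<lambda>h. convol (wirtinger g) k z * h + convol (wirtinger_bar g) k z * cnj h)"
      by (intro bounded_linear_add bounded_linear_mult_right bounded_linear_const_mult bounded_linear_cnj)
    fix e :: real assume "e > 0"
    then have e': "e / (J + 1) > 0" using J0 by simp
    obtain d where d: "d > 0" "\<And>x h. cmod h < d \<Longrightarrow>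
      cmod (g (x + h) - g x - (wirtinger g x * h + wirtinger_bar g x * cnj h)) \<le> e / (J + 1) * cmod h"
      using C1c_uniform_linearization[OF g e'] by blast
    show "\<exists>d>0. \<forall>y. cmod (y - z) < d \<longrightarrow> cmod (convol g k y - convol g k z -
          (convol (wirtinger g) k z * (y - z) + convol (wirtinger_bar g) k z * cnj (y - z))) \<le> e * cmod (y - z)"
    proof (intro exI[of _ "min d 1"] conjI allI impI)
      show "min d 1 > 0" using d by simp
      fix y assume y: "cmod (y - z) < min d 1"
      define h where "h = y - z"
      let ?E = "\<lambda>w. g (z - w + h) - g (z - w) - (wirtinger g (z - w) * h + wirtinger_bar g (z - w) * cnj h)"
      have eqE: "?E w * k w = g (y - w) * k w - g (z - w) * k w
          - (h * (wirtinger g (z - w) * k w) + cnj h * (wirtinger_bar g (z - w) * k w))" for w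
        by (simp add: h_def algebra_simps)
      have intE: "integrable lborel (\<lambda>w. ?E w * k w)"
        unfolding eqE by (intro Bochner_Integration.integrable_diff Bochner_Integration.integrable_add integrable_mult_right int)
      have eq1: "convol g k y - convol g k z -
          (convol (wirtinger g) k z * (y - z) + convol (wirtinger_bar g) k z * cnj (y - z))
        = (LINT w|lborel. ?E w * k w)"
        unfolding eqE convol_def using int
        by (simp add: Bochner_Integration.integral_diff Bochner_Integration.integral_add h_def mult.commute)
      have le1: "cmod (LINT w|lborel. ?E w * k w) \<le> (LINT w|lborel. e / (J + 1) * cmod h * cmod (indicator (cball 0 R) w *\<^sub>R k w))"
      proof (rule Bochner_Integration.integral_norm_bound_integral[OF intE])
        show "integrable lborel (\<lambda>w. e / (J + 1) * cmod h * cmod (indicator (cball 0 R) w *\<^sub>R k w))"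
          using k[of R] unfolding set_integrable_def by (intro integrable_mult_right integrable_norm)
        fix w
        show "cmod (?E w * k w) \<le> e / (J + 1) * cmod h * cmod (indicator (cball 0 R) w *\<^sub>R k w)"
        proof (cases "cmod w \<le> R")
          case True
          have "cmod (?E w) \<le> e / (J + 1) * cmod h"
            using d(2)[of h "z - w"] y by (simp add: h_def)
          then have "cmod (?E w) * cmod (k w) \<le> e / (J + 1) * cmod h * cmod (k w)"
            by (rule mult_right_mono) simp
          then show ?thesis using True by (simp only: norm_mult) simp
        next
          case False
          have "cmod w - cmod z \<le> cmod (z - w)" by (metis norm_minus_commute norm_triangle_ineq2)
          then have a: "cmod (z - w) \<ge> \<rho> + 1" using False by (simp add: R_def)
          have "cmod (z - w) \<le> cmod (z - w + h) + cmod h" using norm_triangle_ineq4[of "z - w + h" h] by simp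
          then have b: "cmod (z - w + h) \<ge> \<rho>" using False \<open>cmod w - cmod z \<le> cmod (z - w)\<close> y
            by (simp add: R_def h_def)
          have "?E w = 0" using \<rho>[OF b] \<rho>'[OF a] wirtinger_support[of \<rho>, OF \<rho> a] by simp
          then show ?thesis using False by simp
        qed
      qed
      have J1: "(LINT w|lborel. e / (J + 1) * cmod h * cmod (indicator (cball 0 R) w *\<^sub>R k w)) = e / (J + 1) * cmod h * J"
        by (subst integral_mult_right_zero) (simp only: J_def)
      have "e / (J + 1) * cmod h * J = e * cmod h * (J / (J + 1))"
        by (simp only: times_divide_eq_left times_divide_eq_right)
      also have "\<dots> \<le> e * cmod h * 1"
        using J0 \<open>e > 0\<close> by (intro mult_left_mono) auto
      finally have "cmod (LINT w|lborel. ?E w * k w) \<le> e * cmod h"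
        using le1 unfolding J1 by linarith
      then show "cmod (convol g k y - convol g k z -
          (convol (wirtinger g) k z * (y - z) + convol (wirtinger_bar g) k z * cnj (y - z))) \<le> e * cmod (y - z)"
        unfolding eq1 by (simp only: h_def)
    qed
  qed
qed

lemma C1cD: assumes "C1c g"
  shows "C1_on UNIV g" "has_dbar g (wirtinger_bar g z) z" "continuous_on UNIV g"
  using assms C1_onD(2)[of UNIV g z] C1_on_imp_continuous by (auto simp: C1c_def)

lemma C1c_mult_left: assumes "C1_on UNIV f" "C1c g" shows "C1c (\<lambda>z. f z * g z)"
proof -
  obtain \<rho> where "\<And>w. cmod w \<ge> \<rho> \<Longrightarrow> g w = 0" "C1_on UNIV g" using assms by (auto simp: C1c_def)
  then show ?thesis unfolding C1c_def using assms(1) C1_on_mult by (intro conjI exI[of _ \<rho>]) auto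
qed

lemma C1c_diff: assumes "C1c f" "C1c g" shows "C1c (\<lambda>z. f z - g z)"
proof -
  obtain \<rho> where "\<And>w. cmod w \<ge> \<rho> \<Longrightarrow> g w = 0" "C1_on UNIV g" using assms by (auto simp: C1c_def)
  moreover obtain \<rho>' where "\<And>w. cmod w \<ge> \<rho>' \<Longrightarrow> f w = 0" "C1_on UNIV f" using assms by (auto simp: C1c_def)
  ultimately show ?thesis unfolding C1c_def using C1_on_diff by (intro conjI exI[of _ "max \<rho> \<rho>'"]) auto
qed

lemma C1c_bump: "r > 0 \<Longrightarrow> C1c (bump 0 r)"
  unfolding C1c_def using C1_bump bump_eq_0[of r _ 0] by (intro conjI exI[of _ r]) auto

text \<open>
  Convolution with the constant 1 gives a constant function, whose dbar derivative is the
  integral in question.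
\<close>

lemma integral_wirtinger_bar_eq_0:
  assumes g: "C1c g" shows "(LINT w|lborel. wirtinger_bar g (- w)) = 0"
proof -
  have one: "set_integrable lborel (cball (0::complex) R) (\<lambda>w. 1::complex)" for R
    unfolding set_integrable_def
    by (rule integrableI_bounded_set_indicator[where B=1])
      (use emeasure_bounded_finite[OF bounded_cball, of "0::complex" R] in auto)
  have D: "(convol g (\<lambda>w. 1) has_derivative (\<lambda>h. convol (wirtinger g) (\<lambda>w. 1) 0 * h
      + convol (wirtinger_bar g) (\<lambda>w. 1) 0 * cnj h)) (at 0)"
    by (rule has_derivative_convol[OF g one])
  have "convol g (\<lambda>w. 1) z = convol g (\<lambda>w. 1) 0" for z
  proof -
    have m: "(\<lambda>w. g (z - w)) \<in> borel_measurable borel"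
      using C1cD(3)[OF g] by (auto intro!: borel_measurable_continuous_onI continuous_intros elim: continuous_on_compose2)
    have "convol g (\<lambda>w. 1) z = (LINT w|distr lborel borel ((+) z). g (z - w))"
      unfolding lborel_distr_plus convol_def by simp
    also have "\<dots> = (LINT w|lborel. g (z - (z + w)))"
      by (rule integral_distr[OF _ m]) simp
    finally show ?thesis by (simp add: convol_def)
  qed
  then have "convol g (\<lambda>w. 1) = (\<lambda>z. convol g (\<lambda>w. 1) 0)" by blast
  then have "(convol g (\<lambda>w. 1) has_derivative (\<lambda>h. 0 * h + 0 * cnj h)) (at 0)"
    by (rule ssubst[where P="\<lambda>f. (f has_derivative (\<lambda>h. 0 * h + 0 * cnj h)) (at 0)"]) simp
  from has_derivative_unique[OF D this] have "convol (wirtinger_bar g) (\<lambda>w. 1) 0 = 0"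
    using wirtinger_eq(2)[OF D] wirtinger_eq(2)[OF \<open>(convol g (\<lambda>w. 1) has_derivative (\<lambda>h. 0 * h + 0 * cnj h)) (at 0)\<close>]
    by simp
  then show ?thesis by (simp add: convol_def)
qed

text \<open>
  The dbar derivative at 0 of the Cauchy transform of \<open>g\<close>. That it is a
  constant multiple of \<open>g 0\<close> is deduced from three properties: it is linear,
  it depends only on \<open>g\<close> near 0, and it vanishes if \<open>g 0 = 0\<close>.
\<close>

definition cauchy0 :: "(complex \<Rightarrow> complex) \<Rightarrow> complex" where
  "cauchy0 g = convol (wirtinger_bar g) (\<lambda>w. 1 / w) 0"

text \<open>
  The kernel is holomorphic off 0 and can be absorbed into \<open>g\<close>, so the
  integrand is a dbar derivative.
\<close>

lemma cauchy0_eq_0_away: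
  assumes g: "C1c g" and r: "r > 0" "\<And>u. cmod u < r \<Longrightarrow> g u = 0"
  shows "cauchy0 g = 0"
proof -
  define H where "H u = (1 / u) * g u" for u
  have zero_near: "has_dbar f 0 u" if "\<And>v. cmod v < r \<Longrightarrow> f v = 0" "cmod u < r" for f u
    by (rule has_dbar_transform[OF has_dbar_const[of 0], where S="ball 0 r"]) (use that in auto)
  have C: "C1_on UNIV H"
  proof (rule C1_on_local)
    fix z :: complex
    show "\<exists>U. open U \<and> z \<in> U \<and> C1_on U H"
    proof (cases "z = 0")
      case True
      have "C1_on (ball 0 r) H"
        by (rule C1_on_cong[OF C1_on_const[of _ 0]]) (use r(2) in \<open>auto simp: H_def\<close>)
      then show ?thesis using True r(1) by (intro exI[of _ "ball 0 r"]) auto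
    next
      case False
      have "C1_on (- {0}) H" unfolding H_def[abs_def]
        by (intro C1_on_mult C1_on_holomorphic holomorphic_intros C1_on_subset[OF C1cD(1)[OF g]]) auto
      then show ?thesis using False by (intro exI[of _ "- {0}"]) auto
    qed
  qed
  then have Hc: "C1c H" using g unfolding C1c_def H_def by auto
  have b: "wirtinger_bar H u = (1 / u) * wirtinger_bar g u" for u
  proof (cases "u = 0")
    case True
    have "has_dbar H 0 0" by (rule zero_near) (use r in \<open>auto simp: H_def\<close>)
    then show ?thesis using True wirtinger_bar_eqI by simp
  next
    case False
    have "has_dbar (\<lambda>u. 1 / u) 0 u"
      by (rule has_dbar_holomorphic[where S="- {0}"]) (use False in \<open>auto intro!: holomorphic_intros\<close>)
    from has_dbar_mult[OF this C1cD(2)[OF g]] show ?thesis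
      unfolding H_def by (intro wirtinger_bar_eqI) simp
  qed
  have "(LINT w|lborel. - wirtinger_bar H (- w)) = 0"
    using integral_wirtinger_bar_eq_0[OF Hc] by simp
  then show ?thesis by (simp add: cauchy0_def convol_def b)
qed

lemma cauchy0_diff:
  assumes "C1c f" "C1c g" shows "cauchy0 (\<lambda>z. f z - g z) = cauchy0 f - cauchy0 g"
proof -
  have i: "integrable lborel (\<lambda>w. wirtinger_bar h (0 - w) * (1 / w))" if h: "C1c h" for h
  proof -
    obtain \<rho> where \<rho>: "\<And>w. cmod w \<ge> \<rho> \<Longrightarrow> h w = 0" "C1_on UNIV h" using h by (auto simp: C1c_def)
    show ?thesis
      by (rule convol_integrable_bound(1)[OF _ wirtinger_support(2)[of \<rho>] set_integrable_inverse order_refl])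
        (use \<rho> in \<open>auto simp: C1_on_def\<close>)
  qed
  have "wirtinger_bar (\<lambda>z. f z - g z) w = wirtinger_bar f w - wirtinger_bar g w" for w
    by (intro wirtinger_bar_eqI has_dbar_diff C1cD assms)
  then show ?thesis using i[OF assms(1)] i[OF assms(2)]
    by (simp add: cauchy0_def convol_def left_diff_distrib Bochner_Integration.integral_diff diff_divide_distrib)
qed

lemma cauchy0_cmult:
  assumes "C1c f" shows "cauchy0 (\<lambda>z. c * f z) = c * cauchy0 f"
proof -
  have "wirtinger_bar (\<lambda>z. c * f z) w = c * wirtinger_bar f w" for w
    by (intro wirtinger_bar_eqI has_dbar_cmult C1cD assms)
  then show ?thesis by (simp add: cauchy0_def convol_def mult.assoc flip: times_divide_eq_right)
qed

lemma integral_inverse_small: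
  "(\<lambda>n. LINT w|lborel. cmod (indicator (cball 0 (1 / real (Suc n))) w *\<^sub>R (1 / w :: complex))) \<longlonglongrightarrow> 0"
proof -
  have i: "integrable lborel (\<lambda>w::complex. indicator (cball 0 R) w *\<^sub>R (1 / w))" for R
    using set_integrable_inverse unfolding set_integrable_def .
  have "(\<lambda>n. LINT w|lborel. cmod (indicator (cball 0 (1 / real (Suc n))) w *\<^sub>R (1 / w :: complex)))
     \<longlonglongrightarrow> (LINT w::complex|lborel. 0)"
  proof (rule integral_dominated_convergence[where w="\<lambda>w. cmod (indicator (cball 0 1) w *\<^sub>R (1 / w :: complex))"])
    show "integrable lborel (\<lambda>w. cmod (indicator (cball 0 1) w *\<^sub>R (1 / w :: complex)))"
      by (intro integrable_norm i)
    show "(\<lambda>w. cmod (indicator (cball 0 (1 / real (Suc n))) w *\<^sub>R (1 / w))) \<in> borel_measurable lborel" for n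
      using i borel_measurable_integrable integrable_norm by blast
    show "AE w in lborel. norm (cmod (indicator (cball 0 (1 / real (Suc n))) w *\<^sub>R (1 / w)))
        \<le> cmod (indicator (cball 0 1) w *\<^sub>R (1 / w :: complex))" for n
    proof (rule AE_I2)
      fix w :: complex
      have "cball (0::complex) (1 / real (Suc n)) \<subseteq> cball 0 1" by (rule subset_cball) simp
      then have "w \<in> cball 0 (1 / real (Suc n)) \<Longrightarrow> w \<in> cball 0 1" by blast
      then show "norm (cmod (indicator (cball 0 (1 / real (Suc n))) w *\<^sub>R (1 / w)))
        \<le> cmod (indicator (cball 0 1) w *\<^sub>R (1 / w :: complex))"
        by (auto simp: indicator_def simp del: mem_cball mem_cball_0)
    qed
    show "AE w in lborel. (\<lambda>n. cmod (indicator (cball 0 (1 / real (Suc n))) w *\<^sub>R (1 / w :: complex))) \<longlonglongrightarrow> 0"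
    proof (rule AE_I2)
      fix w :: complex
      show "(\<lambda>n. cmod (indicator (cball 0 (1 / real (Suc n))) w *\<^sub>R (1 / w :: complex))) \<longlonglongrightarrow> 0"
      proof (cases "w = 0")
        case False
        then have "\<forall>\<^sub>F n in sequentially. 1 / real (Suc n) < cmod w"
          using LIMSEQ_inverse_real_of_nat by (simp add: order_tendsto_iff inverse_eq_divide)
        then have "\<forall>\<^sub>F n in sequentially. cmod (indicator (cball 0 (1 / real (Suc n))) w *\<^sub>R (1 / w :: complex)) = 0"
          by eventually_elim (auto simp: indicator_def)
        then show ?thesis by (rule tendsto_eventually)
      qed simp
    qed
  qed simp_all
  then show ?thesis by simp
qed

text \<open>
  By locality, \<open>g\<close> can be replaced by its product with the cutoff of the disc
  of radius \<open>s\<close>. There \<open>g\<close> is at most \<open>C * s\<close> and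
  the derivative of the cutoff at most \<open>D / s\<close>, so the dbar derivative of the
  product remains bounded, while the integral of the kernel over the disc tends to 0 with
  \<open>s\<close>.
\<close>

lemma cauchy0_eq_0_vanishing:
  assumes g: "C1c g" and g0: "g 0 = 0" shows "cauchy0 g = 0"
proof -
  obtain \<rho> where \<rho>: "\<And>w. cmod w \<ge> \<rho> \<Longrightarrow> g w = 0" using g by (auto simp: C1c_def)
  have cb: "continuous_on UNIV (wirtinger_bar g)" using C1cD(1)[OF g] by (simp add: C1_on_def)
  obtain B where B: "B > 0" "\<And>w. cmod (wirtinger_bar g w) \<le> B"
    using compact_support_bounded[OF cb wirtinger_support(2)[of \<rho>, OF \<rho>]] by metis
  obtain D where D: "D > 0" "\<And>c r z. r > 0 \<Longrightarrow> cmod (dbump c r z) \<le> D / r"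
    using norm_dbump_le by blast
  obtain d where d: "d > 0" "\<And>x h. cmod h < d \<Longrightarrow>
    cmod (g (x + h) - g x - (wirtinger g x * h + wirtinger_bar g x * cnj h)) \<le> 1 * cmod h"
    using C1c_uniform_linearization[OF g zero_less_one] by blast
  define C where "C = cmod (wirtinger g 0) + cmod (wirtinger_bar g 0) + 1"
  have C0: "C > 0" by (auto simp: C_def intro: add_nonneg_pos)
  have gC: "cmod (g h) \<le> C * cmod h" if "cmod h < d" for h
  proof -
    have "g h = (g (0 + h) - g 0 - (wirtinger g 0 * h + wirtinger_bar g 0 * cnj h)) + wirtinger g 0 * h + wirtinger_bar g 0 * cnj h"
      using g0 by simp
    also have "cmod \<dots> \<le> 1 * cmod h + cmod (wirtinger g 0) * cmod h + cmod (wirtinger_bar g 0) * cmod h"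
      using d(2)[OF that, of 0] by (intro norm_triangle_mono) (auto simp: norm_mult)
    finally show ?thesis by (simp add: C_def algebra_simps)
  qed
  let ?J = "\<lambda>s. LINT w|lborel. cmod (indicator (cball 0 s) w *\<^sub>R (1 / w :: complex))"
  have bound: "cmod (cauchy0 g) \<le> (B + C * D) * ?J s" if s: "s > 0" "s < d" for s
  proof -
    define f where "f u = bump 0 s u * g u" for u
    have fc: "C1c f" unfolding f_def by (intro C1c_mult_left C1_bump g)
    have "cauchy0 (\<lambda>u. g u - f u) = 0"
      by (rule cauchy0_eq_0_away[where r="s/2"]) (use s C1c_diff[OF g fc] in \<open>auto simp: f_def bump_eq_1\<close>)
    then have eq: "cauchy0 g = cauchy0 f" using cauchy0_diff[OF g fc] by simp
    have db: "wirtinger_bar f u = bump 0 s u * wirtinger_bar g u + dbump 0 s u * g u" for u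
      unfolding f_def by (intro wirtinger_bar_eqI has_dbar_mult has_dbar_bump C1cD g)
    have zero: "wirtinger_bar f u = 0" if "cmod u \<ge> s" for u
      using that s by (simp add: db bump_eq_0 dbump_eq_0)
    have le: "cmod (wirtinger_bar f u) \<le> B + C * D" for u
    proof (cases "cmod u \<ge> s")
      case True then show ?thesis using zero B(1) C0 D(1) by simp
    next
      case False
      have "cmod (wirtinger_bar f u) \<le> 1 * B + D / s * (C * s)"
        unfolding db
      proof (intro norm_triangle_mono)
        show "cmod (bump 0 s u * wirtinger_bar g u) \<le> 1 * B"
          unfolding norm_mult by (intro mult_mono norm_bump_le B) auto
        have "cmod (g u) \<le> C * s" 
          by (rule order_trans[OF gC mult_left_mono]) (use False s C0 in auto)
        then show "cmod (dbump 0 s u * g u) \<le> D / s * (C * s)"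
          unfolding norm_mult using D s by (intro mult_mono) auto
      qed
      then show ?thesis using s by (simp add: mult.commute)
    qed
    have "continuous_on UNIV (wirtinger_bar f)" using C1cD(1)[OF fc] by (simp add: C1_on_def)
    from convol_integrable_bound(2)[where z=0 and R=s and \<rho>=s, OF this zero set_integrable_inverse _ le]
    have "cmod (cauchy0 f) \<le> (B + C * D) * ?J s" unfolding cauchy0_def by simp
    then show ?thesis by (simp only: eq)
  qed
  have "(\<lambda>n. (B + C * D) * ?J (1 / real (Suc n))) \<longlonglongrightarrow> (B + C * D) * 0"
    by (intro tendsto_intros integral_inverse_small)
  moreover have "\<forall>\<^sub>F n in sequentially. cmod (cauchy0 g) \<le> (B + C * D) * ?J (1 / real (Suc n))"
  proof -
    have "\<forall>\<^sub>F n in sequentially. 1 / real (Suc n) < d"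
      using LIMSEQ_inverse_real_of_nat d(1) by (simp add: order_tendsto_iff inverse_eq_divide)
    then show ?thesis by eventually_elim (rule bound, auto)
  qed
  ultimately have "cmod (cauchy0 g) \<le> (B + C * D) * 0"
    by (intro tendsto_lowerbound) auto
  then show ?thesis by simp
qed

text \<open>
  For a radial bump the integrand is \<open>- cutoff' ((cmod w)\<^sup>2)\<close>, which
  is nonnegative.
\<close>

lemma cauchy0_bump_nonzero: "cauchy0 (bump 0 1) \<noteq> 0"
proof -
  define q where "q w = - cutoff' ((cmod w)\<^sup>2)" for w :: complex
  have cq: "continuous_on UNIV q"
    unfolding q_def by (intro continuous_intros continuous_on_compose2[OF continuous_cutoff']) auto
  have q0: "q w \<ge> 0" for w using cutoff'_nonpos by (simp add: q_def)
  have sup: "q w = 0" if "cmod w \<ge> 1" for w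
    using that by (simp add: q_def cutoff'_eq_0)
  have int: "integrable lborel q"
  proof -
    have "integrable lborel (\<lambda>x. indicator (cball 0 1) x *\<^sub>R q x)"
      by (rule borel_integrable_compact) (auto intro: continuous_on_subset[OF cq])
    moreover have "(\<lambda>x. indicator (cball 0 1) x *\<^sub>R q x) = q"
      using sup by (auto simp: indicator_def fun_eq_iff)
    ultimately show ?thesis by simp
  qed
  have eq: "cauchy0 (bump 0 1) = of_real (LINT w|lborel. q w)"
  proof -
    have "wirtinger_bar (bump 0 1) (0 - w) * (1 / w) = of_real (q w)" for w
    proof (cases "w = 0")
      case True then show ?thesis using cutoff'_eq_0[of 0] by (simp add: q_def)
    next
      case False
      then show ?thesis
        using wirtinger_bar_eqI[OF has_dbar_bump, of 0 1 "- w"] by (simp add: dbump_def q_def)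
    qed
    then show ?thesis unfolding cauchy0_def convol_def by simp
  qed
  define w0 where "w0 = complex_of_real (sqrt (1/2))"
  have "q w0 > 0" using cutoff'_half by (simp add: q_def w0_def)
  moreover have "isCont q w0" using cq by (simp add: continuous_on_eq_continuous_at)
  ultimately have "\<forall>\<^sub>F w in at w0. q w > q w0 / 2"
    by (intro order_tendstoD(1)[where y="q w0"]) (auto simp: isCont_def)
  then obtain r where r: "r > 0" "\<And>w. w \<noteq> w0 \<Longrightarrow> dist w w0 < r \<Longrightarrow> q w > q w0 / 2"
    unfolding eventually_at by auto
  have le: "q w0 / 2 * indicator (ball w0 r) w \<le> q w" for w
    using r(2)[of w] \<open>q w0 > 0\<close> q0[of w] by (cases "w = w0") (auto simp: indicator_def dist_commute)
  have "integrable lborel (\<lambda>w. q w0 / 2 * indicator (ball w0 r) w :: real)"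
    by (intro integrable_mult_right integrable_real_indicator) (use emeasure_bounded_finite[OF bounded_ball, of w0 r] in auto)
  then have "(LINT w|lborel. q w0 / 2 * indicator (ball w0 r) w) \<le> (LINT w|lborel. q w)"
    by (rule integral_mono[OF _ int le])
  moreover have "(LINT w|lborel. q w0 / 2 * indicator (ball w0 r) w) = q w0 / 2 * measure lborel (ball w0 r)"
    by simp
  moreover have "q w0 / 2 * measure lborel (ball w0 r) > 0"
    using \<open>q w0 > 0\<close> content_ball_pos[OF r(1), of w0] by simp
  ultimately show ?thesis unfolding eq by simp
qed

text \<open>
  The solution is the Cauchy transform, divided by the normalising constant
  \<open>\<kappa>\<close>. By translation it is enough to look at one point, and there
  subtracting a multiple of the bump function reduces to a function that vanishes at this
  point. The constant depends only on the two radii, since it is an integral of the kernel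
  over a disc; so it is the same for all cells of a covering.
\<close>

theorem dbar_solution_compact:
  "\<exists>C>0. \<forall>c g. C1_on UNIV g \<longrightarrow> (\<forall>w. cmod (w - c) \<ge> \<rho> \<longrightarrow> g w = 0) \<longrightarrow>
    (\<exists>u. (\<forall>z. has_dbar u (g z) z) \<and>
       (\<forall>S z. (\<forall>w. cmod (g w) \<le> S) \<longrightarrow> cmod (z - c) \<le> R \<longrightarrow> cmod (u z) \<le> C * S))"
proof -
  define \<kappa> where "\<kappa> = cauchy0 (bump 0 1)"
  have \<kappa>: "\<kappa> \<noteq> 0" unfolding \<kappa>_def by (rule cauchy0_bump_nonzero)
  define J where "J = (LINT w|lborel. cmod (indicator (cball 0 (R + \<rho>)) w *\<^sub>R (1 / w :: complex)))"
  have J0: "J \<ge> 0" unfolding J_def by (rule integral_nonneg_AE) auto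
  have repr: "cauchy0 g = g 0 * \<kappa>" if g: "C1c g" for g
  proof -
    have b: "C1c (\<lambda>u. g 0 * bump 0 1 u)" by (intro C1c_mult_left C1_on_const C1c_bump) auto
    have "cauchy0 (\<lambda>u. g u - g 0 * bump 0 1 u) = 0"
      by (rule cauchy0_eq_0_vanishing) (use g b in \<open>auto simp: bump_eq_1 intro!: C1c_diff\<close>)
    then show ?thesis
      using cauchy0_diff[OF g b] cauchy0_cmult[OF C1c_bump, of 1 "g 0"] by (simp add: \<kappa>_def)
  qed
  show ?thesis
  proof (intro exI[of _ "(J + 1) / cmod \<kappa>"] conjI allI impI)
    show "(J + 1) / cmod \<kappa> > 0" using J0 \<kappa> by simp
    fix c g assume C1: "C1_on UNIV g" and supp: "\<forall>w. cmod (w - c) \<ge> \<rho> \<longrightarrow> g w = 0"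
    have shift: "((\<lambda>w. g (a + w)) has_derivative (\<lambda>h. wirtinger g (a + z) * h + wirtinger_bar g (a + z) * cnj h)) (at z)" for a z
    proof -
      have "((\<lambda>w. a + w) has_derivative (\<lambda>h. h)) (at z)" by (auto intro!: derivative_eq_intros)
      from has_derivative_compose[OF this C1_onD(1)[OF C1 UNIV_I]] show ?thesis .
    qed
    have sc: "C1c (\<lambda>w. g (a + w))" for a
      unfolding C1c_def
    proof
      show "C1_on UNIV (\<lambda>w. g (a + w))"
        by (rule C1_onI[OF shift]) (use C1 in \<open>auto simp: C1_on_def intro!: continuous_intros elim: continuous_on_compose2\<close>)
      show "\<exists>\<rho>. \<forall>w. \<rho> \<le> cmod w \<longrightarrow> g (a + w) = 0"
      proof (intro exI[of _ "\<rho> + cmod (a - c)"] allI impI)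
        fix w assume "\<rho> + cmod (a - c) \<le> cmod w"
        moreover have "cmod w \<le> cmod (a + w - c) + cmod (a - c)"
          using norm_triangle_ineq4[of "a + w - c" "a - c"] by simp
        ultimately show "g (a + w) = 0" using supp by simp
      qed
    qed
    define u where "u z = convol (\<lambda>w. g (c + w)) (\<lambda>w. 1 / w) (z - c) / \<kappa>" for z
    have du: "has_dbar u (g z) z" for z
    proof -
      have "has_dbar (convol (\<lambda>w. g (c + w)) (\<lambda>w. 1 / w))
          (convol (wirtinger_bar (\<lambda>w. g (c + w))) (\<lambda>w. 1 / w) (z - c)) (z - c)"
        unfolding has_dbar_def using has_derivative_convol[OF sc set_integrable_inverse] by blast
      moreover have "convol (wirtinger_bar (\<lambda>w. g (c + w))) (\<lambda>w. 1 / w) (z - c) = cauchy0 (\<lambda>w. g (z + w))"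
        using wirtinger_eq(2)[OF shift] by (simp add: convol_def cauchy0_def)
      moreover have "cauchy0 (\<lambda>w. g (z + w)) = g z * \<kappa>" using repr[OF sc] by simp
      ultimately have "has_dbar (convol (\<lambda>w. g (c + w)) (\<lambda>w. 1 / w)) (g z * \<kappa>) (z - c)" by simp
      then obtain a where a: "(convol (\<lambda>w. g (c + w)) (\<lambda>w. 1 / w) has_derivative (\<lambda>h. a * h + g z * \<kappa> * cnj h)) (at (z - c))"
        by (auto simp: has_dbar_def)
      have "((\<lambda>w. w - c) has_derivative (\<lambda>h. h)) (at z)" by (auto intro!: derivative_eq_intros)
      from has_derivative_compose[OF this a]
      have "has_dbar (\<lambda>z. convol (\<lambda>w. g (c + w)) (\<lambda>w. 1 / w) (z - c)) (g z * \<kappa>) z"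
        unfolding has_dbar_def by blast
      from has_dbar_cmult[OF this, of "1 / \<kappa>"] show ?thesis
        using \<kappa> by (simp add: u_def[abs_def])
    qed
    have bu: "cmod (u z) \<le> (J + 1) / cmod \<kappa> * S" if S: "\<forall>w. cmod (g w) \<le> S" and z: "cmod (z - c) \<le> R" for S z
    proof -
      have "cmod (convol (\<lambda>w. g (c + w)) (\<lambda>w. 1 / w) (z - c)) \<le> S * J"
        unfolding J_def
      proof (rule convol_integrable_bound(2)[OF C1cD(3)[OF sc] _ set_integrable_inverse])
        show "g (c + w) = 0" if "\<rho> \<le> cmod w" for w using supp that by simp
      qed (use S z in auto)
      also have "\<dots> \<le> S * (J + 1)"
        using S norm_ge_zero[of "g 0"] by (intro mult_left_mono) (auto intro: order_trans[OF norm_ge_zero])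
      finally show ?thesis using \<kappa> by (simp add: u_def norm_divide field_simps)
    qed
    show "\<exists>u. (\<forall>z. has_dbar u (g z) z) \<and>
       (\<forall>S z. (\<forall>w. cmod (g w) \<le> S) \<longrightarrow> cmod (z - c) \<le> R \<longrightarrow> cmod (u z) \<le> (J + 1) / cmod \<kappa> * S)"
      using du bu by blast
  qed
qed

section \<open>Solving the dbar equation with a weighted bound\<close>

locale locally_finite_points =
  fixes c :: "'i \<Rightarrow> complex" and \<epsilon> :: real
  assumes eps: "0 < \<epsilon>" and finite_cells: "\<And>z r. finite {i. cmod (z - c i) < r}"
begin

text \<open>
  In the disc of radius \<open>\<epsilon>\<close> about \<open>z0\<close> the index set of
  the sum can be made independent of \<open>z\<close>; the sum can then be differentiated
  term by term.
\<close>

lemma local_sum_eq: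
  assumes f: "\<And>i z. cmod (z - c i) \<ge> \<epsilon> \<Longrightarrow> f i z = (0::complex)" and z: "cmod (z - z0) < \<epsilon>"
  shows "(\<Sum>i | cmod (z - c i) < \<epsilon>. f i z) = (\<Sum>i | cmod (z0 - c i) < 2 * \<epsilon>. f i z)"
proof (rule sum.mono_neutral_left)
  show "finite {i. cmod (z0 - c i) < 2 * \<epsilon>}" by (rule finite_cells)
  show "{i. cmod (z - c i) < \<epsilon>} \<subseteq> {i. cmod (z0 - c i) < 2 * \<epsilon>}"
  proof
    fix i assume i: "i \<in> {i. cmod (z - c i) < \<epsilon>}"
    have "cmod (z0 - c i) \<le> cmod (z - c i) + cmod (z - z0)"
      using norm_triangle_ineq4[of "z - c i" "z - z0"] by simp
    then show "i \<in> {i. cmod (z0 - c i) < 2 * \<epsilon>}" using i z by simp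
  qed
  show "\<forall>i\<in>{i. cmod (z0 - c i) < 2 * \<epsilon>} - {i. cmod (z - c i) < \<epsilon>}. f i z = 0"
    using f by auto
qed

lemma has_dbar_local_sum:
  assumes f: "\<And>i z. cmod (z - c i) \<ge> \<epsilon> \<Longrightarrow> f i z = (0::complex)"
    and b: "\<And>i z. cmod (z - c i) \<ge> \<epsilon> \<Longrightarrow> b i z = (0::complex)"
    and d: "\<And>i z. has_dbar (f i) (b i z) z"
  shows "has_dbar (\<lambda>z. \<Sum>i | cmod (z - c i) < \<epsilon>. f i z) (\<Sum>i | cmod (z - c i) < \<epsilon>. b i z) z"
proof -
  note e0 = eps
  have "has_dbar (\<lambda>w. \<Sum>i | cmod (z - c i) < 2 * \<epsilon>. f i w) (\<Sum>i | cmod (z - c i) < 2 * \<epsilon>. b i z) z"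
    by (intro has_dbar_sum d)
  then have "has_dbar (\<lambda>z. \<Sum>i | cmod (z - c i) < \<epsilon>. f i z) (\<Sum>i | cmod (z - c i) < 2 * \<epsilon>. b i z) z"
    by (rule has_dbar_transform[where S="ball z \<epsilon>"])
      (use e0 local_sum_eq[where ?z0.0=z and f=f, OF f] in \<open>auto simp: dist_norm norm_minus_commute\<close>)
  then show ?thesis using local_sum_eq[where ?z0.0=z and z=z and f=b, OF b] e0 by simp
qed

lemma C1_local_sum:
  assumes f: "\<And>i z. cmod (z - c i) \<ge> \<epsilon> \<Longrightarrow> f i z = (0::complex)" and d: "\<And>i. C1_on UNIV (f i)"
  shows "C1_on UNIV (\<lambda>z. \<Sum>i | cmod (z - c i) < \<epsilon>. f i z)"
proof (rule C1_on_local)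
  fix z :: complex
  note e0 = eps
  have "C1_on (ball z \<epsilon>) (\<lambda>w. \<Sum>i | cmod (z - c i) < 2 * \<epsilon>. f i w)"
    using d C1_on_subset by (intro C1_on_sum) blast
  then have "C1_on (ball z \<epsilon>) (\<lambda>z. \<Sum>i | cmod (z - c i) < \<epsilon>. f i z)"
    by (rule C1_on_cong) (use local_sum_eq[where ?z0.0=z and f=f, OF f] in \<open>auto simp: dist_norm norm_minus_commute\<close>)
  then show "\<exists>U. open U \<and> z \<in> U \<and> C1_on U (\<lambda>z. \<Sum>i | cmod (z - c i) < \<epsilon>. f i z)"
    using e0 by (intro exI[of _ "ball z \<epsilon>"]) auto
qed

end

text \<open>
  The gap between the support radius \<open>\<delta>\<close> of the partition of unity and
  \<open>\<epsilon> / 2\<close> leaves room for an annulus around each cell in which local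
  solutions are cut off and where they are holomorphic. The functions
  \<open>\<psi> i\<close> are complex-valued only to fit the calculus of
  \<open>C1_on\<close>.
\<close>

locale cell_cover = locally_finite_points c \<epsilon>
  for c :: "'i \<Rightarrow> complex" and \<epsilon> :: real +
  fixes \<psi> :: "'i \<Rightarrow> complex \<Rightarrow> complex" and \<delta> :: real and N :: nat
  assumes delta: "0 < \<delta>" "\<delta> < \<epsilon> / 2"
    and psi_C1: "\<And>i. C1_on UNIV (\<psi> i)"
    and psi_support: "\<And>i z. cmod (z - c i) \<ge> \<delta> \<Longrightarrow> \<psi> i z = 0"
    and psi_norm: "\<And>i z. cmod (\<psi> i z) \<le> 1"
    and card_cells: "\<And>z. card {i. cmod (z - c i) < \<epsilon>} \<le> N"
    and psi_sum: "\<And>z. (\<Sum>i | cmod (z - c i) < \<epsilon>. \<psi> i z) = 1"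
begin

lemma norm_local_sum:
  assumes "\<And>i. cmod (z - c i) < \<epsilon> \<Longrightarrow> cmod (f i) \<le> B" "B \<ge> 0"
  shows "cmod (\<Sum>i | cmod (z - c i) < \<epsilon>. f i) \<le> real N * B"
proof -
  have "cmod (\<Sum>i | cmod (z - c i) < \<epsilon>. f i) \<le> (\<Sum>i | cmod (z - c i) < \<epsilon>. B)"
    by (rule sum_norm_le) (use assms in auto)
  also have "\<dots> = real (card {i. cmod (z - c i) < \<epsilon>}) * B" by simp
  also have "\<dots> \<le> real N * B" using card_cells assms(2) by (intro mult_right_mono) auto
  finally show ?thesis .
qed

text \<open>
  One step of the parametrix. The correction \<open>u\<close> is the sum over all cells of a
  cutoff times \<open>E i\<close> times a solution for
  \<open>\<psi> i * a / E i\<close>. Its dbar derivative is \<open>a\<close> up to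
  terms containing the derivative of a cutoff. Those live in the annuli
  \<open>\<epsilon> / 2 \<le> cmod (z - c i) < \<epsilon>\<close>, where the
  assumption with \<open>\<tau>\<close> makes them small compared with \<open>M\<close>.
\<close>

lemma dbar_step:
  assumes C: "C > 0" "\<And>c g. C1_on UNIV g \<Longrightarrow> (\<forall>w. cmod (w - c) \<ge> \<delta> \<longrightarrow> g w = 0) \<Longrightarrow>
      (\<exists>u. (\<forall>z. has_dbar u (g z) z) \<and>
       (\<forall>S z. (\<forall>w. cmod (g w) \<le> S) \<longrightarrow> cmod (z - c) \<le> \<epsilon> \<longrightarrow> cmod (u z) \<le> C * S))"
    and D: "D > 0" "\<And>c r z. r > 0 \<Longrightarrow> cmod (dbump c r z) \<le> D / r"
    and E: "\<And>i. E i holomorphic_on ball (c i) (2 * \<epsilon>)" "\<And>i z. z \<in> ball (c i) (2 * \<epsilon>) \<Longrightarrow> E i z \<noteq> 0"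
    and M: "\<And>z. M z > 0"
    and L: "\<And>i w z. cmod (w - c i) < \<delta> \<Longrightarrow> cmod (z - c i) < \<epsilon> \<Longrightarrow>
        M w * cmod (E i z) \<le> M' z * cmod (E i w)"
    and \<tau>: "\<And>i w z. cmod (w - c i) < \<delta> \<Longrightarrow> \<epsilon> / 2 \<le> cmod (z - c i) \<Longrightarrow> cmod (z - c i) < \<epsilon> \<Longrightarrow>
        M w * cmod (E i z) \<le> \<tau> * (M z * cmod (E i w))"
    and pos: "\<And>z. M' z \<ge> 0" "\<tau> \<ge> 0" "s \<ge> 0" and small: "real N * (D / \<epsilon> * (C * \<tau>)) \<le> 1/2"
    and a: "C1_on UNIV a" "\<And>z. cmod (a z) \<le> s * M z"
  shows "\<exists>u a1. (\<forall>z. has_dbar u (a z - a1 z) z) \<and> C1_on UNIV a1 \<and>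
     (\<forall>z. cmod (a1 z) \<le> s / 2 * M z) \<and> (\<forall>z. cmod (u z) \<le> real N * C * s * M' z)"
proof -
  have e0: "\<epsilon> > 0" using delta by simp
  define g where "g i z = (if cmod (z - c i) < 2 * \<epsilon> then \<psi> i z * a z * inverse (E i z) else 0)" for i z
  have g0: "g i z = 0" if "cmod (z - c i) \<ge> \<delta>" for i z using psi_support[OF that] by (simp add: g_def)
  have inB: "w \<in> ball (c i) (2 * \<epsilon>) \<longleftrightarrow> cmod (w - c i) < 2 * \<epsilon>" for w i
    by (simp add: dist_norm norm_minus_commute)
  have dB: "dist (c i) w = cmod (w - c i)" for w i by (simp add: dist_norm norm_minus_commute)
  have gC: "C1_on UNIV (g i)" for i
  proof (rule C1_on_local)
    fix z :: complex
    have 1: "C1_on (ball (c i) (2 * \<epsilon>)) (g i)"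
    proof (rule C1_on_cong)
      show "C1_on (ball (c i) (2 * \<epsilon>)) (\<lambda>z. \<psi> i z * a z * inverse (E i z))"
        by (intro C1_on_mult C1_on_subset[OF psi_C1] C1_on_subset[OF a(1)] C1_on_holomorphic
            holomorphic_on_inverse E open_ball) auto
    qed (auto simp: g_def dist_norm norm_minus_commute)
    have 2: "C1_on (- cball (c i) \<delta>) (g i)"
      by (rule C1_on_cong[OF C1_on_const[of _ 0]]) (use g0 in \<open>auto simp: dist_norm norm_minus_commute\<close>)
    show "\<exists>U. open U \<and> z \<in> U \<and> C1_on U (g i)"
    proof (cases "z \<in> ball (c i) (2 * \<epsilon>)")
      case True then show ?thesis using 1 by blast
    next
      case False
      then have "z \<in> - cball (c i) \<delta>" using delta by auto
      then show ?thesis using 2 by (intro exI[of _ "- cball (c i) \<delta>"]) auto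
    qed
  qed
  obtain u where u: "\<And>i z. has_dbar (u i) (g i z) z"
    and ub: "\<And>i S z. (\<forall>w. cmod (g i w) \<le> S) \<Longrightarrow> cmod (z - c i) \<le> \<epsilon> \<Longrightarrow> cmod (u i z) \<le> C * S"
  proof -
    have "\<forall>i. \<exists>u. (\<forall>z. has_dbar u (g i z) z) \<and>
       (\<forall>S z. (\<forall>w. cmod (g i w) \<le> S) \<longrightarrow> cmod (z - c i) \<le> \<epsilon> \<longrightarrow> cmod (u z) \<le> C * S)"
      using C(2)[OF gC] g0 by blast
    then show ?thesis using that by metis
  qed
  \<comment> \<open>Dividing by \<open>E i\<close> before and multiplying after the
    solution operator turns a bound on the quotient of weights into a bound on the solution;
    \<open>T\<close> will be \<open>M' z\<close> in the whole disc and
    \<open>\<tau> * M z\<close> in the annulus.\<close>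
  have key: "cmod (E i z) * cmod (u i z) \<le> C * (s * T)"
    if z: "cmod (z - c i) < \<epsilon>" and T: "\<And>w. cmod (w - c i) < \<delta> \<Longrightarrow> M w * cmod (E i z) \<le> T * cmod (E i w)"
      and T0: "T \<ge> 0" for i z T
  proof -
    have Ez: "E i z \<noteq> 0" by (rule E(2)[OF inB[THEN iffD2]]) (use z e0 in auto)
    have "cmod (u i z) \<le> C * (s * T / cmod (E i z))"
    proof (rule ub)
      show "\<forall>w. cmod (g i w) \<le> s * T / cmod (E i z)"
      proof
        fix w
        show "cmod (g i w) \<le> s * T / cmod (E i z)"
        proof (cases "cmod (w - c i) < \<delta>")
          case True
          have Ew: "E i w \<noteq> 0" by (rule E(2)[OF inB[THEN iffD2]]) (use True delta in auto)
          have "cmod (g i w) \<le> cmod (\<psi> i w) * cmod (a w) * inverse (cmod (E i w))"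
            by (simp add: g_def norm_mult norm_inverse)
          also have "\<dots> \<le> 1 * (s * M w) * inverse (cmod (E i w))"
            by (intro mult_right_mono mult_mono psi_norm a) (use pos in auto)
          also have "\<dots> \<le> s * T / cmod (E i z)"
            using mult_left_mono[OF T[OF True] pos(3)] Ez Ew by (simp add: field_simps)
          finally show ?thesis .
        next
          case False
          then show ?thesis using g0[of w i] M[of z] T0 pos by simp
        qed
      qed
    qed (use z in auto)
    then show ?thesis using Ez by (simp add: field_simps)
  qed
  define t where "t i z = (if cmod (z - c i) < 2 * \<epsilon> then bump (c i) \<epsilon> z * E i z * u i z else 0)" for i z
  define B where "B i z = (if cmod (z - c i) < 2 * \<epsilon> then dbump (c i) \<epsilon> z * E i z * u i z else 0)" for i z
  have t0: "t i z = 0" if "cmod (z - c i) \<ge> \<epsilon>" for i z using that e0 by (simp add: t_def bump_eq_0)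
  have B0: "B i z = 0" if "cmod (z - c i) \<ge> \<epsilon> \<or> cmod (z - c i) \<le> \<epsilon> / 2" for i z
    using that e0 dbump_eq_0[of \<epsilon> z "c i"] by (auto simp: B_def)
  have dt: "has_dbar (t i) (\<psi> i z * a z + B i z) z" for i z
  proof (cases "cmod (z - c i) < 2 * \<epsilon>")
    case True
    then have zB: "z \<in> ball (c i) (2 * \<epsilon>)" by (simp add: dB)
    have "has_dbar (\<lambda>z. bump (c i) \<epsilon> z * E i z * u i z)
       (bump (c i) \<epsilon> z * E i z * g i z + (bump (c i) \<epsilon> z * 0 + dbump (c i) \<epsilon> z * E i z) * u i z) z"
      by (intro has_dbar_mult has_dbar_bump u has_dbar_holomorphic[OF E(1)] zB open_ball)
    moreover have "bump (c i) \<epsilon> z * E i z * g i z = \<psi> i z * a z"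
    proof (cases "cmod (z - c i) < \<delta>")
      case True
      then have "bump (c i) \<epsilon> z = 1" using delta e0 by (intro bump_eq_1) auto
      then show ?thesis using E(2)[OF zB] zB by (simp add: g_def dB)
    next
      case False then show ?thesis using psi_support g0 by simp
    qed
    ultimately have "has_dbar (\<lambda>z. bump (c i) \<epsilon> z * E i z * u i z) (\<psi> i z * a z + B i z) z"
      using True by (simp add: B_def)
    then show ?thesis
      by (rule has_dbar_transform[where S="ball (c i) (2 * \<epsilon>)"]) (use zB in \<open>auto simp: t_def dB\<close>)
  next
    case False
    have "has_dbar (t i) 0 z"
      by (rule has_dbar_transform[OF has_dbar_const[of 0], where S="- cball (c i) \<epsilon>"])
        (use False e0 t0 in \<open>auto simp: dist_norm norm_minus_commute\<close>)
    then show ?thesis using False psi_support[of z i] delta by (simp add: B_def)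
  qed
  \<comment> \<open>The error term is again of class \<open>C\<^sup>1\<close>: it is
    supported where the local solution is holomorphic.\<close>
  have BC: "C1_on UNIV (B i)" for i
  proof (rule C1_on_local)
    fix z :: complex
    have 1: "C1_on (ball (c i) (\<epsilon> / 2)) (B i)"
      by (rule C1_on_cong[OF C1_on_const[of _ 0]]) (use B0 in \<open>auto simp: dist_norm norm_minus_commute\<close>)
    have 2: "C1_on (- cball (c i) \<epsilon>) (B i)"
      by (rule C1_on_cong[OF C1_on_const[of _ 0]]) (use B0 in \<open>auto simp: dist_norm norm_minus_commute\<close>)
    have o: "open (ball (c i) (2 * \<epsilon>) - cball (c i) \<delta>)" by auto
    have 3: "C1_on (ball (c i) (2 * \<epsilon>) - cball (c i) \<delta>) (B i)"
    proof (rule C1_on_cong[OF _ o])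
      have hol: "u i holomorphic_on (ball (c i) (2 * \<epsilon>) - cball (c i) \<delta>)"
      proof (rule has_dbar_zero_imp_holomorphic[OF o])
        fix w assume "w \<in> ball (c i) (2 * \<epsilon>) - cball (c i) \<delta>"
        then have "g i w = 0" by (intro g0) (auto simp: dist_norm norm_minus_commute)
        then show "has_dbar (u i) 0 w" using u[of i w] by simp
      qed
      show "C1_on (ball (c i) (2 * \<epsilon>) - cball (c i) \<delta>) (\<lambda>z. dbump (c i) \<epsilon> z * E i z * u i z)"
        by (intro C1_on_mult C1_on_holomorphic[OF hol o] C1_on_subset[OF C1_on_holomorphic[OF E(1)]]
            C1_on_subset[OF C1_dbump]) auto
    qed (auto simp: B_def dB)
    show "\<exists>U. open U \<and> z \<in> U \<and> C1_on U (B i)"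
    proof -
      consider "z \<in> ball (c i) (\<epsilon> / 2)" | "z \<in> - cball (c i) \<epsilon>" | "z \<in> ball (c i) (2 * \<epsilon>) - cball (c i) \<delta>"
        using delta e0 by force
      then show ?thesis using 1 2 3 o by cases (blast intro: open_Compl closed_cball open_ball)+
    qed
  qed
  define uu where "uu z = (\<Sum>i | cmod (z - c i) < \<epsilon>. t i z)" for z
  define a1 where "a1 z = (\<Sum>i | cmod (z - c i) < \<epsilon>. - B i z)" for z
  have "has_dbar uu (a z - a1 z) z" for z
  proof -
    have "has_dbar uu (\<Sum>i | cmod (z - c i) < \<epsilon>. \<psi> i z * a z + B i z) z"
      unfolding uu_def using psi_support delta B0 e0
      by (intro has_dbar_local_sum t0 dt) auto
    moreover have "(\<Sum>i | cmod (z - c i) < \<epsilon>. \<psi> i z * a z + B i z) = a z - a1 z"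
      using psi_sum[of z] by (simp add: sum.distrib a1_def sum_negf flip: sum_distrib_right)
    ultimately show ?thesis by simp
  qed
  moreover have "C1_on UNIV a1"
    unfolding a1_def
  proof (rule C1_local_sum)
    show "C1_on UNIV (\<lambda>z. - B i z)" for i using C1_on_diff[OF C1_on_const[of _ 0] BC] by simp
  qed (use B0 in auto)
  moreover have "cmod (a1 z) \<le> s / 2 * M z" for z
  proof -
    have "cmod (a1 z) \<le> real N * (D / \<epsilon> * (C * (s * \<tau> * M z)))"
      unfolding a1_def
    proof (rule norm_local_sum)
      show "0 \<le> D / \<epsilon> * (C * (s * \<tau> * M z))" using D(1) C(1) e0 pos M[of z] by simp
      fix i assume z: "cmod (z - c i) < \<epsilon>"
      show "cmod (- B i z) \<le> D / \<epsilon> * (C * (s * \<tau> * M z))"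
      proof (cases "\<epsilon> / 2 \<le> cmod (z - c i)")
        case True
        have "cmod (- B i z) \<le> cmod (dbump (c i) \<epsilon> z) * (cmod (E i z) * cmod (u i z))"
          using z by (simp add: B_def norm_mult)
        also have "\<dots> \<le> D / \<epsilon> * (C * (s * \<tau> * M z))"
          proof (rule mult_mono[OF D(2)[OF e0]])
            have "cmod (E i z) * cmod (u i z) \<le> C * (s * (\<tau> * M z))"
              by (rule key[OF z]) (use \<tau>[OF _ True z] pos(2) M[of z] in \<open>auto simp: mult.assoc\<close>)
            then show "cmod (E i z) * cmod (u i z) \<le> C * (s * \<tau> * M z)" by (simp add: mult.assoc)
          qed (use D e0 in auto)
        finally show ?thesis .
      next
        case False
        then show ?thesis using B0[of z i] D(1) C(1) e0 pos M[of z] by simp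
      qed
    qed
    also have "\<dots> = (real N * (D / \<epsilon> * (C * \<tau>))) * (s * M z)" by (simp add: algebra_simps)
    also have "\<dots> \<le> 1/2 * (s * M z)" using small pos M[of z] by (intro mult_right_mono) auto
    finally show ?thesis by simp
  qed
  moreover have "cmod (uu z) \<le> real N * C * s * M' z" for z
  proof -
    have "cmod (uu z) \<le> real N * (1 * (C * (s * M' z)))"
      unfolding uu_def
    proof (rule norm_local_sum)
      show "0 \<le> 1 * (C * (s * M' z))" using C(1) pos by simp
      fix i assume z: "cmod (z - c i) < \<epsilon>"
      have "cmod (t i z) \<le> cmod (bump (c i) \<epsilon> z) * (cmod (E i z) * cmod (u i z))"
        using z by (simp add: t_def norm_mult)
      also have "\<dots> \<le> 1 * (C * (s * M' z))"
        by (rule mult_mono[OF norm_bump_le key[OF z L[OF _ z] pos(1)]]) auto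
      finally show "cmod (t i z) \<le> 1 * (C * (s * M' z))" .
    qed
    then show ?thesis by (simp add: algebra_simps)
  qed
  ultimately show ?thesis by blast
qed

text \<open>
  Iteration of \<open>dbar_step\<close> produces corrections that decrease like
  \<open>2 ^ (- k)\<close> times \<open>V * M\<close>, where \<open>V\<close> is the
  loss that is admitted in the size of the solution, as opposed to the error. The series
  converges locally uniformly, and the derivative of its sum is not controlled; the equation
  is therefore expressed through the holomorphy of \<open>F - G * b\<close>, which
  passes to the limit.
\<close>

theorem dbar_solve:
  assumes C: "C > 0" "\<And>c g. C1_on UNIV g \<Longrightarrow> (\<forall>w. cmod (w - c) \<ge> \<delta> \<longrightarrow> g w = 0) \<Longrightarrow>
      (\<exists>u. (\<forall>z. has_dbar u (g z) z) \<and>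
       (\<forall>S z. (\<forall>w. cmod (g w) \<le> S) \<longrightarrow> cmod (z - c) \<le> \<epsilon> \<longrightarrow> cmod (u z) \<le> C * S))"
    and D: "D > 0" "\<And>c r z. r > 0 \<Longrightarrow> cmod (dbump c r z) \<le> D / r"
    and E: "\<And>i. E i holomorphic_on ball (c i) (2 * \<epsilon>)" "\<And>i z. z \<in> ball (c i) (2 * \<epsilon>) \<Longrightarrow> E i z \<noteq> 0"
    and M: "\<And>z. M z > 0"
    and L: "\<And>i w z. cmod (w - c i) < \<delta> \<Longrightarrow> cmod (z - c i) < \<epsilon> \<Longrightarrow>
        M w * cmod (E i z) \<le> V z * M z * cmod (E i w)"
    and \<tau>: "\<And>i w z. cmod (w - c i) < \<delta> \<Longrightarrow> \<epsilon> / 2 \<le> cmod (z - c i) \<Longrightarrow> cmod (z - c i) < \<epsilon> \<Longrightarrow>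
        M w * cmod (E i z) \<le> \<tau> * (M z * cmod (E i w))"
    and V: "\<And>z. V z \<ge> 0" "\<And>R. \<exists>Q. \<forall>z\<in>cball 0 R. V z \<le> Q"
    and pos0: "\<tau> \<ge> 0" "s \<ge> 0" and small: "real N * (D / \<epsilon> * (C * \<tau>)) \<le> 1/2"
    and a: "C1_on UNIV a" "\<And>z. cmod (a z) \<le> s * M z"
  shows "\<exists>b. (\<forall>z. cmod (b z) \<le> 2 * real N * C * s * (V z * M z)) \<and>
     (\<forall>F G. G holomorphic_on UNIV \<longrightarrow> (\<forall>z. has_dbar F (G z * a z) z) \<longrightarrow>
        (\<lambda>z. F z - G z * b z) holomorphic_on UNIV)"
proof -
  define M' where "M' z = V z * M z" for z
  have pos: "\<And>z. M' z \<ge> 0" "\<tau> \<ge> 0" "s \<ge> 0"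
    using V(1) M pos0 by (auto simp: M'_def intro: mult_nonneg_nonneg less_imp_le)
  have L': "\<And>i w z. cmod (w - c i) < \<delta> \<Longrightarrow> cmod (z - c i) < \<epsilon> \<Longrightarrow> M w * cmod (E i z) \<le> M' z * cmod (E i w)"
    using L by (simp add: M'_def)
  define P where "P r a \<longleftrightarrow> C1_on UNIV a \<and> (\<forall>z. cmod (a z) \<le> r * M z)" for r and a :: "complex \<Rightarrow> complex"
  define K where "K = real N * C"
  have K0: "K \<ge> 0" using C(1) by (simp add: K_def)
  have e0: "\<epsilon> > 0" using delta by simp
  have "\<forall>r a. r \<ge> 0 \<and> P r a \<longrightarrow> (\<exists>u a1. (\<forall>z. has_dbar u (a z - a1 z) z) \<and> P (r / 2) a1 \<and>
      (\<forall>z. cmod (u z) \<le> K * r * M' z))"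
  proof (intro allI impI)
    fix r a assume "r \<ge> 0 \<and> P r a"
    then show "\<exists>u a1. (\<forall>z. has_dbar u (a z - a1 z) z) \<and> P (r / 2) a1 \<and> (\<forall>z. cmod (u z) \<le> K * r * M' z)"
      using dbar_step[OF C D E M L' \<tau> pos(1,2) _ small, of r a] unfolding P_def K_def by blast
  qed
  then obtain U A where UA: "\<And>r a z. r \<ge> 0 \<Longrightarrow> P r a \<Longrightarrow> has_dbar (U r a) (a z - A r a z) z"
    "\<And>r a. r \<ge> 0 \<Longrightarrow> P r a \<Longrightarrow> P (r / 2) (A r a)"
    "\<And>r a z. r \<ge> 0 \<Longrightarrow> P r a \<Longrightarrow> cmod (U r a z) \<le> K * r * M' z"
    by metis
  define sq where "sq = rec_nat a (\<lambda>k. A (s / 2 ^ k))"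
  have sq: "sq 0 = a" "sq (Suc k) = A (s / 2 ^ k) (sq k)" for k by (auto simp: sq_def)
  have Pk: "P (s / 2 ^ k) (sq k)" for k
  proof (induction k)
    case 0 then show ?case using a by (simp add: sq P_def)
  next
    case (Suc k) then show ?case using UA(2)[of "s / 2 ^ k" "sq k"] pos by (simp add: sq mult.commute)
  qed
  define u where "u k = U (s / 2 ^ k) (sq k)" for k
  have du: "has_dbar (u k) (sq k z - sq (Suc k) z) z" for k z
    using UA(1)[OF _ Pk[of k]] pos by (simp add: u_def sq)
  have ub: "cmod (u k z) \<le> K * s * M' z * (1/2) ^ k" for k z
    using UA(3)[OF _ Pk[of k], of z] pos by (simp add: u_def power_one_over field_simps)
  have geo: "summable (\<lambda>k. B * (1/2) ^ k)" for B :: real by (intro summable_mult summable_geometric) simp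
  have su: "summable (\<lambda>k. u k z)" for z
    by (rule summable_comparison_test[OF _ geo]) (use ub in auto)
  define b where "b z = (\<Sum>k. u k z)" for z
  have bb: "cmod (b z) \<le> 2 * real N * C * s * M' z" for z
  proof -
    have "cmod (b z) \<le> (\<Sum>k. K * s * M' z * (1/2) ^ k)"
    proof -
      have sn: "summable (\<lambda>k. cmod (u k z))"
        by (rule summable_comparison_test[OF _ geo]) (use ub in auto)
      have "cmod (b z) \<le> (\<Sum>k. cmod (u k z))" unfolding b_def by (rule summable_norm[OF sn])
      also have "\<dots> \<le> (\<Sum>k. K * s * M' z * (1/2) ^ k)" by (intro suminf_le ub sn geo)
      finally show ?thesis .
    qed
    also have "\<dots> = K * s * M' z * 2" by (subst suminf_mult) (auto simp: suminf_geometric intro: summable_geometric)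
    finally show ?thesis by (simp add: K_def algebra_simps)
  qed
  \<comment> \<open>On a cell, the assumption with \<open>V\<close> compares
    \<open>M\<close> with its value at the centre, so \<open>M\<close> is locally
    bounded.\<close>
  have Mb: "\<exists>Q. \<forall>z\<in>cball 0 R. M z \<le> Q" for R
  proof -
    define I where "I = {i. cmod (0 - c i) < R + \<delta>}"
    have fI: "finite I" unfolding I_def by (rule finite_cells)
    have "\<exists>Q\<ge>0. \<forall>w. cmod (w - c i) < \<delta> \<longrightarrow> M w \<le> Q" for i
    proof -
      have "continuous_on (cball (c i) \<delta>) (E i)"
        using delta by (intro continuous_on_subset[OF holomorphic_on_imp_continuous_on[OF E(1)]]) auto
      then have "bounded (E i ` cball (c i) \<delta>)"
        by (intro compact_imp_bounded compact_continuous_image) auto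
      then obtain H where H: "H > 0" "\<And>w. w \<in> cball (c i) \<delta> \<Longrightarrow> cmod (E i w) \<le> H"
        unfolding bounded_pos by blast
      have Ec: "E i (c i) \<noteq> 0" using E(2) e0 by simp
      have "M w \<le> M' (c i) * H / cmod (E i (c i))" if w: "cmod (w - c i) < \<delta>" for w
      proof -
        have "M w * cmod (E i (c i)) \<le> M' (c i) * cmod (E i w)"
          using L'[OF w, of "c i"] e0 by simp
        also have "\<dots> \<le> M' (c i) * H"
          using pos w H(2)[of w] by (intro mult_left_mono) (auto simp: dist_norm norm_minus_commute)
        finally show ?thesis using Ec by (simp add: field_simps)
      qed
      moreover have "M' (c i) * H / cmod (E i (c i)) \<ge> 0" using pos H(1) by simp
      ultimately show ?thesis by blast
    qed
    then obtain Q where Q: "\<And>i. Q i \<ge> 0" "\<And>i w. cmod (w - c i) < \<delta> \<Longrightarrow> M w \<le> Q i" by metis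
    have "M z \<le> (\<Sum>i\<in>I. Q i)" if z: "z \<in> cball 0 R" for z
    proof -
      have "(\<Sum>i | cmod (z - c i) < \<epsilon>. \<psi> i z) \<noteq> 0" using psi_sum by simp
      then obtain i where i: "\<psi> i z \<noteq> 0" by (metis (no_types, lifting) sum.neutral)
      then have zi: "cmod (z - c i) < \<delta>" using psi_support[of z i] by force
      have "cmod (c i) \<le> cmod z + cmod (z - c i)" using norm_triangle_ineq4[of z "z - c i"] by simp
      then have "i \<in> I" using zi z by (simp add: I_def)
      then have "Q i \<le> (\<Sum>i\<in>I. Q i)" using fI Q(1) by (intro member_le_sum) auto
      then show ?thesis using Q(2)[OF zi] by simp
    qed
    then show ?thesis by blast
  qed
  have "(\<lambda>z. F z - G z * b z) holomorphic_on UNIV"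
    if G: "G holomorphic_on UNIV" and F: "\<And>z. has_dbar F (G z * a z) z" for F G
  proof (rule holomorphic_limit_dbar[where F="\<lambda>n z. F z - (\<Sum>k<n. G z * u k z)" and \<beta>="\<lambda>n z. G z * sq n z"])
    show "has_dbar (\<lambda>z. F z - (\<Sum>k<n. G z * u k z)) (G z * sq n z) z" for n z
    proof -
      have "has_dbar (\<lambda>z. G z * u k z) (G z * (sq k z - sq (Suc k) z)) z" for k
        using has_dbar_mult[OF has_dbar_holomorphic[OF G open_UNIV UNIV_I] du] by simp
      then have d: "has_dbar (\<lambda>z. F z - (\<Sum>k<n. G z * u k z))
          (G z * a z - (\<Sum>k<n. G z * (sq k z - sq (Suc k) z))) z"
        by (intro has_dbar_diff F has_dbar_sum)
      have t: "(\<Sum>k<n. G z * (sq k z - sq (Suc k) z)) = G z * (a z - sq n z)"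
        using sum_lessThan_telescope'[of "\<lambda>k. sq k z" n] by (simp only: sum_distrib_left[symmetric] sq(1))
      show ?thesis using d unfolding t by (simp add: right_diff_distrib)
    qed
    fix R
    obtain Q where Q: "\<And>z. z \<in> cball 0 R \<Longrightarrow> M z \<le> Q" using Mb by blast
    have "bounded (G ` cball 0 R)"
      by (intro compact_imp_bounded compact_continuous_image
          continuous_on_subset[OF holomorphic_on_imp_continuous_on[OF G]]) auto
    then obtain H where H: "H > 0" "\<And>w. w \<in> cball 0 R \<Longrightarrow> cmod (G w) \<le> H"
      unfolding bounded_pos by blast
    obtain Q' where Q': "\<And>z. z \<in> cball 0 R \<Longrightarrow> V z \<le> Q'" using V(2) by blast
    have GM': "cmod (G z) * M' z \<le> H * (Q' * Q)" if "z \<in> cball 0 R" for z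
      unfolding M'_def using H(1) H(2)[OF that] Q[OF that] Q'[OF that] V(1)[of z] M[of z]
      by (intro mult_mono) auto
    have GM: "cmod (G z) * M z \<le> H * Q" if "z \<in> cball 0 R" for z
      using H Q that M[of z] by (intro mult_mono) auto
    have "uniform_limit (cball 0 R) (\<lambda>n z. \<Sum>k<n. G z * u k z) (\<lambda>z. \<Sum>k. G z * u k z) sequentially"
    proof (rule Weierstrass_m_test[OF _ geo[of "K * s * (H * (Q' * Q))"]])
      fix k and z :: complex assume z: "z \<in> cball 0 R"
      have "cmod (G z * u k z) \<le> cmod (G z) * (K * s * M' z * (1/2) ^ k)"
        unfolding norm_mult by (intro mult_left_mono ub) auto
      also have "\<dots> = K * s * (1/2) ^ k * (cmod (G z) * M' z)" by simp
      also have "\<dots> \<le> K * s * (1/2) ^ k * (H * (Q' * Q))"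
        using GM'[OF z] K0 pos by (intro mult_left_mono) auto
      finally show "cmod (G z * u k z) \<le> K * s * (H * (Q' * Q)) * (1/2) ^ k" by (simp add: algebra_simps)
    qed
    moreover have "(\<Sum>k. G z * u k z) = G z * b z" for z unfolding b_def by (rule suminf_mult[OF su])
    ultimately show "uniform_limit (cball 0 R) (\<lambda>n z. F z - (\<Sum>k<n. G z * u k z)) (\<lambda>z. F z - G z * b z) sequentially"
      by (intro uniform_limit_minus uniform_limit_const) simp
    show "uniform_limit (cball 0 R) (\<lambda>n z. G z * sq n z) (\<lambda>_. 0) sequentially"
    proof (rule uniform_limitI)
      fix e :: real assume e: "e > 0"
      have "(\<lambda>n. s * (H * Q) * (1/2) ^ n) \<longlonglongrightarrow> s * (H * Q) * 0"
        by (intro tendsto_intros LIMSEQ_power_zero) auto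
      then have "\<forall>\<^sub>F n in sequentially. s * (H * Q) * (1/2) ^ n < e"
        using e by (intro order_tendstoD(2)) auto
      then show "\<forall>\<^sub>F n in sequentially. \<forall>z\<in>cball 0 R. dist (G z * sq n z) 0 < e"
      proof eventually_elim
        case (elim n)
        show ?case
        proof
          fix z :: complex assume z: "z \<in> cball 0 R"
          have "cmod (G z * sq n z) \<le> cmod (G z) * (s / 2 ^ n * M z)"
            unfolding norm_mult using Pk[of n] by (intro mult_left_mono) (auto simp: P_def)
          also have "\<dots> = s * (1/2) ^ n * (cmod (G z) * M z)" by (simp add: power_one_over)
          also have "\<dots> \<le> s * (1/2) ^ n * (H * Q)" using GM[OF z] pos by (intro mult_left_mono) auto
          also have "\<dots> < e" using elim by (simp add: algebra_simps)
          finally show "dist (G z * sq n z) 0 < e" by (simp add: dist_norm)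
        qed
      qed
    qed
  qed
  then show ?thesis using bb unfolding M'_def by blast
qed

end

section \<open>A partition of unity on a square lattice\<close>

text \<open>
  The denominator is symmetric under exchange of \<open>x\<close> and
  \<open>1 - x\<close>, so the two values add up to 1; this makes the integer translates
  of \<open>hat\<close> a partition of unity.
\<close>

definition smooth_step :: "real \<Rightarrow> real" where
  "smooth_step x = max 0 x ^ 2 / (max 0 x ^ 2 + max 0 (1 - x) ^ 2)"

definition smooth_step' :: "real \<Rightarrow> real" where
  "smooth_step' x = (2 * max 0 x * (max 0 x ^ 2 + max 0 (1 - x) ^ 2) - max 0 x ^ 2 * (2 * max 0 x - 2 * max 0 (1 - x)))
     / ((max 0 x ^ 2 + max 0 (1 - x) ^ 2) * (max 0 x ^ 2 + max 0 (1 - x) ^ 2))"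

lemma smooth_step_denom: "max 0 x ^ 2 + max 0 (1 - x) ^ 2 > (0::real)"
proof (cases "x < 1")
  case True then show ?thesis by (intro add_nonneg_pos) (auto simp: max_def)
next
  case False then show ?thesis by (intro add_pos_nonneg) (auto simp: max_def)
qed

lemma DERIV_smooth_step: "(smooth_step has_real_derivative smooth_step' x) (at x)"
proof -
  have 1: "((\<lambda>x. max 0 x ^ 2) has_real_derivative 2 * max 0 x) (at x)"
    using DERIV_max_power[of 0 x] by (simp add: numeral_2_eq_2)
  have 2: "((\<lambda>x. max 0 (1 - x) ^ 2) has_real_derivative - (2 * max 0 (1 - x))) (at x)"
    by (rule DERIV_max_cube(3))
  have nz: "max 0 x ^ 2 + max 0 (1 - x) ^ 2 \<noteq> 0" using smooth_step_denom[of x] by linarith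
  show ?thesis unfolding smooth_step_def[abs_def] smooth_step'_def
    by (rule DERIV_cong[OF DERIV_divide[OF 1 DERIV_add[OF 1 2] nz]]) simp
qed

lemma continuous_smooth_step': "continuous_on UNIV smooth_step'"
  unfolding smooth_step'_def[abs_def]
proof (intro continuous_intros ballI)
  fix x :: real
  show "(max 0 x ^ 2 + max 0 (1 - x) ^ 2) * (max 0 x ^ 2 + max 0 (1 - x) ^ 2) \<noteq> 0"
    using smooth_step_denom[of x] by (metis less_irrefl mult_eq_0_iff)
qed

lemma smooth_step_eq:
  "x \<le> 0 \<Longrightarrow> smooth_step x = 0" "x \<ge> 1 \<Longrightarrow> smooth_step x = 1"
  by (simp_all add: smooth_step_def)

lemma smooth_step_add: "smooth_step x + smooth_step (1 - x) = 1"
proof -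
  have "smooth_step (1 - x) = max 0 (1 - x) ^ 2 / (max 0 x ^ 2 + max 0 (1 - x) ^ 2)"
    by (simp add: smooth_step_def add.commute)
  then have "smooth_step x + smooth_step (1 - x)
      = (max 0 x ^ 2 + max 0 (1 - x) ^ 2) / (max 0 x ^ 2 + max 0 (1 - x) ^ 2)"
    by (simp only: smooth_step_def add_divide_distrib)
  then show ?thesis using smooth_step_denom[of x] by (metis divide_self less_irrefl)
qed

lemma smooth_step_bounds: "0 \<le> smooth_step x" "smooth_step x \<le> 1"
proof -
  show 0: "0 \<le> smooth_step x" for x unfolding smooth_step_def by (intro divide_nonneg_nonneg add_nonneg_nonneg) auto
  show "smooth_step x \<le> 1" using smooth_step_add[of x] 0[of "1 - x"] by linarith
qed

definition hat :: "real \<Rightarrow> real" where "hat x = smooth_step (1 + x) * smooth_step (1 - x)"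

lemma hat_bounds: "0 \<le> hat x" "hat x \<le> 1"
  using smooth_step_bounds by (auto simp: hat_def mult_le_one)

lemma hat_eq_0: "\<bar>x\<bar> \<ge> 1 \<Longrightarrow> hat x = 0"
  by (auto simp: hat_def smooth_step_eq abs_if split: if_splits)

lemma sum_hat: "(\<Sum>k\<in>{\<lfloor>x\<rfloor>, \<lfloor>x\<rfloor> + 1}. hat (x - of_int k)) = 1"
proof -
  define t where "t = x - of_int \<lfloor>x\<rfloor>"
  have t: "0 \<le> t" "t \<le> 1" unfolding t_def by linarith+
  have "(\<Sum>k\<in>{\<lfloor>x\<rfloor>, \<lfloor>x\<rfloor> + 1}. hat (x - of_int k)) = hat t + hat (t - 1)"
    by (simp add: t_def algebra_simps)
  also have "hat t = smooth_step (1 - t)" using t by (simp add: hat_def smooth_step_eq)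
  also have "hat (t - 1) = smooth_step t" using t by (simp add: hat_def smooth_step_eq)
  finally show ?thesis using smooth_step_add[of t] by simp
qed

lemma C1_hat: "\<exists>h'. (\<forall>x. (hat has_real_derivative h' x) (at x)) \<and> continuous_on UNIV h'"
proof (intro exI conjI allI)
  let ?d = "\<lambda>x. smooth_step (1 + x) * (smooth_step' (1 - x) * (-1)) + smooth_step' (1 + x) * 1 * smooth_step (1 - x)"
  show "(hat has_real_derivative ?d x) (at x)" for x
  proof -
    have 1: "((\<lambda>x::real. 1 + x) has_real_derivative 1) (at x)" by (auto intro!: derivative_eq_intros)
    have 2: "((\<lambda>x::real. 1 - x) has_real_derivative -1) (at x)" by (auto intro!: derivative_eq_intros)
    show ?thesis unfolding hat_def[abs_def]
      by (rule DERIV_cong[OF DERIV_mult[OF DERIV_chain2[OF DERIV_smooth_step 1] DERIV_chain2[OF DERIV_smooth_step 2]]])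
        (simp add: algebra_simps)
  qed
  have c: "continuous_on UNIV smooth_step"
    using DERIV_smooth_step by (meson DERIV_isCont continuous_at_imp_continuous_on)
  show "continuous_on UNIV ?d"
    by (intro continuous_intros continuous_on_compose2[OF c] continuous_on_compose2[OF continuous_smooth_step']) auto
qed

definition lattice_point :: "real \<Rightarrow> int \<times> int \<Rightarrow> complex" where
  "lattice_point h i = Complex (h * of_int (fst i)) (h * of_int (snd i))"

definition lattice_hat :: "real \<Rightarrow> int \<times> int \<Rightarrow> complex \<Rightarrow> complex" where
  "lattice_hat h i z = of_real (hat (Re z / h - of_int (fst i))) * of_real (hat (Im z / h - of_int (snd i)))"

lemma C1_lattice_hat: "C1_on UNIV (lattice_hat h i)"
proof -
  obtain h' where h': "\<And>x. (hat has_real_derivative h' x) (at x)" "continuous_on UNIV h'"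
    using C1_hat by blast
  have re: "complex_of_real (Re z / h - of_int k) = of_real (1 / (2 * h)) * (z + cnj z) - of_int k" for z k
    by (simp add: complex_add_cnj)
  have im: "complex_of_real (Im z / h - of_int k) = of_real (1 / (2 * h)) * - \<i> * (z - cnj z) - of_int k" for z k
    by (simp add: complex_eq_iff)
  have "C1_on UNIV (\<lambda>z. complex_of_real (Re z / h - of_int k))" for k
    unfolding re by (intro C1_on_mult C1_on_diff C1_on_add C1_on_const C1_on_ident C1_on_cnj)
  moreover have "C1_on UNIV (\<lambda>z. complex_of_real (Im z / h - of_int k))" for k
    unfolding im by (intro C1_on_mult C1_on_diff C1_on_add C1_on_const C1_on_ident C1_on_cnj)
  ultimately show ?thesis unfolding lattice_hat_def[abs_def]
    by (intro C1_on_mult C1_on_real_compose(1)[OF _ h'])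
qed

lemma card_ints_near: "finite {k::int. \<bar>t - of_int k\<bar> < r} \<and> card {k::int. \<bar>t - of_int k\<bar> < r} \<le> nat (\<lceil>2 * r\<rceil> + 1)"
  for t r :: real
proof -
  have sub: "{k::int. \<bar>t - of_int k\<bar> < r} \<subseteq> {\<lceil>t - r\<rceil>..\<lfloor>t + r\<rfloor>}"
    by (auto simp: ceiling_le_iff le_floor_iff)
  have "card {\<lceil>t - r\<rceil>..\<lfloor>t + r\<rfloor>} \<le> nat (\<lceil>2 * r\<rceil> + 1)"
    unfolding card_atLeastAtMost_int by (intro nat_mono) linarith
  then show ?thesis using sub card_mono[OF _ sub] finite_subset[OF sub] by auto
qed

text \<open>
  The mesh is \<open>\<delta> / 2\<close>: a product of two hats lives in a square of that
  half-width, hence within distance \<open>\<delta>\<close> of its lattice point.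
\<close>

lemma lattice_cell_cover:
  assumes d: "0 < \<delta>" "\<delta> < \<epsilon> / 2"
  shows "\<exists>N. cell_cover (lattice_point (\<delta> / 2)) \<epsilon> (lattice_hat (\<delta> / 2)) \<delta> N"
proof -
  define h where "h = \<delta> / 2"
  have h: "h > 0" using d by (simp add: h_def)
  define B where "B z r = {k::int. \<bar>Re z / h - of_int k\<bar> < r / h} \<times> {k::int. \<bar>Im z / h - of_int k\<bar> < r / h}" for z r
  have sub: "{i. cmod (z - lattice_point h i) < r} \<subseteq> B z r" for z r
  proof
    fix i assume "i \<in> {i. cmod (z - lattice_point h i) < r}"
    then have "\<bar>Re (z - lattice_point h i)\<bar> < r" "\<bar>Im (z - lattice_point h i)\<bar> < r"
      using abs_Re_le_cmod abs_Im_le_cmod le_less_trans by blast+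
    then have "\<bar>h * (Re z / h - of_int (fst i))\<bar> < r" "\<bar>h * (Im z / h - of_int (snd i))\<bar> < r"
      using h by (auto simp: lattice_point_def right_diff_distrib)
    then show "i \<in> B z r" using h by (cases i) (simp add: B_def abs_mult pos_less_divide_eq mult.commute)
  qed
  have finB: "finite (B z r)" for z r using card_ints_near by (auto simp: B_def)
  have support: "lattice_hat h i z = 0" if "cmod (z - lattice_point h i) \<ge> \<delta>" for i z
  proof (rule ccontr)
    assume "lattice_hat h i z \<noteq> 0"
    then have "\<bar>Re z / h - of_int (fst i)\<bar> < 1" "\<bar>Im z / h - of_int (snd i)\<bar> < 1"
      using hat_eq_0 by (force simp: lattice_hat_def)+
    then have m: "h * \<bar>Re z / h - of_int (fst i)\<bar> < h * 1" "h * \<bar>Im z / h - of_int (snd i)\<bar> < h * 1"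
      by (intro mult_strict_left_mono h; simp)+
    have "Re (z - lattice_point h i) = h * (Re z / h - of_int (fst i))"
      "Im (z - lattice_point h i) = h * (Im z / h - of_int (snd i))"
      using h by (simp_all add: lattice_point_def right_diff_distrib)
    then have "\<bar>Re (z - lattice_point h i)\<bar> < h" "\<bar>Im (z - lattice_point h i)\<bar> < h"
      using m h by (simp_all only: abs_mult abs_of_pos mult_1_right)
    then show False using that cmod_le[of "z - lattice_point h i"] by (simp add: h_def)
  qed
  have eps: "\<delta> < \<epsilon>" using d by simp
  show ?thesis unfolding h_def[symmetric]
  proof (intro exI[of _ "nat (\<lceil>2 * (\<epsilon> / h)\<rceil> + 1) * nat (\<lceil>2 * (\<epsilon> / h)\<rceil> + 1)"] cell_cover.intro cell_cover_axioms.intro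
      locally_finite_points.intro d support C1_lattice_hat)
    show "0 < \<epsilon>" using d by simp
    show "cmod (lattice_hat h i z) \<le> 1" for i z
      using hat_bounds by (simp add: lattice_hat_def norm_mult mult_le_one)
    show "finite {i. cmod (z - lattice_point h i) < r}" for z r
      by (rule finite_subset[OF sub finB])
    show "card {i. cmod (z - lattice_point h i) < \<epsilon>} \<le> nat (\<lceil>2 * (\<epsilon> / h)\<rceil> + 1) * nat (\<lceil>2 * (\<epsilon> / h)\<rceil> + 1)" for z
    proof -
      have "card {i. cmod (z - lattice_point h i) < \<epsilon>} \<le> card (B z \<epsilon>)" by (rule card_mono[OF finB sub])
      also have "\<dots> \<le> nat (\<lceil>2 * (\<epsilon> / h)\<rceil> + 1) * nat (\<lceil>2 * (\<epsilon> / h)\<rceil> + 1)"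
        unfolding B_def card_cartesian_product
        by (intro mult_le_mono card_ints_near[THEN conjunct2])
      finally show ?thesis .
    qed
    show "(\<Sum>i | cmod (z - lattice_point h i) < \<epsilon>. lattice_hat h i z) = 1" for z
    proof -
      let ?x = "Re z / h" and ?y = "Im z / h"
      let ?Q = "{\<lfloor>?x\<rfloor>, \<lfloor>?x\<rfloor> + 1} \<times> {\<lfloor>?y\<rfloor>, \<lfloor>?y\<rfloor> + 1}"
      let ?A = "{i. cmod (z - lattice_point h i) < \<epsilon>}"
      have far: "hat (t - of_int k) = 0" if "k \<notin> {\<lfloor>t\<rfloor>, \<lfloor>t\<rfloor> + 1}" for t k
      proof (rule hat_eq_0)
        have "k \<le> \<lfloor>t\<rfloor> - 1 \<or> k \<ge> \<lfloor>t\<rfloor> + 2" using that by auto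
        then show "1 \<le> \<bar>t - of_int k\<bar>" by linarith
      qed
      have "(\<Sum>i\<in>?A. lattice_hat h i z) = (\<Sum>i\<in>?A \<union> ?Q. lattice_hat h i z)"
        using finite_subset[OF sub finB] eps by (intro sum.mono_neutral_left) (auto intro!: support)
      also have "\<dots> = (\<Sum>i\<in>?Q. lattice_hat h i z)"
      proof (rule sum.mono_neutral_right)
        show "\<forall>i\<in>?A \<union> ?Q - ?Q. lattice_hat h i z = 0"
          using far by (fastforce simp: lattice_hat_def)
      qed (use finite_subset[OF sub finB] in auto)
      also have "\<dots> = (\<Sum>k\<in>{\<lfloor>?x\<rfloor>, \<lfloor>?x\<rfloor> + 1}. \<Sum>l\<in>{\<lfloor>?y\<rfloor>, \<lfloor>?y\<rfloor> + 1}. of_real (hat (?x - of_int k)) * of_real (hat (?y - of_int l)))"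
        unfolding lattice_hat_def by (simp only: sum.cartesian_product split_def fst_conv snd_conv)
      also have "\<dots> = of_real (\<Sum>k\<in>{\<lfloor>?x\<rfloor>, \<lfloor>?x\<rfloor> + 1}. hat (?x - of_int k)) * of_real (\<Sum>l\<in>{\<lfloor>?y\<rfloor>, \<lfloor>?y\<rfloor> + 1}. hat (?y - of_int l))"
        by (simp only: of_real_sum sum_product)
      also have "\<dots> = 1" by (simp only: sum_hat of_real_1 mult_1)
      finally show ?thesis .
    qed
  qed
qed

section \<open>Mollified weights\<close>

text \<open>
  With the fourth power the kernel is of class \<open>C\<^sup>3\<close>, enough for a third
  order remainder in Taylor's formula.
\<close>

definition mollifier :: "complex \<Rightarrow> real" where
  "mollifier w = max 0 (1 - (cmod w)\<^sup>2) ^ 4"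

text \<open>
  The second order Taylor polynomial is the real part of a holomorphic polynomial, with
  coefficients \<open>mollifier_lin\<close> and \<open>mollifier_quad\<close>, plus
  \<open>mollifier_lap\<close> times the square of the modulus; the latter coefficient is a
  quarter of the Laplacian.
\<close>

definition mollifier_lap :: "complex \<Rightarrow> real" where
  "mollifier_lap w = 12 * max 0 (1 - (cmod w)\<^sup>2) ^ 2 * (cmod w)\<^sup>2 - 4 * max 0 (1 - (cmod w)\<^sup>2) ^ 3"

definition mollifier_lin :: "complex \<Rightarrow> complex" where
  "mollifier_lin w = of_real (- 8 * max 0 (1 - (cmod w)\<^sup>2) ^ 3) * cnj w"

definition mollifier_quad :: "complex \<Rightarrow> complex" where
  "mollifier_quad w = of_real (12 * max 0 (1 - (cmod w)\<^sup>2) ^ 2) * (cnj w)\<^sup>2"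

lemma mollifier_Taylor:
  "\<bar>mollifier (w + h) - (mollifier w + Re (mollifier_lin w * h + mollifier_quad w * h\<^sup>2) + mollifier_lap w * (cmod h)\<^sup>2)\<bar>
    \<le> 56 * cmod h ^ 3"
proof -
  define m where "m s = max 0 (1 - s)" for s :: real
  define r where "r = Re (cnj w * h)"
  define H where "H = (cmod h)\<^sup>2"
  define s where "s t = (cmod w)\<^sup>2 + 2 * r * t + H * t\<^sup>2" for t
  define s1 where "s1 t = 2 * r + 2 * H * t" for t
  have sw: "s t = (cmod (w + of_real t * h))\<^sup>2" for t
    unfolding s_def r_def H_def cmod_power2 by (simp add: power2_eq_square algebra_simps)
  have ds: "(s has_real_derivative s1 t) (at t)" for t
    unfolding s_def[abs_def] s1_def by (auto intro!: derivative_eq_intros)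
  have ds1: "(s1 has_real_derivative 2 * H) (at t)" for t
    unfolding s1_def[abs_def] by (auto intro!: derivative_eq_intros)
  have dm: "((\<lambda>t. m (s t) ^ (n + 2)) has_real_derivative - (real (n + 2) * m (s t) ^ (n + 1)) * s1 t) (at t)" for n t
    unfolding m_def by (rule DERIV_chain2[OF DERIV_max_power_left ds])
  have dm4: "((\<lambda>t. m (s t) ^ 4) has_real_derivative - (4 * m (s t) ^ 3) * s1 t) (at t)" for t
    using dm[of 2 t] by (simp add: eval_nat_numeral)
  have dm3: "((\<lambda>t. m (s t) ^ 3) has_real_derivative - (3 * m (s t) ^ 2) * s1 t) (at t)" for t
    using dm[of 1 t] by (simp add: eval_nat_numeral)
  have dm2: "((\<lambda>t. m (s t) ^ 2) has_real_derivative - (2 * m (s t)) * s1 t) (at t)" for t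
    using dm[of 0 t] by (simp add: eval_nat_numeral)
  \<comment> \<open>The function \<open>g0\<close> is the kernel along the segment, and
    \<open>g1\<close>, \<open>g2\<close>, \<open>g3\<close> are its derivatives. On the
    support of the kernel, \<open>\<bar>s1\<bar> \<le> 2 * cmod h\<close>, so
    \<open>g3\<close> is at most \<open>24 * 8 + 72 * 2 = 336 = 6 * 56\<close>
    times the cube of \<open>cmod h\<close>.\<close>
  define g0 where "g0 t = m (s t) ^ 4" for t
  define g1 where "g1 t = - 4 * m (s t) ^ 3 * s1 t" for t
  define g2 where "g2 t = 12 * m (s t) ^ 2 * s1 t ^ 2 - 8 * m (s t) ^ 3 * H" for t
  define g3 where "g3 t = - 24 * m (s t) * s1 t ^ 3 + 72 * m (s t) ^ 2 * s1 t * H" for t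
  have d0: "(g0 has_real_derivative g1 t) (at t)" for t
    unfolding g0_def[abs_def] g1_def using dm4[of t] by simp
  have d1: "(g1 has_real_derivative g2 t) (at t)" for t
    unfolding g1_def[abs_def] g2_def
    by (rule DERIV_cong[OF DERIV_mult[OF DERIV_cmult[OF dm3] ds1]])
      (simp add: power2_eq_square algebra_simps)
  have ds1_2: "((\<lambda>t. s1 t ^ 2) has_real_derivative 2 * s1 t * (2 * H)) (at t)" for t
    using DERIV_power[OF ds1, where n=2] by (simp add: algebra_simps)
  have d2: "(g2 has_real_derivative g3 t) (at t)" for t
    unfolding g2_def[abs_def] g3_def
    by (rule DERIV_cong[OF DERIV_diff[OF DERIV_mult[OF DERIV_cmult[OF dm2] ds1_2] DERIV_cmult_right[OF DERIV_cmult[OF dm3]]]])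
      (simp add: power2_eq_square power3_eq_cube algebra_simps)
  define df where "df n = (if n = 0 then g0 else if n = 1 then g1 else if n = 2 then g2 else g3)" for n :: nat
  have "\<exists>t>0. t < 1 \<and> g0 1 = (\<Sum>n<3. df n 0 / fact n * 1 ^ n) + df 3 t / fact 3 * 1 ^ 3"
  proof (rule Maclaurin)
    show "\<forall>n t. n < 3 \<and> 0 \<le> t \<and> t \<le> 1 \<longrightarrow> (df n has_real_derivative df (Suc n) t) (at t)"
    proof (intro allI impI)
      fix n :: nat and t :: real assume "n < 3 \<and> 0 \<le> t \<and> t \<le> 1"
      then have "n = 0 \<or> n = 1 \<or> n = 2" by auto
      then show "(df n has_real_derivative df (Suc n) t) (at t)"
        using d0 d1 d2 by (auto simp: df_def)
    qed
  qed (auto simp: df_def)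
  then obtain t where t: "0 < t" "t < 1" and eq: "g0 1 = g0 0 + g1 0 + g2 0 / 2 + g3 t / 6"
    by (auto simp: df_def eval_nat_numeral fact_numeral)
  have b: "\<bar>g3 t\<bar> \<le> 336 * cmod h ^ 3"
  proof (cases "s t < 1")
    case False
    then have "m (s t) = 0" by (simp add: m_def)
    then show ?thesis by (simp add: g3_def)
  next
    case True
    have m1: "0 \<le> m (s t)" "m (s t) \<le> 1" unfolding m_def using sw[of t] by auto
    have "cmod (w + of_real t * h) < 1" using True sw[of t] by (simp add: abs_square_less_1)
    moreover have "s1 t = 2 * Re (cnj (w + of_real t * h) * h)"
      unfolding s1_def r_def H_def cmod_power2 by (simp add: power2_eq_square algebra_simps)
    moreover have "\<bar>Re (cnj (w + of_real t * h) * h)\<bar> \<le> cmod (w + of_real t * h) * cmod h"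
      using abs_Re_le_cmod[of "cnj (w + of_real t * h) * h"] unfolding norm_mult complex_mod_cnj .
    ultimately have s1b: "\<bar>s1 t\<bar> \<le> 2 * cmod h"
      using mult_right_mono[of "cmod (w + of_real t * h)" 1 "cmod h"] by simp
    have "\<bar>g3 t\<bar> \<le> \<bar>- 24 * m (s t) * s1 t ^ 3\<bar> + \<bar>72 * m (s t) ^ 2 * s1 t * H\<bar>"
      unfolding g3_def by (rule abs_triangle_ineq)
    also have "\<bar>- 24 * m (s t) * s1 t ^ 3\<bar> = 24 * m (s t) * \<bar>s1 t\<bar> ^ 3"
      using m1 by (simp add: abs_mult power_abs)
    also have "\<dots> \<le> 24 * 1 * (2 * cmod h) ^ 3"
      using m1 s1b by (intro mult_mono power_mono) auto
    also have "\<bar>72 * m (s t) ^ 2 * s1 t * H\<bar> = 72 * m (s t) ^ 2 * \<bar>s1 t\<bar> * H"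
      using m1 by (simp add: abs_mult H_def)
    also have "\<dots> \<le> 72 * 1 ^ 2 * (2 * cmod h) * H"
      using m1 s1b by (intro mult_mono power_mono) (auto simp: H_def)
    finally show ?thesis by (simp add: H_def power2_eq_square power3_eq_cube)
  qed
  have quad: "2 * r\<^sup>2 = (cmod w)\<^sup>2 * (cmod h)\<^sup>2 + Re ((cnj w)\<^sup>2 * h\<^sup>2)"
    unfolding r_def cmod_power2 by (simp add: power2_eq_square algebra_simps)
  have k1: "mollifier (w + h) = g0 1" using sw[of 1] by (simp add: mollifier_def g0_def m_def)
  have k0: "mollifier w = g0 0" by (simp add: mollifier_def g0_def m_def s_def)
  have l: "Re (mollifier_lin w * h) = g1 0"
    by (simp add: mollifier_lin_def g1_def m_def s_def s1_def r_def algebra_simps)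
  have q: "Re (mollifier_quad w * h\<^sup>2) + mollifier_lap w * (cmod h)\<^sup>2 = g2 0 / 2"
  proof -
    have e1: "Re (mollifier_quad w * h\<^sup>2) = 12 * m (s 0) ^ 2 * Re ((cnj w)\<^sup>2 * h\<^sup>2)"
    proof -
      have "mollifier_quad w * h\<^sup>2 = (12 * m (s 0) ^ 2) *\<^sub>R ((cnj w)\<^sup>2 * h\<^sup>2)"
        by (simp add: mollifier_quad_def m_def s_def scaleR_conv_of_real mult.assoc)
      then show ?thesis by (simp only: scaleR_complex.sel)
    qed
    have e2: "mollifier_lap w = 12 * m (s 0) ^ 2 * (cmod w)\<^sup>2 - 4 * m (s 0) ^ 3"
      by (simp add: mollifier_lap_def m_def s_def)
    have e3: "g2 0 / 2 = 12 * m (s 0) ^ 2 * (2 * r\<^sup>2) - 4 * m (s 0) ^ 3 * (cmod h)\<^sup>2"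
      by (simp add: g2_def s1_def H_def power2_eq_square)
    show ?thesis unfolding e1 e2 e3 quad by algebra
  qed
  have "mollifier (w + h) - (mollifier w + Re (mollifier_lin w * h + mollifier_quad w * h\<^sup>2) + mollifier_lap w * (cmod h)\<^sup>2) = g3 t / 6"
    using eq l q unfolding k1 k0 plus_complex.sel by linarith
  then show ?thesis using b by simp
qed

lemma mollifier_nonneg: "0 \<le> mollifier w" by (simp add: mollifier_def)
lemma mollifier_le_1: "mollifier w \<le> 1"
  unfolding mollifier_def by (rule power_le_one) auto

lemma mollifier_support:
  assumes "cmod w \<ge> 1"
  shows "mollifier w = 0" "mollifier_lin w = 0" "mollifier_quad w = 0" "mollifier_lap w = 0"
proof -
  have "1 \<le> (cmod w)\<^sup>2" using assms by (simp add: power2_eq_square mult_ge1_I)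
  then have "max 0 (1 - (cmod w)\<^sup>2) = 0" by simp
  then show "mollifier w = 0" "mollifier_lin w = 0" "mollifier_quad w = 0" "mollifier_lap w = 0"
    by (simp_all add: mollifier_def mollifier_lin_def mollifier_quad_def mollifier_lap_def)
qed

lemma mollifier_continuous:
  "continuous_on S mollifier" "continuous_on S mollifier_lin" "continuous_on S mollifier_quad" "continuous_on S mollifier_lap"
  unfolding mollifier_def[abs_def] mollifier_lin_def[abs_def] mollifier_quad_def[abs_def] mollifier_lap_def[abs_def]
  by (intro continuous_intros)+

lemma mollifier_coeff_bounds:
  "cmod (mollifier_lin w) \<le> 12" "cmod (mollifier_quad w) \<le> 12" "\<bar>mollifier_lap w\<bar> \<le> 12"
proof -
  have "cmod (mollifier_lin w) \<le> 12 \<and> cmod (mollifier_quad w) \<le> 12 \<and> \<bar>mollifier_lap w\<bar> \<le> 12"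
  proof (cases "cmod w \<ge> 1")
    case True then show ?thesis using mollifier_support by simp
  next
    case False
    define x where "x = max 0 (1 - (cmod w)\<^sup>2)"
    have w1: "(cmod w)\<^sup>2 \<le> 1" "cmod w \<le> 1" using False by (auto simp: abs_square_le_1)
    have x: "0 \<le> x" "x \<le> 1" by (auto simp: x_def)
    have x23: "0 \<le> x ^ 2" "x ^ 2 \<le> 1" "0 \<le> x ^ 3" "x ^ 3 \<le> 1" using x by (auto intro: power_le_one)
    have "x ^ 3 * cmod w \<le> 1 * 1" using x23 w1 by (intro mult_mono) auto
    then have 1: "cmod (mollifier_lin w) \<le> 12"
      using x by (simp add: mollifier_lin_def norm_mult norm_power x_def[symmetric] abs_mult mult.commute)
    have q: "x ^ 2 * (cmod w)\<^sup>2 \<le> 1 * 1" using x23 w1 by (intro mult_mono) auto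
    then have 2: "cmod (mollifier_quad w) \<le> 12"
      using x by (simp add: mollifier_quad_def norm_mult norm_power x_def[symmetric] abs_mult)
    have "0 \<le> x ^ 2 * (cmod w)\<^sup>2" using x by simp
    then have 3: "\<bar>mollifier_lap w\<bar> \<le> 12"
      unfolding mollifier_lap_def x_def[symmetric] abs_le_iff mult.assoc using q x23 by linarith
    show ?thesis using 1 2 3 by blast
  qed
  then show "cmod (mollifier_lin w) \<le> 12" "cmod (mollifier_quad w) \<le> 12" "\<bar>mollifier_lap w\<bar> \<le> 12" by auto
qed

lemma lborel_distr_reflect: "distr lborel borel (\<lambda>w. c - w) = (lborel :: complex measure)"
  using lborel_affine[of "-1" c] by (simp add: density_1)

text \<open>
  A quadratic polynomial in the plane restricts to a circle as such a trigonometric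
  polynomial; its average is \<open>a + (d + g) / 2\<close>.
\<close>

lemma circle_mean_trig:
  fixes f :: "real \<Rightarrow> real"
  assumes f: "set_integrable lborel {0..2*pi} f"
    and b: "\<And>t. t \<in> {0..2*pi} \<Longrightarrow> \<bar>f t - (a + (b * cos t + c * sin t) + (d * (cos t)\<^sup>2 + e * (cos t * sin t) + g * (sin t)\<^sup>2))\<bar> \<le> \<eta>"
  shows "\<bar>1 / (2 * pi) * (LBINT t:{0..2*pi}. f t) - (a + (d + g) / 2)\<bar> \<le> \<eta>"
proof -
  let ?T = "\<lambda>t. a + (b * cos t + c * sin t) + (d * (cos t)\<^sup>2 + e * (cos t * sin t) + g * (sin t)\<^sup>2)"
  let ?F = "\<lambda>t. a * t + (b * sin t - c * cos t) + (d * (t + sin t * cos t) / 2 + e * (sin t)\<^sup>2 / 2 + g * (t - sin t * cos t) / 2)"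
  have sc: "(sin t)\<^sup>2 = 1 - (cos t)\<^sup>2" for t :: real by (simp add: sin_squared_eq)
  have "has_bochner_integral lborel (\<lambda>t. indicator {0..2*pi} t *\<^sub>R ?T t) (?F (2*pi) - ?F 0)"
  proof (rule has_bochner_integral_FTC_Icc)
    show "(?F has_vector_derivative ?T t) (at t within {0..2*pi})" for t
      unfolding has_real_derivative_iff_has_vector_derivative[symmetric]
      by (rule derivative_eq_intros refl | simp)+ (simp add: sc power2_eq_square algebra_simps, simp add: sc flip: power2_eq_square, simp add: field_simps)
    show "continuous_on {0..2*pi} ?T" by (intro continuous_intros)
  qed simp
  then have T: "set_integrable lborel {0..2*pi} ?T" "(LBINT t:{0..2*pi}. ?T t) = 2 * pi * (a + (d + g) / 2)"
    unfolding set_integrable_def set_lebesgue_integral_def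
    by (auto simp: has_bochner_integral_iff field_simps)
  have "(LBINT t:{0..2*pi}. f t) - 2 * pi * (a + (d + g) / 2) = (LBINT t:{0..2*pi}. f t - ?T t)"
    using T f by (simp only: set_integral_diff)
  also have "\<bar>\<dots>\<bar> \<le> (LBINT t:{0..2*pi}. \<eta>)"
  proof -
    have "norm (LBINT t. indicator {0..2*pi} t *\<^sub>R (f t - ?T t)) \<le> (LBINT t. indicator {0..2*pi} t *\<^sub>R \<eta>)"
    proof (rule Bochner_Integration.integral_norm_bound_integral)
      show "integrable lborel (\<lambda>t. indicator {0..2*pi} t *\<^sub>R (f t - ?T t))"
        using set_integral_diff(1)[OF f T(1)] unfolding set_integrable_def .
      show "integrable lborel (\<lambda>t. indicator {0..2*pi} t *\<^sub>R \<eta>)"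
        by (intro integrable_scaleR_left integrable_real_indicator) auto
      show "norm (indicator {0..2*pi} t *\<^sub>R (f t - ?T t)) \<le> indicator {0..2*pi} t *\<^sub>R \<eta>" for t
        using b[of t] by (auto simp: indicator_def)
    qed
    then show ?thesis unfolding set_lebesgue_integral_def by simp
  qed
  also have "\<dots> = 2 * pi * \<eta>" by (simp add: set_lebesgue_integral_def)
  finally have "\<bar>(LBINT t:{0..2*pi}. f t) - 2 * pi * (a + (d + g) / 2)\<bar> \<le> 2 * pi * \<eta>" .
  moreover have "(1 / (2 * pi)) * (LBINT t:{0..2*pi}. f t) - (a + (d + g) / 2)
      = ((LBINT t:{0..2*pi}. f t) - 2 * pi * (a + (d + g) / 2)) / (2 * pi)"
    by (simp add: diff_divide_distrib)
  ultimately show ?thesis by (simp add: abs_divide pos_divide_le_eq mult.commute)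
qed

text \<open>
  The growth condition on a weight \<open>p\<close> becomes multiplicative after adding 1,
  and a positive lower bound makes constants absorbable; \<open>q\<close> stands for
  \<open>p + 1\<close>.
\<close>

locale moderate_weight =
  fixes q :: "complex \<Rightarrow> real" and \<kappa> :: real
  assumes q_ge_1: "\<And>z. 1 \<le> q z"
    and q_moderate: "\<And>z w. cmod (z - w) \<le> 1 \<Longrightarrow> q w \<le> \<kappa> * q z"
    and q_measurable [measurable]: "q \<in> borel_measurable borel"
begin

lemma kappa_ge_1: "\<kappa> \<ge> 1"
  using q_moderate[of 0 0] q_ge_1[of 0] by simp

lemma q_moderate_2: assumes "cmod (z - w) \<le> 2" shows "q w \<le> \<kappa>\<^sup>2 * q z"
proof -
  let ?v = "midpoint z w"
  have "dist z ?v = dist z w / 2" "dist ?v w = dist z w / 2" by (simp_all add: dist_midpoint)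
  then have "q ?v \<le> \<kappa> * q z" "q w \<le> \<kappa> * q ?v"
    using assms by (auto intro!: q_moderate simp: dist_norm)
  moreover have "\<kappa> * q ?v \<le> \<kappa> * (\<kappa> * q z)"
    using kappa_ge_1 calculation(1) by (intro mult_left_mono) auto
  ultimately show ?thesis unfolding power2_eq_square mult.assoc by linarith
qed

lemma q_integral:
  fixes K :: "complex \<Rightarrow> 'b :: {banach, second_countable_topology}"
  assumes K: "K \<in> borel_measurable borel" "\<And>w. norm (K w) \<le> B" "\<And>w. cmod (c - w) > 2 \<Longrightarrow> K w = 0"
  shows "integrable lborel (\<lambda>w. q w *\<^sub>R K w)"
    and "norm (LINT w|lborel. q w *\<^sub>R K w) \<le> B * \<kappa>\<^sup>2 * q c * measure lborel (cball (0::complex) 2)"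
proof -
  let ?D = "\<lambda>w. (B * \<kappa>\<^sup>2 * q c) * indicator (cball c 2) w :: real"
  have B0: "B \<ge> 0" using K(2)[of 0] norm_ge_zero order_trans by blast
  have iD: "integrable lborel ?D"
    by (intro integrable_mult_right integrable_real_indicator)
      (use emeasure_bounded_finite[OF bounded_cball, of c 2] in auto)
  have le: "norm (q w *\<^sub>R K w) \<le> ?D w" for w
  proof (cases "cmod (c - w) \<le> 2")
    case True
    have "norm (q w *\<^sub>R K w) = q w * norm (K w)" using q_ge_1[of w] by simp
    also have "\<dots> \<le> \<kappa>\<^sup>2 * q c * B"
      using q_moderate_2[OF True] K(2) q_ge_1[of w] q_ge_1[of c] by (intro mult_mono) auto
    finally show ?thesis using True by (simp add: dist_norm mult.commute mult.left_commute)
  next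
    case False then show ?thesis using K(3)[of w] by (simp add: dist_norm)
  qed
  show i: "integrable lborel (\<lambda>w. q w *\<^sub>R K w)"
    by (rule Bochner_Integration.integrable_bound[OF iD])
      (use K(1) order_trans[OF le abs_ge_self] in auto)
  have "norm (LINT w|lborel. q w *\<^sub>R K w) \<le> (LINT w|lborel. ?D w)"
    by (rule Bochner_Integration.integral_norm_bound_integral[OF i iD le])
  also have "\<dots> = B * \<kappa>\<^sup>2 * q c * measure lborel (cball c 2)" by simp
  also have "measure lborel (cball c 2) = measure lborel (cball (0::complex) 2)"
    by (simp add: content_cball)
  finally show "norm (LINT w|lborel. q w *\<^sub>R K w) \<le> B * \<kappa>\<^sup>2 * q c * measure lborel (cball (0::complex) 2)" .
qed

text \<open>
  \<open>P\<close> is the convolution of \<open>q\<close> with the kernel and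
  \<open>\<Lambda>\<close> a quarter of the Laplacian of \<open>P\<close>. The constant
  \<open>A0\<close> serves for all upper bounds, as 100 exceeds the constants 1, 12 and 56
  of the kernel.
\<close>

definition P :: "complex \<Rightarrow> real" where "P c = (LINT w|lborel. q w * mollifier (c - w))"
definition \<Lambda> :: "complex \<Rightarrow> real" where "\<Lambda> c = (LINT w|lborel. q w * mollifier_lap (c - w))"
definition A0 :: real where "A0 = 100 * \<kappa>\<^sup>2 * (measure lborel (cball (0::complex) 2) + 1)"

lemma A0_pos: "A0 > 0"
  unfolding A0_def using kappa_ge_1 by (intro mult_pos_pos add_nonneg_pos) auto

lemma kernel_measurable:
  assumes "continuous_on UNIV (K :: complex \<Rightarrow> 'b :: {banach, second_countable_topology})"
  shows "(\<lambda>w. K (c - w)) \<in> borel_measurable borel"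
  using assms by (auto intro!: borel_measurable_continuous_onI continuous_intros elim: continuous_on_compose2)

lemma A0_bound:
  assumes "B \<le> 100" "x \<le> B * \<kappa>\<^sup>2 * q c * measure lborel (cball (0::complex) 2)"
  shows "x \<le> A0 * q c"
proof -
  have "B * (\<kappa>\<^sup>2 * q c * measure lborel (cball (0::complex) 2)) \<le> 100 * (\<kappa>\<^sup>2 * q c * (measure lborel (cball (0::complex) 2) + 1))"
    using assms q_ge_1[of c] by (intro mult_mono mult_left_mono) auto
  then show ?thesis using assms(2) by (simp add: A0_def algebra_simps)
qed

text \<open>
  Taylor's formula for the kernel, integrated against \<open>q\<close>. The smoothness is
  that of the kernel; \<open>q\<close> enters through its size in a disc of radius 2.
\<close>

lemma P_Taylor:
  "\<exists>\<alpha> \<beta>. \<forall>h. cmod h \<le> 1 \<longrightarrow>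
     \<bar>P (c + h) - (P c + Re (\<alpha> * h + \<beta> * h\<^sup>2) + \<Lambda> c * (cmod h)\<^sup>2)\<bar> \<le> A0 * q c * cmod h ^ 3"
proof -
  let ?V = "measure lborel (cball (0::complex) 2)"
  define \<alpha> where "\<alpha> = (LINT w|lborel. q w *\<^sub>R mollifier_lin (c - w))"
  define \<beta> where "\<beta> = (LINT w|lborel. q w *\<^sub>R mollifier_quad (c - w))"
  have far: "1 \<le> cmod (c - w)" if "2 < cmod (c - w)" for w using that by simp
  have iA: "integrable lborel (\<lambda>w. q w *\<^sub>R mollifier_lin (c - w))"
    by (rule q_integral(1)[where B=12 and c=c]) (auto intro!: kernel_measurable mollifier_continuous mollifier_coeff_bounds mollifier_support far)
  have iB: "integrable lborel (\<lambda>w. q w *\<^sub>R mollifier_quad (c - w))"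
    by (rule q_integral(1)[where B=12 and c=c]) (auto intro!: kernel_measurable mollifier_continuous mollifier_coeff_bounds mollifier_support far)
  have iL: "integrable lborel (\<lambda>w. q w *\<^sub>R mollifier_lap (c - w))"
    by (rule q_integral(1)[where B=12 and c=c]) (auto intro!: kernel_measurable mollifier_continuous mollifier_coeff_bounds mollifier_support far)
  have iK: "integrable lborel (\<lambda>w. q w *\<^sub>R mollifier (c + h - w))" if "cmod h \<le> 1" for h
  proof (rule q_integral(1)[where B=1 and c=c])
    show "mollifier (c + h - w) = 0" if "2 < cmod (c - w)" for w
    proof (rule mollifier_support)
      have "cmod (c - w) \<le> cmod (c + h - w) + cmod h" using norm_triangle_ineq4[of "c + h - w" h] by simp
      then show "1 \<le> cmod (c + h - w)" using that \<open>cmod h \<le> 1\<close> by simp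
    qed
  qed (use mollifier_nonneg mollifier_le_1 in \<open>auto intro!: kernel_measurable mollifier_continuous\<close>)
  show ?thesis
  proof (rule exI[of _ \<alpha>], rule exI[of _ \<beta>], intro allI impI)
    fix h assume h: "cmod h \<le> 1"
    let ?R = "\<lambda>w. mollifier (c + h - w) - (mollifier (c - w) + Re (mollifier_lin (c - w) * h + mollifier_quad (c - w) * h\<^sup>2)
        + mollifier_lap (c - w) * (cmod h)\<^sup>2)"
    have Rb: "norm (?R w) \<le> 56 * cmod h ^ 3" for w
      using mollifier_Taylor[of "c - w" h] by (simp add: algebra_simps)
    have jA: "integrable lborel (\<lambda>w. q w *\<^sub>R mollifier_lin (c - w) * h)" by (rule integrable_mult_left[OF iA])
    have bA: "(LINT w|lborel. Re (q w *\<^sub>R mollifier_lin (c - w) * h)) = Re (\<alpha> * h)"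
      unfolding integral_Re[OF jA] \<alpha>_def by (simp only: integral_mult_left_zero)
    have jB: "integrable lborel (\<lambda>w. q w *\<^sub>R mollifier_quad (c - w) * h\<^sup>2)" by (rule integrable_mult_left[OF iB])
    have bB: "(LINT w|lborel. Re (q w *\<^sub>R mollifier_quad (c - w) * h\<^sup>2)) = Re (\<beta> * h\<^sup>2)"
      unfolding integral_Re[OF jB] \<beta>_def by (simp only: integral_mult_left_zero)
    have eq: "q w *\<^sub>R ?R w = q w *\<^sub>R mollifier (c + h - w) - (q w *\<^sub>R mollifier (c - w) + (Re (q w *\<^sub>R mollifier_lin (c - w) * h)
        + Re (q w *\<^sub>R mollifier_quad (c - w) * h\<^sup>2)) + (q w *\<^sub>R mollifier_lap (c - w)) * (cmod h)\<^sup>2)" for w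
      by (simp add: right_diff_distrib distrib_left mult.assoc)
    have iK0: "integrable lborel (\<lambda>w. q w *\<^sub>R mollifier (c - w))" using iK[of 0] by simp
    have "(LINT w|lborel. q w *\<^sub>R ?R w) = P (c + h) - (P c + Re (\<alpha> * h + \<beta> * h\<^sup>2) + \<Lambda> c * (cmod h)\<^sup>2)"
    proof -
      have "(LINT w|lborel. q w *\<^sub>R ?R w) = (LINT w|lborel. q w *\<^sub>R mollifier (c + h - w)) -
        ((LINT w|lborel. q w *\<^sub>R mollifier (c - w)) + ((LINT w|lborel. Re (q w *\<^sub>R mollifier_lin (c - w) * h))
        + (LINT w|lborel. Re (q w *\<^sub>R mollifier_quad (c - w) * h\<^sup>2))) + (LINT w|lborel. q w *\<^sub>R mollifier_lap (c - w)) * (cmod h)\<^sup>2)"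
        unfolding eq using iK[OF h] iK0 iL integrable_Re[OF jA] integrable_Re[OF jB] integrable_mult_left[OF iL]
        by (simp only: Bochner_Integration.integral_diff Bochner_Integration.integral_add
            Bochner_Integration.integrable_add Bochner_Integration.integrable_diff integral_mult_left_zero)
      then show ?thesis unfolding bA bB by (simp add: P_def \<Lambda>_def)
    qed
    moreover have "norm (LINT w|lborel. q w *\<^sub>R ?R w) \<le> (56 * cmod h ^ 3) * \<kappa>\<^sup>2 * q c * ?V"
    proof (rule q_integral(2)[OF _ Rb])
      show "?R \<in> borel_measurable borel"
        by (intro borel_measurable_continuous_onI continuous_intros
            continuous_on_compose2[OF mollifier_continuous(1)[of UNIV]] continuous_on_compose2[OF mollifier_continuous(2)[of UNIV]]
            continuous_on_compose2[OF mollifier_continuous(3)[of UNIV]] continuous_on_compose2[OF mollifier_continuous(4)[of UNIV]]) auto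
      fix w assume w: "2 < cmod (c - w)"
      have "cmod (c - w) \<le> cmod (c + h - w) + cmod h" using norm_triangle_ineq4[of "c + h - w" h] by simp
      then have "1 \<le> cmod (c + h - w)" using w h by simp
      then show "?R w = 0" using mollifier_support[OF far[OF w]] mollifier_support(1) by simp
    qed
    moreover have "(56 * cmod h ^ 3) * \<kappa>\<^sup>2 * q c * ?V \<le> A0 * q c * cmod h ^ 3"
      using mult_right_mono[OF A0_bound[of 56 "56 * \<kappa>\<^sup>2 * q c * ?V" c, OF _ order_refl], of "cmod h ^ 3"]
      by (simp add: algebra_simps)
    ultimately show "\<bar>P (c + h) - (P c + Re (\<alpha> * h + \<beta> * h\<^sup>2) + \<Lambda> c * (cmod h)\<^sup>2)\<bar> \<le> A0 * q c * cmod h ^ 3"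
      by simp
  qed
qed

lemma Lambda_le: "\<Lambda> c \<le> A0 * q c"
proof (rule A0_bound[of 12])
  have "norm (LINT w|lborel. q w *\<^sub>R mollifier_lap (c - w)) \<le> 12 * \<kappa>\<^sup>2 * q c * measure lborel (cball (0::complex) 2)"
    by (rule q_integral(2)) (auto intro!: kernel_measurable mollifier_continuous mollifier_coeff_bounds mollifier_support)
  then show "\<Lambda> c \<le> 12 * \<kappa>\<^sup>2 * q c * measure lborel (cball (0::complex) 2)"
    by (simp add: \<Lambda>_def)
qed simp

lemma P_reflect: "P c = (LINT w|lborel. q (c - w) * mollifier w)"
proof -
  have "P c = (LINT w|distr lborel borel (\<lambda>w. c - w). q w * mollifier (c - w))"
    unfolding lborel_distr_reflect P_def ..
  also have "\<dots> = (LINT w|lborel. q (c - w) * mollifier (c - (c - w)))"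
    by (rule integral_distr) (auto intro!: borel_measurable_times kernel_measurable mollifier_continuous)
  finally show ?thesis by simp
qed

lemma P_le: "P c \<le> A0 * q c"
proof (rule A0_bound[of 1])
  have "norm (LINT w|lborel. q w *\<^sub>R mollifier (c - w)) \<le> 1 * \<kappa>\<^sup>2 * q c * measure lborel (cball (0::complex) 2)"
    by (rule q_integral(2)) (use mollifier_nonneg mollifier_le_1 in \<open>auto intro!: kernel_measurable mollifier_continuous mollifier_support\<close>)
  then show "P c \<le> 1 * \<kappa>\<^sup>2 * q c * measure lborel (cball (0::complex) 2)"
    by (simp add: P_def)
qed simp

definition mass :: real where "mass = (LINT w|lborel. mollifier w)"

lemma mollifier_integrable: "integrable lborel mollifier"
proof -
  have "integrable lborel (\<lambda>x. indicator (cball 0 1) x *\<^sub>R mollifier x)"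
    by (rule borel_integrable_compact) (auto intro: mollifier_continuous)
  moreover have "(\<lambda>x. indicator (cball 0 1) x *\<^sub>R mollifier x) = mollifier"
    using mollifier_support(1) by (auto simp: indicator_def fun_eq_iff)
  ultimately show ?thesis by simp
qed

lemma mass_pos: "mass > 0"
proof -
  have le: "(1/2) ^ 4 * indicator (ball 0 (1/2)) w \<le> mollifier w" for w
  proof (cases "w \<in> ball 0 (1/2)")
    case True
    then have "(cmod w)\<^sup>2 \<le> (1/2)\<^sup>2" by (intro power_mono) auto
    moreover have "(1/2)\<^sup>2 = (1/4 :: real)" by (simp add: power2_eq_square)
    ultimately have "1/2 \<le> max 0 (1 - (cmod w)\<^sup>2)" by linarith
    then have "(1/2) ^ 4 \<le> mollifier w" unfolding mollifier_def by (rule power_mono) simp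
    then show ?thesis using True by simp
  next
    case False then show ?thesis using mollifier_nonneg by simp
  qed
  have "integrable lborel (\<lambda>w. (1/2) ^ 4 * indicator (ball (0::complex) (1/2)) w :: real)"
    by (intro integrable_mult_right integrable_real_indicator)
      (use emeasure_bounded_finite[OF bounded_ball, of "0::complex" "1/2"] in auto)
  then have "(LINT w|lborel. (1/2) ^ 4 * indicator (ball (0::complex) (1/2)) w) \<le> mass"
    unfolding mass_def by (rule integral_mono[OF _ mollifier_integrable le])
  moreover have "(LINT w|lborel. (1/2) ^ 4 * indicator (ball (0::complex) (1/2)) w :: real) = (1/2) ^ 4 * measure lborel (ball (0::complex) (1/2))"
    by simp
  moreover have "(1/2) ^ 4 * measure lborel (ball (0::complex) (1/2)) > 0"
    by (intro mult_pos_pos content_ball_pos) auto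
  ultimately show ?thesis by linarith
qed

lemma q_mollifier_integrable: "integrable lborel (\<lambda>w. q (c - w) * mollifier w)"
proof -
  have "integrable lborel (\<lambda>w. q w *\<^sub>R mollifier (c - w))"
    by (rule q_integral(1)[where B=1 and c=c]) (use mollifier_nonneg mollifier_le_1 in \<open>auto intro!: kernel_measurable mollifier_continuous mollifier_support\<close>)
  then have "integrable (distr lborel borel (\<lambda>w. c - w)) (\<lambda>w. q w *\<^sub>R mollifier (c - w))"
    unfolding lborel_distr_reflect .
  then have "integrable lborel (\<lambda>w. q (c - w) *\<^sub>R mollifier (c - (c - w)))"
    by (rule integrable_distr[rotated]) auto
  then show ?thesis by simp
qed

lemma P_ge: "mass / \<kappa> * q c \<le> P c"
proof -
  have "(LINT w|lborel. q c / \<kappa> * mollifier w) \<le> (LINT w|lborel. q (c - w) * mollifier w)"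
  proof (rule integral_mono[OF _ q_mollifier_integrable])
    show "integrable lborel (\<lambda>w. q c / \<kappa> * mollifier w)" by (intro integrable_mult_right mollifier_integrable)
    show "q c / \<kappa> * mollifier w \<le> q (c - w) * mollifier w" for w
    proof (cases "cmod w \<le> 1")
      case True
      have "q c \<le> \<kappa> * q (c - w)" by (rule q_moderate) (use True in auto)
      then show ?thesis using kappa_ge_1 mollifier_nonneg by (intro mult_right_mono) (auto simp: field_simps)
    qed (use mollifier_support(1)[of w] in auto)
  qed
  then show ?thesis by (simp add: P_reflect mass_def mult.commute)
qed

end

section \<open>Circle means and the Laplacian\<close>

definition circle_mean :: "(complex \<Rightarrow> real) \<Rightarrow> complex \<Rightarrow> real \<Rightarrow> real" where
  "circle_mean f z r = 1 / (2 * pi) * (LBINT t:{0..2*pi}. f (z + of_real r * cis t))"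

lemma second_order_Taylor:
  fixes f :: "complex \<Rightarrow> real"
  assumes S: "open S" "x \<in> S"
    and f': "\<And>w. w \<in> S \<Longrightarrow> (f has_derivative blinfun_apply (f' w)) (at w)"
    and f'': "(f' has_derivative blinfun_apply f'') (at x)" and eta: "\<eta> > 0"
  obtains d where "d > 0"
    "\<And>h. cmod h < d \<Longrightarrow> \<bar>f (x + h) - (f x + f' x h + f'' h h / 2)\<bar> \<le> \<eta> * (cmod h)\<^sup>2"
proof -
  obtain d1 where d1: "d1 > 0" "ball x d1 \<subseteq> S" using S openE by blast
  obtain d2 where d2: "d2 > 0"
    "\<And>y. norm (y - x) < d2 \<Longrightarrow> norm (f' y - f' x - f'' (y - x)) \<le> \<eta> * norm (y - x)"
    using f'' eta unfolding has_derivative_at_alt by blast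
  have "\<bar>f (x + h) - (f x + f' x h + f'' h h / 2)\<bar> \<le> \<eta> * (cmod h)\<^sup>2" if h: "cmod h < min d1 d2" for h
  proof -
    define g where "g t = f (x + of_real t * h) - t * f' x h - t\<^sup>2 * (f'' h h / 2)" for t :: real
    define g' where "g' t = f' (x + of_real t * h) h - f' x h - 2 * t * (f'' h h / 2)" for t :: real
    have inS: "x + of_real t * h \<in> S" and small: "cmod (of_real t * h) < d2" if "0 \<le> t" "t \<le> 1" for t
    proof -
      have "cmod (of_real t * h) \<le> 1 * cmod h" unfolding norm_mult using that by (intro mult_right_mono) auto
      then show "x + of_real t * h \<in> S" "cmod (of_real t * h) < d2" using h d1(2) by (auto simp: dist_norm subset_iff)
    qed
    have der: "(g has_real_derivative g' t) (at t)" if "0 \<le> t" "t \<le> 1" for t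
    proof -
      have "((\<lambda>t. x + of_real t * h) has_derivative (\<lambda>s. of_real s * h)) (at t)"
        by (auto intro!: derivative_eq_intros)
      from has_derivative_compose[OF this f'[OF inS[OF that]]]
      have "((\<lambda>t. f (x + of_real t * h)) has_derivative (\<lambda>s. f' (x + of_real t * h) (of_real s * h))) (at t)" .
      moreover have "f' (x + of_real t * h) (of_real s * h) = f' (x + of_real t * h) h * s" for s
        using blinfun.scaleR_right[of "f' (x + of_real t * h)" s h] by (simp add: scaleR_conv_of_real mult.commute)
      ultimately have "((\<lambda>t. f (x + of_real t * h)) has_real_derivative f' (x + of_real t * h) h) (at t)"
        by (simp add: has_field_derivative_def)
      then show ?thesis unfolding g_def[abs_def] g'_def
        by (rule DERIV_cong[OF DERIV_diff[OF DERIV_diff[OF _ DERIV_cmult_right[OF DERIV_ident]] DERIV_cmult_right[OF DERIV_power[OF DERIV_ident, where n=2]]]])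
          simp
    qed
    obtain t where t: "0 < t" "t < 1" "g 1 - g 0 = (1 - 0) * g' t"
      using MVT2[of 0 1 g g'] der by auto
    have t1: "0 \<le> t" "t \<le> 1" using t by auto
    have "g' t = (f' (x + of_real t * h) - f' x - f'' (of_real t * h)) h"
    proof -
      have "f'' (of_real t * h) = t *\<^sub>R f'' h"
        using blinfun.scaleR_right[of f'' t h] by (simp add: scaleR_conv_of_real)
      then show ?thesis by (simp add: g'_def blinfun.diff_left blinfun.scaleR_left)
    qed
    also have "\<bar>\<dots>\<bar> \<le> norm (f' (x + of_real t * h) - f' x - f'' (of_real t * h)) * cmod h"
      using norm_blinfun[of "f' (x + of_real t * h) - f' x - f'' (of_real t * h)" h] by simp
    also have "\<dots> \<le> \<eta> * cmod (of_real t * h) * cmod h"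
      using d2(2)[of "x + of_real t * h"] small[OF t1] by (intro mult_right_mono) auto
    also have "\<dots> \<le> \<eta> * (1 * cmod h) * cmod h"
      unfolding norm_mult using t1 eta by (intro mult_right_mono mult_left_mono) auto
    finally have "\<bar>g' t\<bar> \<le> \<eta> * (cmod h)\<^sup>2" by (simp add: power2_eq_square mult.assoc)
    then show ?thesis using t(3) by (simp add: g_def)
  qed
  then show ?thesis using that[of "min d1 d2"] d1(1) d2(1) by auto
qed

context moderate_weight
begin

lemma measurable_circle: "(\<lambda>t. q (z + of_real r * cis t)) \<in> borel_measurable borel"
  by (rule measurable_compose[OF borel_measurable_continuous_onI q_measurable]) (intro continuous_intros)

lemma circle_integrable:
  assumes "\<bar>r\<bar> \<le> 1" shows "set_integrable lborel {0..2*pi} (\<lambda>t. q (z + of_real r * cis t))"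
  unfolding set_integrable_def
proof (rule integrableI_bounded_set_indicator[where B="\<kappa> * q z"])
  show "AE t in lborel. t \<in> {0..2*pi} \<longrightarrow> norm (q (z + of_real r * cis t)) \<le> \<kappa> * q z"
  proof (intro AE_I2 impI)
    fix t
    have "q (z + of_real r * cis t) \<le> \<kappa> * q z"
      by (rule q_moderate) (use assms in \<open>simp add: norm_mult\<close>)
    then show "norm (q (z + of_real r * cis t)) \<le> \<kappa> * q z"
      using q_ge_1[of "z + of_real r * cis t"] by simp
  qed
qed (use measurable_circle in auto)

text \<open>
  At a point of twofold differentiability the excess of the circle mean over the value,
  divided by \<open>r\<^sup>2\<close>, tends to a quarter of the Laplacian.
\<close>

lemma circle_mean_second_order:
  assumes S: "open S" "x \<in> S"
    and f': "\<And>w. w \<in> S \<Longrightarrow> (q has_derivative blinfun_apply (f' w)) (at w)"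
    and f'': "(f' has_derivative blinfun_apply f'') (at x)" and eta: "\<eta> > 0"
  obtains d where "d > 0"
    "\<And>r. 0 < r \<Longrightarrow> r < d \<Longrightarrow> \<bar>(circle_mean q x r - q x) / r\<^sup>2 - (f'' 1 1 + f'' \<i> \<i>) / 4\<bar> \<le> \<eta>"
proof -
  obtain d where d: "d > 0"
    "\<And>h. cmod h < d \<Longrightarrow> \<bar>q (x + h) - (q x + f' x h + f'' h h / 2)\<bar> \<le> \<eta> * (cmod h)\<^sup>2"
    using second_order_Taylor[OF S f' f'' eta] by blast
  have "\<bar>(circle_mean q x r - q x) / r\<^sup>2 - (f'' 1 1 + f'' \<i> \<i>) / 4\<bar> \<le> \<eta>" if r: "0 < r" "r < min d 1" for r
  proof -
    have "\<bar>circle_mean q x r - (q x + (r\<^sup>2 * f'' 1 1 / 2 + r\<^sup>2 * f'' \<i> \<i> / 2) / 2)\<bar> \<le> \<eta> * r\<^sup>2"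
      unfolding circle_mean_def
    proof (rule circle_mean_trig[where b="r * f' x 1" and c="r * f' x \<i>" and e="r\<^sup>2 * (f'' 1 \<i> + f'' \<i> 1) / 2"])
      show "set_integrable lborel {0..2 * pi} (\<lambda>t. q (x + complex_of_real r * cis t))"
        using r by (intro circle_integrable) auto
      fix t :: real
      have h: "of_real r * cis t = (r * cos t) *\<^sub>R 1 + (r * sin t) *\<^sub>R \<i>"
        by (simp add: complex_eq_iff)
      have n: "cmod (of_real r * cis t) = r" using r by (simp add: norm_mult)
      have 1: "f' x (of_real r * cis t) = r * f' x 1 * cos t + r * f' x \<i> * sin t"
        unfolding h blinfun.add_right blinfun.scaleR_right by simp
      have 2: "f'' (of_real r * cis t) (of_real r * cis t) / 2
          = r\<^sup>2 * f'' 1 1 / 2 * (cos t)\<^sup>2 + r\<^sup>2 * (f'' 1 \<i> + f'' \<i> 1) / 2 * (cos t * sin t) + r\<^sup>2 * f'' \<i> \<i> / 2 * (sin t)\<^sup>2"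
        unfolding h blinfun.add_right blinfun.scaleR_right blinfun.add_left blinfun.scaleR_left
        by (simp add: power2_eq_square field_simps)
      show "\<bar>q (x + complex_of_real r * cis t) - (q x + (r * f' x 1 * cos t + r * f' x \<i> * sin t)
         + (r\<^sup>2 * f'' 1 1 / 2 * (cos t)\<^sup>2 + r\<^sup>2 * (f'' 1 \<i> + f'' \<i> 1) / 2 * (cos t * sin t) + r\<^sup>2 * f'' \<i> \<i> / 2 * (sin t)\<^sup>2))\<bar>
         \<le> \<eta> * r\<^sup>2"
        using d(2)[of "of_real r * cis t"] r unfolding 1 2 n by simp
    qed
    moreover have "(circle_mean q x r - q x) / r\<^sup>2 - (f'' 1 1 + f'' \<i> \<i>) / 4
       = (circle_mean q x r - (q x + (r\<^sup>2 * f'' 1 1 / 2 + r\<^sup>2 * f'' \<i> \<i> / 2) / 2)) / r\<^sup>2"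
      using r by (simp add: field_simps)
    ultimately show ?thesis using r by (simp add: abs_divide pos_divide_le_eq)
  qed
  then show ?thesis using that[of "min d 1"] d(1) by auto
qed

text \<open>
  Fubini: circle means commute with convolution. This carries the submean value property,
  and its quantitative form, from \<open>q\<close> to \<open>P\<close>.
\<close>

lemma circle_mean_P:
  assumes r: "\<bar>r\<bar> \<le> 1"
  shows "set_integrable lborel {0..2*pi} (\<lambda>t. P (c + of_real r * cis t))"
    and "integrable lborel (\<lambda>w. circle_mean q (c - w) r * mollifier w)"
    and "circle_mean P c r = (LINT w|lborel. circle_mean q (c - w) r * mollifier w)"
proof -
  define f where "f t w = indicator {0..2*pi} t * (q (c + of_real r * cis t - w) * mollifier w)" for t :: real and w :: complex
  have m1: "(\<lambda>x::real \<times> complex. q (c + of_real r * cis (fst x) - snd x)) \<in> borel_measurable borel"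
    by (rule measurable_compose[OF borel_measurable_continuous_onI q_measurable]) (intro continuous_intros)
  have m2: "(\<lambda>x::real \<times> complex. mollifier (snd x)) \<in> borel_measurable borel"
    by (rule borel_measurable_continuous_onI) (intro continuous_on_compose2[OF mollifier_continuous(1)[of UNIV]] continuous_intros, auto)
  have m3: "(\<lambda>x::real \<times> complex. indicator {0..2*pi} (fst x) :: real) \<in> borel_measurable borel"
    by (rule measurable_compose[OF borel_measurable_continuous_onI[OF continuous_on_fst[OF continuous_on_id]]]) auto
  have sets_eq: "sets (lborel \<Otimes>\<^sub>M lborel :: (real \<times> complex) measure) = sets borel"
    by (simp add: borel_prod[symmetric] cong: sets_pair_measure_cong)
  have mf: "case_prod f \<in> borel_measurable (lborel \<Otimes>\<^sub>M lborel)"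
    unfolding measurable_cong_sets[OF sets_eq refl] f_def[abs_def] split_def
    by (intro borel_measurable_times m1 m2 m3)
  have int: "integrable (lborel \<Otimes>\<^sub>M lborel) (case_prod f)"
  proof (rule Bochner_Integration.integrable_bound)
    let ?D = "\<lambda>x. (\<kappa>\<^sup>2 * q c) * indicator ({0..2*pi} \<times> cball (0::complex) 1) x :: real"
    have "emeasure (lborel \<Otimes>\<^sub>M lborel) ({0..2*pi} \<times> cball (0::complex) 1) < \<infinity>"
      using emeasure_bounded_finite[OF bounded_cball, of "0::complex" 1]
      by (subst lborel.emeasure_pair_measure_Times) (auto simp: ennreal_mult_less_top)
    then show "integrable (lborel \<Otimes>\<^sub>M lborel) ?D"
      by (intro integrable_mult_right integrable_real_indicator) auto
    show "AE x in lborel \<Otimes>\<^sub>M lborel. norm (case_prod f x) \<le> norm (?D x)"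
    proof (rule AE_I2)
      fix x :: "real \<times> complex"
      obtain t w where x: "x = (t, w)" by (cases x)
      show "norm (case_prod f x) \<le> norm (?D x)"
      proof (cases "cmod w \<le> 1 \<and> t \<in> {0..2*pi}")
        case True
        have "cmod (c - (c + of_real r * cis t - w)) \<le> cmod w + cmod (of_real r * cis t)"
          using norm_triangle_ineq4[of w "of_real r * cis t"] by simp
        then have "cmod (c - (c + of_real r * cis t - w)) \<le> 2" using True r by (simp add: norm_mult)
        from q_moderate_2[OF this] have "q (c + of_real r * cis t - w) * mollifier w \<le> \<kappa>\<^sup>2 * q c * 1"
          using mollifier_nonneg mollifier_le_1 q_ge_1[of c] by (intro mult_mono) auto
        moreover have "0 \<le> q (c + of_real r * cis t - w) * mollifier w"
          using mollifier_nonneg q_ge_1[of "c + of_real r * cis t - w"] by simp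
        ultimately show ?thesis using True by (simp add: x f_def)
      next
        case False
        then have "f t w = 0" using mollifier_support(1)[of w] by (auto simp: f_def)
        then show ?thesis by (simp add: x)
      qed
    qed
  qed (rule mf)
  have fst_eq: "(LINT w|lborel. f t w) = indicator {0..2*pi} t *\<^sub>R P (c + of_real r * cis t)" for t
    by (simp add: f_def P_reflect)
  have snd_eq: "(LINT t|lborel. f t w) = 2 * pi * (circle_mean q (c - w) r * mollifier w)" for w
  proof -
    have "(LINT t|lborel. f t w) = (LINT t|lborel. (indicator {0..2*pi} t *\<^sub>R q (c - w + of_real r * cis t)) * mollifier w)"
      by (rule Bochner_Integration.integral_cong) (auto simp: f_def algebra_simps)
    also have "\<dots> = (LBINT t:{0..2*pi}. q (c - w + of_real r * cis t)) * mollifier w"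
      unfolding set_lebesgue_integral_def by (rule integral_mult_left_zero)
    finally show ?thesis by (simp add: circle_mean_def)
  qed
  show "set_integrable lborel {0..2*pi} (\<lambda>t. P (c + of_real r * cis t))"
    using lborel_pair.integrable_fst[OF int] unfolding set_integrable_def fst_eq .
  have "integrable lborel (\<lambda>w. 2 * pi * (circle_mean q (c - w) r * mollifier w))"
    using lborel_pair.integrable_snd[OF int] unfolding snd_eq .
  then show "integrable lborel (\<lambda>w. circle_mean q (c - w) r * mollifier w)" by simp
  have "2 * pi * circle_mean P c r = (LINT t|lborel. LINT w|lborel. f t w)"
    unfolding fst_eq by (simp add: circle_mean_def set_lebesgue_integral_def)
  also have "\<dots> = (LINT w|lborel. LINT t|lborel. f t w)"
    by (rule lborel_pair.Fubini_integral[OF int, symmetric])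
  also have "\<dots> = 2 * pi * (LINT w|lborel. circle_mean q (c - w) r * mollifier w)"
    unfolding snd_eq by simp
  finally show "circle_mean P c r = (LINT w|lborel. circle_mean q (c - w) r * mollifier w)" by simp
qed

lemma circle_mean_P_Taylor:
  assumes r: "0 < r" "r \<le> 1"
  shows "\<bar>(circle_mean P c r - P c) / r\<^sup>2 - \<Lambda> c\<bar> \<le> A0 * q c * r"
proof -
  obtain \<alpha> \<beta> where T: "\<And>h. cmod h \<le> 1 \<Longrightarrow>
     \<bar>P (c + h) - (P c + Re (\<alpha> * h + \<beta> * h\<^sup>2) + \<Lambda> c * (cmod h)\<^sup>2)\<bar> \<le> A0 * q c * cmod h ^ 3"
    using P_Taylor by blast
  have "\<bar>circle_mean P c r - (P c + \<Lambda> c * r\<^sup>2 + (r\<^sup>2 * Re \<beta> + - (r\<^sup>2 * Re \<beta>)) / 2)\<bar> \<le> A0 * q c * r ^ 3"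
    unfolding circle_mean_def
  proof (rule circle_mean_trig[where b="r * Re \<alpha>" and c="- (r * Im \<alpha>)" and e="- 2 * r\<^sup>2 * Im \<beta>"])
    show "set_integrable lborel {0..2 * pi} (\<lambda>t. P (c + complex_of_real r * cis t))"
      using r by (intro circle_mean_P) auto
    fix t :: real
    let ?h = "of_real r * cis t"
    have n: "cmod ?h = r" using r by (simp add: norm_mult)
    have e: "P c + Re (\<alpha> * ?h + \<beta> * ?h\<^sup>2) + \<Lambda> c * r\<^sup>2 = P c + \<Lambda> c * r\<^sup>2 + (r * Re \<alpha> * cos t + - (r * Im \<alpha>) * sin t) +
          (r\<^sup>2 * Re \<beta> * (cos t)\<^sup>2 + - 2 * r\<^sup>2 * Im \<beta> * (cos t * sin t) + - (r\<^sup>2 * Re \<beta>) * (sin t)\<^sup>2)"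
      by (simp add: power2_eq_square algebra_simps)
    show "\<bar>P (c + complex_of_real r * cis t) - (P c + \<Lambda> c * r\<^sup>2 + (r * Re \<alpha> * cos t + - (r * Im \<alpha>) * sin t) +
          (r\<^sup>2 * Re \<beta> * (cos t)\<^sup>2 + - 2 * r\<^sup>2 * Im \<beta> * (cos t * sin t) + - (r\<^sup>2 * Re \<beta>) * (sin t)\<^sup>2))\<bar> \<le> A0 * q c * r ^ 3"
      using T[of ?h] r unfolding n e by simp
  qed
  moreover have "(circle_mean P c r - P c) / r\<^sup>2 - \<Lambda> c
     = (circle_mean P c r - (P c + \<Lambda> c * r\<^sup>2 + (r\<^sup>2 * Re \<beta> + - (r\<^sup>2 * Re \<beta>)) / 2)) / r\<^sup>2"
    using r by (simp add: field_simps)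
  ultimately show ?thesis
    using r by (simp add: abs_divide pos_divide_le_eq power2_eq_square power3_eq_cube mult.assoc)
qed

lemma Lambda_limit:
  "(\<lambda>n. (circle_mean P c (1 / real (Suc n)) - P c) / (1 / real (Suc n))\<^sup>2) \<longlonglongrightarrow> \<Lambda> c"
proof (rule LIM_zero_cancel, rule Lim_null_comparison[where g="\<lambda>n. A0 * q c * (1 / real (Suc n))"])
  show "\<forall>\<^sub>F n in sequentially. norm ((circle_mean P c (1 / real (Suc n)) - P c) / (1 / real (Suc n))\<^sup>2 - \<Lambda> c) \<le> A0 * q c * (1 / real (Suc n))"
    unfolding real_norm_def by (intro always_eventually allI circle_mean_P_Taylor) auto
  have "(\<lambda>n. A0 * q c * inverse (real (Suc n))) \<longlonglongrightarrow> A0 * q c * 0"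
    by (intro tendsto_intros LIMSEQ_inverse_real_of_nat)
  then show "(\<lambda>n. A0 * q c * (1 / real (Suc n))) \<longlonglongrightarrow> 0" by (simp add: inverse_eq_divide)
qed

end

locale subharmonic_weight = moderate_weight +
  assumes submean: "\<And>z r. 0 < r \<Longrightarrow> r \<le> 1 \<Longrightarrow> q z \<le> circle_mean q z r"
begin

lemma circle_mean_P_diff:
  assumes r: "0 < r" "r \<le> 1"
  shows "integrable lborel (\<lambda>w. (circle_mean q (c - w) r - q (c - w)) * mollifier w)"
    and "(LINT w|lborel. (circle_mean q (c - w) r - q (c - w)) * mollifier w) = circle_mean P c r - P c"
  using circle_mean_P(2,3)[of r c] q_mollifier_integrable[of c] r
  by (simp_all add: left_diff_distrib P_reflect)

lemma Lambda_nonneg: "0 \<le> \<Lambda> c"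
proof (rule LIMSEQ_le_const[OF Lambda_limit], intro exI allI impI)
  fix n :: nat
  have "0 \<le> (LINT w|lborel. (circle_mean q (c - w) (1 / real (Suc n)) - q (c - w)) * mollifier w)"
    by (rule integral_nonneg_AE) (auto intro!: AE_I2 mult_nonneg_nonneg mollifier_nonneg submean)
  then show "0 \<le> (circle_mean P c (1 / real (Suc n)) - P c) / (1 / real (Suc n))\<^sup>2"
    using circle_mean_P_diff(2)[of "1 / real (Suc n)" c] by simp
qed

text \<open>
  The excesses of the circle means of \<open>q\<close> are nonnegative, so by Fatou's lemma
  a pointwise lower bound for their limits survives the convolution, although nothing is
  known about the uniformity of the limits.
\<close>

lemma Lambda_ge:
  assumes lim: "\<And>w. cmod w < 1 \<Longrightarrow>
      (\<lambda>n. (circle_mean q (c - w) (1 / real (Suc n)) - q (c - w)) / (1 / real (Suc n))\<^sup>2) \<longlonglongrightarrow> L w"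
    and L: "\<And>w. cmod w < 1 \<Longrightarrow> a * q (c - w) \<le> L w" and a: "0 \<le> a"
  shows "a * P c \<le> \<Lambda> c"
proof -
  define u where "u n w = (circle_mean q (c - w) (1 / real (Suc n)) - q (c - w)) * mollifier w / (1 / real (Suc n))\<^sup>2"
    for n w
  have ui: "integrable lborel (u n)" for n
    unfolding u_def by (intro integrable_divide circle_mean_P_diff) auto
  have u0: "0 \<le> u n w" for n w
    unfolding u_def by (intro divide_nonneg_nonneg mult_nonneg_nonneg mollifier_nonneg) (auto simp: submean)
  have iu: "(LINT w|lborel. u n w) = (circle_mean P c (1 / real (Suc n)) - P c) / (1 / real (Suc n))\<^sup>2" for n
    unfolding u_def using circle_mean_P_diff(2)[of "1 / real (Suc n)" c] by simp
  have "ennreal (a * P c) = ennreal (LINT w|lborel. a * (q (c - w) * mollifier w))"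
    by (simp add: P_reflect)
  also have "\<dots> = (\<integral>\<^sup>+ w. ennreal (a * (q (c - w) * mollifier w)) \<partial>lborel)"
  proof (rule nn_integral_eq_integral[symmetric])
    show "integrable lborel (\<lambda>w. a * (q (c - w) * mollifier w))"
      by (intro integrable_mult_right q_mollifier_integrable)
    show "AE w in lborel. 0 \<le> a * (q (c - w) * mollifier w)"
      using a mollifier_nonneg order_trans[OF zero_le_one q_ge_1] by (auto intro!: AE_I2 mult_nonneg_nonneg)
  qed
  also have "\<dots> \<le> (\<integral>\<^sup>+ w. liminf (\<lambda>n. ennreal (u n w)) \<partial>lborel)"
  proof (rule nn_integral_mono)
    fix w
    show "ennreal (a * (q (c - w) * mollifier w)) \<le> liminf (\<lambda>n. ennreal (u n w))"
    proof (cases "cmod w < 1")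
      case True
      have "(\<lambda>n. (circle_mean q (c - w) (1 / real (Suc n)) - q (c - w)) / (1 / real (Suc n))\<^sup>2 * mollifier w) \<longlonglongrightarrow> L w * mollifier w"
        by (intro tendsto_mult lim[OF True] tendsto_const)
      then have "(\<lambda>n. ennreal (u n w)) \<longlonglongrightarrow> ennreal (L w * mollifier w)"
        unfolding u_def by (intro tendsto_ennrealI) (simp only: times_divide_eq_left)
      then have "liminf (\<lambda>n. ennreal (u n w)) = ennreal (L w * mollifier w)"
        by (rule lim_imp_Liminf[OF sequentially_bot])
      moreover have "a * (q (c - w) * mollifier w) \<le> L w * mollifier w"
        using mult_right_mono[OF L[OF True] mollifier_nonneg] by (simp add: mult.assoc)
      ultimately show ?thesis by (simp add: ennreal_leI)
    next
      case False then show ?thesis using mollifier_support(1)[of w] by simp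
    qed
  qed
  also have "\<dots> \<le> liminf (\<lambda>n. \<integral>\<^sup>+ w. ennreal (u n w) \<partial>lborel)"
    by (rule nn_integral_liminf) (use ui borel_measurable_integrable in auto)
  also have "(\<lambda>n. \<integral>\<^sup>+ w. ennreal (u n w) \<partial>lborel) = (\<lambda>n. ennreal (LINT w|lborel. u n w))"
    using nn_integral_eq_integral[OF ui] u0 by auto
  also have "liminf \<dots> = ennreal (\<Lambda> c)"
    unfolding iu by (intro lim_imp_Liminf[OF sequentially_bot] tendsto_ennrealI Lambda_limit)
  finally show ?thesis using Lambda_nonneg by (simp add: ennreal_le_iff)
qed

end

section \<open>Local holomorphic peaks\<close>

definition log_weight :: "complex \<Rightarrow> real" where "log_weight z = ln (1 + (cmod z)\<^sup>2)"

lemma Lagrange_identity: "(1 + (cmod c)\<^sup>2) * (1 + (cmod z)\<^sup>2) = (cmod (1 + cnj c * z))\<^sup>2 + (cmod (z - c))\<^sup>2"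
  unfolding cmod_power2 by (simp add: power2_eq_square algebra_simps)

lemma Re_one_plus_cnj_mult:
  assumes "cmod (z - c) \<le> 1" shows "3/4 \<le> Re (1 + cnj c * z)"
proof -
  have "Re (1 + cnj c * z) = 1 + (cmod c)\<^sup>2 + Re (cnj c * (z - c))"
    unfolding cmod_power2 by (simp add: power2_eq_square algebra_simps)
  moreover have "\<bar>Re (cnj c * (z - c))\<bar> \<le> cmod c * cmod (z - c)"
    using abs_Re_le_cmod[of "cnj c * (z - c)"] unfolding norm_mult complex_mod_cnj .
  moreover have "cmod c * cmod (z - c) \<le> cmod c * 1" using assms by (intro mult_left_mono) auto
  moreover have "0 \<le> (cmod c - 1/2)\<^sup>2" by simp
  then have "cmod c \<le> (cmod c)\<^sup>2 + 1/4" by (simp add: power2_eq_square algebra_simps)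
  ultimately show ?thesis by linarith
qed

text \<open>
  By Lagrange's identity, \<open>ln (1 + \<bar>z\<bar>\<^sup>2)\<close> minus the
  harmonic function
  \<open>2 ln \<bar>1 + cnj c z\<bar> - ln (1 + \<bar>c\<bar>\<^sup>2)\<close> is
  an explicit function with a strict minimum at \<open>c\<close>.
\<close>

lemma log_weight_peak:
  obtains h where "h holomorphic_on ball c 1"
    "\<And>z. cmod (z - c) < 1 \<Longrightarrow> log_weight z - Re (h z) = ln (1 + (cmod (z - c))\<^sup>2 / (cmod (1 + cnj c * z))\<^sup>2)"
proof
  let ?h = "\<lambda>z. 2 * Ln (1 + cnj c * z) - of_real (ln (1 + (cmod c)\<^sup>2))"
  show "?h holomorphic_on ball c 1"
  proof (intro holomorphic_intros)
    fix z assume "z \<in> ball c 1"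
    then have "3/4 \<le> Re (1 + cnj c * z)"
      by (intro Re_one_plus_cnj_mult) (simp add: dist_norm norm_minus_commute)
    then show "1 + cnj c * z \<notin> \<real>\<^sub>\<le>\<^sub>0" using complex_nonpos_Reals_iff[of "1 + cnj c * z"] by linarith
  qed
  fix z assume z: "cmod (z - c) < 1"
  let ?w = "1 + cnj c * z"
  have "3/4 \<le> Re ?w" by (rule Re_one_plus_cnj_mult) (use z in auto)
  then have w: "cmod ?w > 0" using complex_Re_le_cmod[of ?w] by linarith
  have p: "1 + (cmod c)\<^sup>2 > 0" "1 + (cmod z)\<^sup>2 > 0" by (simp_all add: add_pos_nonneg)
  have "1 + (cmod (z - c))\<^sup>2 / (cmod ?w)\<^sup>2 = (1 + (cmod c)\<^sup>2) * (1 + (cmod z)\<^sup>2) / (cmod ?w)\<^sup>2"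
    unfolding Lagrange_identity using w by (simp add: field_simps)
  also have "ln \<dots> = ln (1 + (cmod c)\<^sup>2) + ln (1 + (cmod z)\<^sup>2) - 2 * ln (cmod ?w)"
    using p w by (simp add: ln_div ln_mult ln_realpow)
  finally show "log_weight z - Re (?h z) = ln (1 + (cmod (z - c))\<^sup>2 / (cmod ?w)\<^sup>2)"
    using w by (simp add: log_weight_def Re_Ln)
qed

context moderate_weight
begin

lemma q_le_power: "cmod z \<le> real n \<Longrightarrow> q z \<le> \<kappa> ^ n * q 0"
proof (induction n arbitrary: z)
  case 0 then show ?case by simp
next
  case (Suc n)
  define w where "w = (real n / real (Suc n)) *\<^sub>R z"
  have "cmod w = real n / real (Suc n) * cmod z" by (simp add: w_def)
  also have "\<dots> \<le> real n / real (Suc n) * real (Suc n)" using Suc.prems by (intro mult_left_mono) auto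
  finally have 1: "cmod w \<le> real n" by simp
  have "real n / real (Suc n) = 1 - 1 / real (Suc n)" by (simp add: field_simps)
  then have "w - z = - ((1 / real (Suc n)) *\<^sub>R z)" unfolding w_def by (simp only: scaleR_left_diff_distrib) simp
  then have "cmod (w - z) = cmod z / real (Suc n)" by simp
  then have "cmod (w - z) \<le> 1" using Suc.prems by (simp add: pos_divide_le_eq)
  then have "q z \<le> \<kappa> * q w" by (rule q_moderate)
  also have "\<dots> \<le> \<kappa> * (\<kappa> ^ n * q 0)" using Suc.IH[OF 1] kappa_ge_1 by (intro mult_left_mono) auto
  finally show ?case by simp
qed

lemma q_bounded: "\<exists>Q>0. \<forall>z. cmod z \<le> R \<longrightarrow> q z \<le> Q"
proof -
  obtain n where n: "R \<le> real n" using real_arch_simple by blast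
  show ?thesis
  proof (intro exI[of _ "\<kappa> ^ n * q 0"] conjI allI impI)
    show "\<kappa> ^ n * q 0 > 0" using kappa_ge_1 q_ge_1[of 0] by simp
  qed (use n q_le_power in force)
qed

end

context subharmonic_weight
begin

text \<open>
  Take \<open>\<Phi> = P + K1 * log_weight\<close>, and for \<open>h\<close> the
  holomorphic part of the Taylor polynomial of \<open>P\<close> at \<open>c\<close> plus
  \<open>K1\<close> times the holomorphic function that belongs to
  \<open>log_weight\<close>. Then \<open>\<Phi> - Re h\<close> is
  \<open>\<Lambda> c * (cmod (z - c))\<^sup>2\<close>, plus \<open>K1\<close> times a
  nonnegative function, plus a cubic error of size \<open>O(q)\<close>. On the annulus the
  cubic error is outweighed by the first term if \<open>cmod c \<ge> R\<close>, and by
  the second one otherwise, if \<open>K1\<close> is large. On the disc of radius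
  \<open>\<delta>\<close> all terms are \<open>O(\<delta>\<^sup>2 q)\<close>.
\<close>

theorem local_peaks:
  assumes c1: "c1 > 0" "\<And>c. cmod c \<ge> R \<Longrightarrow> c1 * q c \<le> \<Lambda> c"
    and K: "K \<ge> 0" "\<And>z. log_weight z \<le> K * q z"
  shows "\<exists>\<Phi> A \<gamma> \<epsilon> \<delta>. A > 0 \<and> \<gamma> > 0 \<and> 0 < \<delta> \<and> \<delta> < \<epsilon> / 2 \<and> \<epsilon> \<le> 1/8 \<and>
    (\<forall>z. q z \<le> A * \<Phi> z \<and> \<Phi> z \<le> A * q z) \<and>
    (\<forall>c. \<exists>h. h holomorphic_on ball c 1 \<and>
      (\<forall>z. cmod (z - c) < \<delta> \<longrightarrow> \<Phi> z - Re (h z) \<le> \<gamma> * q c) \<and>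
      (\<forall>z. \<epsilon> / 2 \<le> cmod (z - c) \<and> cmod (z - c) < \<epsilon> \<longrightarrow> 2 * \<gamma> * q c \<le> \<Phi> z - Re (h z)) \<and>
      (\<forall>z. cmod (z - c) < \<epsilon> \<longrightarrow> - (A * q c) \<le> \<Phi> z - Re (h z)))"
proof -
  \<comment> \<open>For
    \<open>\<epsilon> / 2 \<le> cmod (z - c) < \<epsilon>\<close> the quadratic term
    is at least \<open>c1 / 4\<close> and the cubic error at most \<open>c1 / 8\<close>
    times \<open>\<epsilon>\<^sup>2 * q c\<close>; the difference is
    \<open>2 * \<gamma> * q c\<close>.\<close>
  define \<epsilon> where "\<epsilon> = min (1/8) (c1 / (8 * A0))"
  have eps: "0 < \<epsilon>" "\<epsilon> \<le> 1/8" "A0 * \<epsilon> \<le> c1 / 8"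
  proof -
    show "0 < \<epsilon>" "\<epsilon> \<le> 1/8" using c1(1) A0_pos by (auto simp: \<epsilon>_def)
    have "\<epsilon> \<le> c1 / (8 * A0)" by (simp add: \<epsilon>_def)
    then show "A0 * \<epsilon> \<le> c1 / 8" using A0_pos by (simp add: field_simps)
  qed
  define \<gamma> where "\<gamma> = \<epsilon>\<^sup>2 * c1 / 16"
  have g0: "\<gamma> > 0" using eps c1(1) by (simp add: \<gamma>_def)
  obtain Q where Q: "Q > 0" "\<And>z. cmod z \<le> \<bar>R\<bar> \<Longrightarrow> q z \<le> Q" using q_bounded by blast
  define R' where "R' = 1 + \<bar>R\<bar> * (\<bar>R\<bar> + 1)"
  have R': "R' > 0" by (simp add: R'_def add_pos_nonneg)
  \<comment> \<open>A lower bound on the annulus for the nonnegative function that belongs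
    to \<open>log_weight\<close>, uniform for \<open>cmod c \<le> \<bar>R\<bar>\<close>;
    \<open>R'\<close> bounds \<open>cmod (1 + cnj c * z)\<close>.\<close>
  define b where "b = ln (1 + (\<epsilon> / 2)\<^sup>2 / R'\<^sup>2)"
  have b0: "b > 0" unfolding b_def using eps R' by (intro ln_gt_zero) simp
  define K1 where "K1 = (A0 * Q * \<epsilon> ^ 3 + 2 * \<gamma> * Q) / b"
  have K10: "K1 \<ge> 0" using A0_pos Q(1) eps g0 b0 by (simp add: K1_def)
  have K1b: "K1 * b = A0 * Q * \<epsilon> ^ 3 + 2 * \<gamma> * Q" using b0 by (simp add: K1_def)
  define X where "X = 2 * A0 + 2 * K1"
  have X0: "X > 0" using A0_pos K10 by (simp add: X_def add_pos_nonneg)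
  define \<delta> where "\<delta> = min (\<epsilon> / 4) (\<gamma> / X)"
  have del: "0 < \<delta>" "\<delta> < \<epsilon> / 2" "\<delta> \<le> 1" "\<delta>\<^sup>2 * X \<le> \<gamma>"
  proof -
    show d: "0 < \<delta>" "\<delta> < \<epsilon> / 2" "\<delta> \<le> 1" using eps g0 X0 by (auto simp: \<delta>_def)
    have "\<delta>\<^sup>2 * X \<le> (1 * \<delta>) * X"
      unfolding power2_eq_square using d X0 by (intro mult_right_mono) auto
    also have "\<dots> \<le> \<gamma>" using X0 by (simp add: \<delta>_def min_def field_simps)
    finally show "\<delta>\<^sup>2 * X \<le> \<gamma>" .
  qed
  define \<Phi> where "\<Phi> z = P z + K1 * log_weight z" for z
  define A where "A = \<kappa> / mass + A0 + K1 * K"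
  have A0': "A > 0" "A0 \<le> A" "\<kappa> / mass \<le> A" "A0 + K1 * K \<le> A"
  proof -
    have "\<kappa> / mass > 0" using kappa_ge_1 mass_pos by simp
    moreover have "K1 * K \<ge> 0" using K10 K(1) by simp
    ultimately show "A > 0" "A0 \<le> A" "\<kappa> / mass \<le> A" "A0 + K1 * K \<le> A"
      using A0_pos unfolding A_def by linarith+
  qed
  have log_weight0: "log_weight z \<ge> 0" for z by (simp add: log_weight_def)
  show ?thesis
  proof (rule exI[of _ \<Phi>], rule exI[of _ A], rule exI[of _ \<gamma>], rule exI[of _ \<epsilon>], rule exI[of _ \<delta>], intro conjI allI)
    fix z
    have lo: "mass / \<kappa> * q z \<le> \<Phi> z"
      using P_ge[of z] mult_nonneg_nonneg[OF K10 log_weight0[of z]] unfolding \<Phi>_def by linarith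
    have "\<kappa> / mass * (mass / \<kappa> * q z) \<le> \<kappa> / mass * \<Phi> z"
      using mass_pos kappa_ge_1 by (intro mult_left_mono[OF lo]) simp
    then have "q z \<le> \<kappa> / mass * \<Phi> z" using mass_pos kappa_ge_1 by simp
    moreover have "0 \<le> mass / \<kappa> * q z"
      using mass_pos kappa_ge_1 q_ge_1[of z] by (intro mult_nonneg_nonneg divide_nonneg_nonneg) auto
    then have "\<Phi> z \<ge> 0" using lo by linarith
    then have "\<kappa> / mass * \<Phi> z \<le> A * \<Phi> z" using A0' by (intro mult_right_mono)
    ultimately show "q z \<le> A * \<Phi> z" by linarith
    have "\<Phi> z \<le> A0 * q z + K1 * (K * q z)"
      unfolding \<Phi>_def by (intro add_mono P_le mult_left_mono K K10)
    also have "\<dots> = (A0 + K1 * K) * q z" by (simp add: algebra_simps)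
    also have "\<dots> \<le> A * q z" using A0' q_ge_1[of z] by (intro mult_right_mono) auto
    finally show "\<Phi> z \<le> A * q z" .
  next
    fix c
    obtain \<alpha> \<beta> where T: "\<And>h. cmod h \<le> 1 \<Longrightarrow>
       \<bar>P (c + h) - (P c + Re (\<alpha> * h + \<beta> * h\<^sup>2) + \<Lambda> c * (cmod h)\<^sup>2)\<bar> \<le> A0 * q c * cmod h ^ 3"
      using P_Taylor by blast
    obtain h1 where h1: "h1 holomorphic_on ball c 1"
      "\<And>z. cmod (z - c) < 1 \<Longrightarrow> log_weight z - Re (h1 z) = ln (1 + (cmod (z - c))\<^sup>2 / (cmod (1 + cnj c * z))\<^sup>2)"
      using log_weight_peak by blast
    define h where "h z = of_real (P c) + \<alpha> * (z - c) + \<beta> * (z - c)\<^sup>2 + of_real K1 * h1 z" for z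
    define e where "e z = ln (1 + (cmod (z - c))\<^sup>2 / (cmod (1 + cnj c * z))\<^sup>2)" for z
    define \<rho> where "\<rho> z = P z - (P c + Re (\<alpha> * (z - c) + \<beta> * (z - c)\<^sup>2) + \<Lambda> c * (cmod (z - c))\<^sup>2)" for z
    have rho: "\<bar>\<rho> z\<bar> \<le> A0 * q c * cmod (z - c) ^ 3" if "cmod (z - c) < 1" for z
      using T[of "z - c"] that by (simp add: \<rho>_def)
    have eq: "\<Phi> z - Re (h z) = \<Lambda> c * (cmod (z - c))\<^sup>2 + \<rho> z + K1 * e z" if "cmod (z - c) < 1" for z
    proof -
      have "Re (h z) = P c + Re (\<alpha> * (z - c) + \<beta> * (z - c)\<^sup>2) + K1 * Re (h1 z)"
        by (simp add: h_def)
      then show ?thesis using h1(2)[OF that] by (simp add: \<Phi>_def \<rho>_def e_def algebra_simps)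
    qed
    have w34: "3/4 \<le> cmod (1 + cnj c * z)" if "cmod (z - c) < 1" for z
      using Re_one_plus_cnj_mult[of z c] complex_Re_le_cmod[of "1 + cnj c * z"] that by simp
    have e0: "0 \<le> e z" for z unfolding e_def by (intro ln_ge_zero) simp
    have e_le: "e z \<le> 2 * (cmod (z - c))\<^sup>2" if z: "cmod (z - c) < 1" for z
    proof -
      have "e z \<le> (cmod (z - c))\<^sup>2 / (cmod (1 + cnj c * z))\<^sup>2"
        unfolding e_def by (rule ln_add_one_self_le_self) simp
      also have "\<dots> \<le> (cmod (z - c))\<^sup>2 / (3/4)\<^sup>2"
        using w34[OF z] by (intro divide_left_mono power_mono mult_pos_pos zero_less_power) auto
      also have "\<dots> \<le> 2 * (cmod (z - c))\<^sup>2" by (simp add: power2_eq_square)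
      finally show ?thesis .
    qed
    have qc: "1 \<le> q c" by (rule q_ge_1)
    have cub: "A0 * q c * cmod (z - c) ^ 3 \<le> A0 * q c * r ^ 3" if "cmod (z - c) \<le> r" for z r
      using that A0_pos qc by (intro mult_left_mono power_mono) auto
    have part1: "h holomorphic_on ball c 1"
      unfolding h_def by (intro holomorphic_intros h1)
    have part2: "\<Phi> z - Re (h z) \<le> \<gamma> * q c" if z: "cmod (z - c) < \<delta>" for z
    proof -
      have z1: "cmod (z - c) < 1" using z del by simp
      have z2: "(cmod (z - c))\<^sup>2 \<le> \<delta>\<^sup>2" using z by (intro power_mono) auto
      have "\<Lambda> c * (cmod (z - c))\<^sup>2 \<le> A0 * q c * \<delta>\<^sup>2"
        using Lambda_le[of c] Lambda_nonneg[of c] z2 by (intro mult_mono) auto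
      moreover have "\<rho> z \<le> A0 * q c * \<delta>\<^sup>2"
      proof -
        have "\<rho> z \<le> A0 * q c * \<delta> ^ 3" using rho[OF z1] cub[of z \<delta>] z by simp
        also have "\<dots> \<le> A0 * q c * \<delta>\<^sup>2"
          using del A0_pos qc by (intro mult_left_mono power_decreasing) auto
        finally show ?thesis .
      qed
      moreover have "K1 * e z \<le> 2 * K1 * \<delta>\<^sup>2 * q c"
      proof -
        have "K1 * e z \<le> K1 * (2 * \<delta>\<^sup>2)" using e_le[OF z1] z2 K10 by (intro mult_left_mono) auto
        also have "\<dots> \<le> K1 * (2 * \<delta>\<^sup>2) * q c" using K10 qc mult_left_mono[of 1 "q c" "K1 * (2 * \<delta>\<^sup>2)"] by simp
        finally show ?thesis by (simp add: algebra_simps)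
      qed
      ultimately have "\<Phi> z - Re (h z) \<le> (\<delta>\<^sup>2 * X) * q c"
        unfolding eq[OF z1] X_def by (simp add: algebra_simps)
      also have "\<dots> \<le> \<gamma> * q c" using del qc by (intro mult_right_mono) auto
      finally show ?thesis .
    qed
    have part4: "- (A * q c) \<le> \<Phi> z - Re (h z)" if z: "cmod (z - c) < \<epsilon>" for z
    proof -
      have z1: "cmod (z - c) < 1" using z eps by simp
      have "A0 * q c * cmod (z - c) ^ 3 \<le> A0 * q c * 1 ^ 3" by (rule cub) (use z1 in auto)
      moreover have "A0 * q c \<le> A * q c" using A0' qc by (intro mult_right_mono) auto
      moreover have "0 \<le> \<Lambda> c * (cmod (z - c))\<^sup>2" using Lambda_nonneg[of c] by simp
      moreover have "0 \<le> K1 * e z" using K10 e0 by simp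
      ultimately show ?thesis unfolding eq[OF z1] using rho[OF z1] by simp
    qed
    have part3: "2 * \<gamma> * q c \<le> \<Phi> z - Re (h z)" if z: "\<epsilon> / 2 \<le> cmod (z - c)" "cmod (z - c) < \<epsilon>" for z
    proof -
      have z1: "cmod (z - c) < 1" using z eps by simp
      have rz: "- (A0 * q c * \<epsilon> ^ 3) \<le> \<rho> z" using rho[OF z1] cub[of z \<epsilon>] z by simp
      have z2: "(\<epsilon> / 2)\<^sup>2 \<le> (cmod (z - c))\<^sup>2" using z eps by (intro power_mono) auto
      show ?thesis
      proof (cases "R \<le> cmod c")
        case True
        have "c1 * q c * (\<epsilon> / 2)\<^sup>2 \<le> \<Lambda> c * (cmod (z - c))\<^sup>2"
          using c1 True z2 qc Lambda_nonneg by (intro mult_mono) auto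
        moreover have "A0 * q c * \<epsilon> ^ 3 \<le> c1 / 8 * (q c * \<epsilon>\<^sup>2)"
        proof -
          have "0 \<le> q c * \<epsilon>\<^sup>2" using qc by simp
          from mult_right_mono[OF eps(3) this] show ?thesis
            by (simp add: power2_eq_square power3_eq_cube algebra_simps)
        qed
        moreover have "0 \<le> K1 * e z" using K10 e0 by simp
        moreover have "c1 * q c * (\<epsilon> / 2)\<^sup>2 - c1 / 8 * (q c * \<epsilon>\<^sup>2) = 2 * \<gamma> * q c"
          by (simp add: \<gamma>_def power2_eq_square field_simps)
        ultimately show ?thesis unfolding eq[OF z1] using rz by linarith
      next
        case False
        then have cR: "cmod c \<le> \<bar>R\<bar>" by simp
        have qQ: "q c \<le> Q" by (rule Q(2)[OF cR])
        have "cmod z \<le> cmod c + cmod (z - c)" by (metis norm_triangle_sub)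
        then have "cmod z \<le> \<bar>R\<bar> + 1" using cR z1 by simp
        then have "cmod c * cmod z \<le> \<bar>R\<bar> * (\<bar>R\<bar> + 1)" using cR by (intro mult_mono) auto
        then have wR: "cmod (1 + cnj c * z) \<le> R'"
          using norm_triangle_ineq[of 1 "cnj c * z"] by (simp add: R'_def norm_mult)
        have w0: "cmod (1 + cnj c * z) > 0" using w34[OF z1] by linarith
        have "(\<epsilon> / 2)\<^sup>2 / R'\<^sup>2 \<le> (cmod (z - c))\<^sup>2 / (cmod (1 + cnj c * z))\<^sup>2"
          by (rule frac_le[OF zero_le_power2 z2 _ power_mono[OF wR norm_ge_zero]]) (use w0 in simp)
        then have "b \<le> e z" unfolding b_def e_def by (subst ln_le_cancel_iff) (auto intro: add_pos_nonneg)
        then have "K1 * b \<le> K1 * e z" using K10 by (intro mult_left_mono)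
        moreover have "A0 * q c * \<epsilon> ^ 3 \<le> A0 * Q * \<epsilon> ^ 3"
          using qQ A0_pos eps by (intro mult_right_mono mult_left_mono) auto
        moreover have "2 * \<gamma> * q c \<le> 2 * \<gamma> * Q" using qQ g0 by (intro mult_left_mono) auto
        moreover have "0 \<le> \<Lambda> c * (cmod (z - c))\<^sup>2" using Lambda_nonneg[of c] by simp
        ultimately show ?thesis unfolding eq[OF z1] using rz K1b by linarith
      qed
    qed
    show "\<exists>h. h holomorphic_on ball c 1 \<and>
      (\<forall>z. cmod (z - c) < \<delta> \<longrightarrow> \<Phi> z - Re (h z) \<le> \<gamma> * q c) \<and>
      (\<forall>z. \<epsilon> / 2 \<le> cmod (z - c) \<and> cmod (z - c) < \<epsilon> \<longrightarrow> 2 * \<gamma> * q c \<le> \<Phi> z - Re (h z)) \<and>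
      (\<forall>z. cmod (z - c) < \<epsilon> \<longrightarrow> - (A * q c) \<le> \<Phi> z - Re (h z))"
      using part1 part2 part3 part4 by blast
  qed (use A0' g0 del eps in auto)
qed

end

lemma weight_subharmonic_weight:
  assumes p: "weight p"
  obtains \<kappa> where "subharmonic_weight (\<lambda>z. p z + 1) \<kappa>"
proof -
  obtain C1 C2 where C: "C1 > 0" "C2 > 0" "\<And>z w. cmod (z - w) \<le> 1 \<Longrightarrow> p w \<le> C1 * p z + C2"
    using p by (auto simp: weight_def)
  have p0: "0 \<le> p z" for z using p by (simp add: weight_def)
  have pm: "p \<in> borel_measurable borel"
    unfolding borel_measurable_iff_less using p by (auto simp: weight_def subharmonic_def)
  interpret moderate_weight "\<lambda>z. p z + 1" "C1 + C2 + 1"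
  proof
    fix z w :: complex assume "cmod (z - w) \<le> 1"
    then have "p w + 1 \<le> C1 * p z + C2 + 1" using C(3) by simp
    also have "\<dots> \<le> (C1 + C2 + 1) * (p z + 1)" using C p0[of z] by (simp add: algebra_simps)
    finally show "p w + 1 \<le> (C1 + C2 + 1) * (p z + 1)" .
  qed (use p0 pm in auto)
  have "subharmonic_weight (\<lambda>z. p z + 1) (C1 + C2 + 1)"
  proof
    fix z :: complex and r :: real assume r: "0 < r" "r \<le> 1"
    have one: "set_integrable lborel {0..2*pi} (\<lambda>t. 1::real)"
      unfolding set_integrable_def by (auto intro!: integrable_real_indicator)
    have q: "set_integrable lborel {0..2*pi} (\<lambda>t. p (z + of_real r * cis t) + 1)"
      by (rule circle_integrable) (use r in auto)
    have "set_integrable lborel {0..2*pi} (\<lambda>t. p (z + of_real r * cis t))"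
      using set_integral_diff(1)[OF q one] by simp
    then have "(LBINT t:{0..2*pi}. p (z + of_real r * cis t) + 1)
        = (LBINT t:{0..2*pi}. p (z + of_real r * cis t)) + (LBINT t:{0..2*pi}. 1)"
      using one by (rule set_integral_add)
    moreover have "(LBINT t:{0..2*pi}. 1) = 2 * pi" by (simp add: set_lebesgue_integral_def)
    ultimately have "circle_mean (\<lambda>z. p z + 1) z r = 1 / (2 * pi) * (LBINT t:{0..2*pi}. p (z + of_real r * cis t)) + 1"
      by (simp add: circle_mean_def add_divide_distrib)
    then show "p z + 1 \<le> circle_mean (\<lambda>z. p z + 1) z r"
      using p r by (simp add: weight_def subharmonic_def)
  qed
  then show ?thesis by (rule that)
qed

lemma weight_log_weight_bound:
  assumes p: "weight p" shows "\<exists>K\<ge>0. \<forall>z. log_weight z \<le> K * (p z + 1)"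
proof -
  have p0: "0 \<le> p z" for z using p by (simp add: weight_def)
  have "(\<lambda>z. ln (1 + (cmod z)\<^sup>2)) \<in> O[at_infinity](p)" using p by (simp add: weight_def)
  then obtain C where C: "C > 0" "\<forall>\<^sub>F z in at_infinity. norm (ln (1 + (cmod z)\<^sup>2)) \<le> C * norm (p z)"
    by (rule landau_o.bigE)
  then obtain b where b: "\<And>z. b \<le> cmod z \<Longrightarrow> log_weight z \<le> C * p z"
    using p0 by (auto simp: eventually_at_infinity log_weight_def)
  define K where "K = C + ln (1 + b\<^sup>2)"
  have K0: "ln (1 + b\<^sup>2) \<ge> 0" by simp
  show ?thesis
  proof (intro exI[of _ K] conjI allI)
    show "K \<ge> 0" using C(1) K0 by (simp add: K_def)
    fix z
    show "log_weight z \<le> K * (p z + 1)"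
    proof (cases "b \<le> cmod z")
      case True
      have "log_weight z \<le> C * p z" by (rule b[OF True])
      also have "\<dots> \<le> K * (p z + 1)" unfolding K_def using C(1) K0 p0[of z] by (intro mult_mono) auto
      finally show ?thesis .
    next
      case False
      then have "log_weight z \<le> ln (1 + b\<^sup>2)"
        unfolding log_weight_def by (subst ln_le_cancel_iff) (auto intro!: power_mono add_pos_nonneg)
      also have "\<dots> * 1 \<le> K * (p z + 1)" unfolding K_def using C(1) K0 p0[of z] by (intro mult_mono) auto
      finally show ?thesis by simp
    qed
  qed
qed

text \<open>
  Far out \<open>p \<ge> 1\<close>, because \<open>p\<close> dominates a multiple of the
  logarithm, so that \<open>p + 1 \<le> 2 * p\<close> is bounded by a multiple of the
  Laplacian of \<open>p\<close>. Hence \<open>Lambda_ge\<close> gives the lower bound for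
  \<open>\<Lambda>\<close> on which \<open>local_peaks\<close> rests.
\<close>

theorem weight_local_peaks:
  assumes p: "weight p" and C2: "C2_on p {z. cmod z > R0}" and O: "p \<in> O[at_infinity](laplacian p)"
    and \<kappa>: "subharmonic_weight (\<lambda>z. p z + 1) \<kappa>"
  shows "\<exists>\<Phi> A \<gamma> \<epsilon> \<delta>. A > 0 \<and> \<gamma> > 0 \<and> 0 < \<delta> \<and> \<delta> < \<epsilon> / 2 \<and> \<epsilon> \<le> 1/8 \<and>
    (\<forall>z. p z + 1 \<le> A * \<Phi> z \<and> \<Phi> z \<le> A * (p z + 1)) \<and>
    (\<forall>c. \<exists>h. h holomorphic_on ball c 1 \<and>
      (\<forall>z. cmod (z - c) < \<delta> \<longrightarrow> \<Phi> z - Re (h z) \<le> \<gamma> * (p c + 1)) \<and>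
      (\<forall>z. \<epsilon> / 2 \<le> cmod (z - c) \<and> cmod (z - c) < \<epsilon> \<longrightarrow> 2 * \<gamma> * (p c + 1) \<le> \<Phi> z - Re (h z)) \<and>
      (\<forall>z. cmod (z - c) < \<epsilon> \<longrightarrow> - (A * (p c + 1)) \<le> \<Phi> z - Re (h z)))"
proof -
  interpret subharmonic_weight "\<lambda>z. p z + 1" \<kappa> by (rule \<kappa>)
  let ?S = "{z. cmod z > R0}"
  have oS: "open ?S" by (intro open_Collect_less continuous_intros)
  obtain p' :: "complex \<Rightarrow> complex \<Rightarrow>\<^sub>L real" and p'' :: "complex \<Rightarrow> complex \<Rightarrow>\<^sub>L complex \<Rightarrow>\<^sub>L real"
    where d1: "\<And>z. z \<in> ?S \<Longrightarrow> (p has_derivative blinfun_apply (p' z)) (at z)"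
      and d2: "\<And>z. z \<in> ?S \<Longrightarrow> (p' has_derivative blinfun_apply (p'' z)) (at z)"
    using C2 unfolding C2_on_def by blast
  have p0: "0 \<le> p z" for z using p by (simp add: weight_def)
  have lim: "(\<lambda>n. (circle_mean (\<lambda>z. p z + 1) x (1 / real (Suc n)) - (p x + 1)) / (1 / real (Suc n))\<^sup>2)
      \<longlonglongrightarrow> laplacian p x / 4" if x: "x \<in> ?S" for x
  proof (rule LIMSEQ_I)
    fix e :: real assume e: "e > 0"
    have q1: "((\<lambda>z. p z + 1) has_derivative blinfun_apply (p' w)) (at w)" if "w \<in> ?S" for w
      using has_derivative_add[OF d1[OF that] has_derivative_const[of 1]] by simp
    have "e / 2 > 0" using e by simp
    then obtain d where d: "d > 0" "\<And>r. 0 < r \<Longrightarrow> r < d \<Longrightarrow>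
      \<bar>(circle_mean (\<lambda>z. p z + 1) x r - (p x + 1)) / r\<^sup>2 - (p'' x 1 1 + p'' x \<i> \<i>) / 4\<bar> \<le> e / 2"
      using circle_mean_second_order[OF oS x q1 d2[OF x]] by blast
    have lap: "laplacian p x = p'' x 1 1 + p'' x \<i> \<i>" by (rule laplacian_eq[OF oS x d1 d2[OF x]])
    have "(\<lambda>n. inverse (real (Suc n))) \<longlonglongrightarrow> 0" by (rule LIMSEQ_inverse_real_of_nat)
    then have "\<forall>\<^sub>F n in sequentially. 1 / real (Suc n) < d"
      using d(1) by (simp add: order_tendsto_iff inverse_eq_divide)
    then obtain N where N: "\<And>n. n \<ge> N \<Longrightarrow> 1 / real (Suc n) < d" unfolding eventually_sequentially by blast
    show "\<exists>N. \<forall>n\<ge>N. norm ((circle_mean (\<lambda>z. p z + 1) x (1 / real (Suc n)) - (p x + 1)) / (1 / real (Suc n))\<^sup>2 - laplacian p x / 4) < e"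
    proof (intro exI[of _ N] allI impI)
      fix n assume "N \<le> n"
      then have "\<bar>(circle_mean (\<lambda>z. p z + 1) x (1 / real (Suc n)) - (p x + 1)) / (1 / real (Suc n))\<^sup>2 - laplacian p x / 4\<bar> \<le> e / 2"
        unfolding lap by (intro d(2) N) auto
      also have "\<dots> < e" using e by simp
      finally show "norm ((circle_mean (\<lambda>z. p z + 1) x (1 / real (Suc n)) - (p x + 1)) / (1 / real (Suc n))\<^sup>2 - laplacian p x / 4) < e"
        unfolding real_norm_def .
    qed
  qed
  have lap0: "0 \<le> laplacian p x" if x: "x \<in> ?S" for x
  proof -
    have "0 \<le> laplacian p x / 4"
    proof (rule LIMSEQ_le_const[OF lim[OF x]], intro exI allI impI)
      fix n :: nat
      show "0 \<le> (circle_mean (\<lambda>z. p z + 1) x (1 / real (Suc n)) - (p x + 1)) / (1 / real (Suc n))\<^sup>2"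
        using submean[of "1 / real (Suc n)" x] by simp
    qed
    then show ?thesis by simp
  qed
  obtain K where K: "K \<ge> 0" "\<And>z. log_weight z \<le> K * (p z + 1)" using weight_log_weight_bound[OF p] by blast
  obtain C b1 where C: "C > 0" "\<And>z. b1 \<le> cmod z \<Longrightarrow> p z \<le> C * \<bar>laplacian p z\<bar>"
  proof -
    obtain C where "C > 0" "\<forall>\<^sub>F z in at_infinity. norm (p z) \<le> C * norm (laplacian p z)"
      using O by (rule landau_o.bigE)
    then show ?thesis using that p0 by (auto simp: eventually_at_infinity)
  qed
  obtain b2 where b2: "\<And>z. b2 \<le> cmod z \<Longrightarrow> 1 \<le> p z"
  proof -
    have "filterlim (\<lambda>z::complex. ln (1 + (cmod z)\<^sup>2)) at_top at_infinity"
      by (rule filterlim_compose[OF ln_at_top], rule filterlim_tendsto_add_at_top[OF tendsto_const],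
          rule filterlim_pow_at_top, simp, rule filterlim_norm_at_top)
    then have "\<forall>\<^sub>F z::complex in at_infinity. 2 * K \<le> ln (1 + (cmod z)\<^sup>2) \<and> 1 \<le> ln (1 + (cmod z)\<^sup>2)"
      by (simp add: filterlim_at_top eventually_conj_iff)
    then obtain b where b: "\<And>z::complex. b \<le> cmod z \<Longrightarrow> 2 * K \<le> log_weight z \<and> 1 \<le> log_weight z"
      by (auto simp: eventually_at_infinity log_weight_def)
    have "1 \<le> p z" if "b \<le> cmod z" for z
    proof -
      have "2 * K \<le> K * (p z + 1)" "1 \<le> K * (p z + 1)" using b[OF that] K(2)[of z] by linarith+
      then have "K > 0" using K(1) by (cases "K = 0") auto
      then show ?thesis using \<open>2 * K \<le> K * (p z + 1)\<close> by (simp add: mult.commute)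
    qed
    then show ?thesis using that by blast
  qed
  define R where "R = max (max b1 b2) (R0 + 1) + 1"
  have big: "1 / (8 * C) * (p x + 1) \<le> laplacian p x / 4" if x: "R - 1 \<le> cmod x" for x
  proof -
    have x': "x \<in> ?S" "b1 \<le> cmod x" "b2 \<le> cmod x" using x by (auto simp: R_def)
    have "p x + 1 \<le> 2 * p x" using b2[OF x'(3)] by simp
    also have "\<dots> \<le> 2 * (C * laplacian p x)" using C(2)[OF x'(2)] lap0[OF x'(1)] by simp
    finally show ?thesis using C(1) by (simp add: field_simps)
  qed
  have "1 / (8 * C) * P c \<le> \<Lambda> c" if c: "R \<le> cmod c" for c
  proof (rule Lambda_ge[where L="\<lambda>w. laplacian p (c - w) / 4"])
    fix w :: complex assume w: "cmod w < 1"
    have "cmod c - cmod w \<le> cmod (c - w)" by (rule norm_triangle_ineq2)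
    then have cw: "R - 1 \<le> cmod (c - w)" using c w by simp
    then have "c - w \<in> ?S" by (simp add: R_def)
    then show "(\<lambda>n. (circle_mean (\<lambda>z. p z + 1) (c - w) (1 / real (Suc n)) - (p (c - w) + 1)) / (1 / real (Suc n))\<^sup>2)
        \<longlonglongrightarrow> laplacian p (c - w) / 4" by (rule lim)
    show "1 / (8 * C) * (p (c - w) + 1) \<le> laplacian p (c - w) / 4" by (rule big[OF cw])
  qed (use C in auto)
  then have "1 / (8 * C) * (mass / \<kappa>) * (p c + 1) \<le> \<Lambda> c" if c: "R \<le> cmod c" for c
  proof -
    have "1 / (8 * C) * (mass / \<kappa> * (p c + 1)) \<le> 1 / (8 * C) * P c"
      using C(1) by (intro mult_left_mono P_ge) auto
    also have "\<dots> \<le> \<Lambda> c" by (rule \<open>\<And>c. R \<le> cmod c \<Longrightarrow> 1 / (8 * C) * P c \<le> \<Lambda> c\<close>[OF c])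
    finally show ?thesis by (simp add: mult.assoc)
  qed
  moreover have "1 / (8 * C) * (mass / \<kappa>) > 0" using C(1) mass_pos kappa_ge_1 by simp
  ultimately show ?thesis using local_peaks[OF _ _ K] by blast
qed

section \<open>Entire functions with prescribed zeros\<close>

lemma higher_deriv_zero_of_bound:
  assumes f: "f holomorphic_on UNIV" and r: "r > 0" and b: "\<And>z. cmod (z - a) < r \<Longrightarrow> cmod (f z) \<le> C * cmod (z - a) ^ m"
    and l: "l < m"
  shows "(deriv ^^ l) f a = 0"
proof -
  have C: "cmod ((deriv ^^ l) f a) \<le> fact l * \<bar>C\<bar> * s" if s: "0 < s" "s < r" "s \<le> 1" for s
  proof -
    have "cmod ((deriv ^^ l) f a) \<le> fact l * (\<bar>C\<bar> * s ^ m) / s ^ l"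
    proof (rule Cauchy_inequality)
      show "f holomorphic_on ball a s" "continuous_on (cball a s) f"
        using f holomorphic_on_subset holomorphic_on_imp_continuous_on continuous_on_subset by blast+
      fix x assume x: "cmod (a - x) = s"
      then have "cmod (x - a) = s" by (simp add: norm_minus_commute)
      then have "cmod (f x) \<le> C * s ^ m" using b[of x] s by simp
      also have "\<dots> \<le> \<bar>C\<bar> * s ^ m" using s by (intro mult_right_mono) auto
      finally show "cmod (f x) \<le> \<bar>C\<bar> * s ^ m" .
    qed (use s in auto)
    also have "s ^ m = s ^ l * s ^ (m - l)" using l by (simp flip: power_add)
    also have "fact l * (\<bar>C\<bar> * (s ^ l * s ^ (m - l))) / s ^ l = fact l * \<bar>C\<bar> * s ^ (m - l)"
      using s by simp
    also have "\<dots> \<le> fact l * \<bar>C\<bar> * s ^ 1"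
      using s l by (intro mult_left_mono power_decreasing) auto
    finally show ?thesis by simp
  qed
  have "cmod ((deriv ^^ l) f a) \<le> 0"
  proof (rule field_le_epsilon)
    fix e :: real assume e: "e > 0"
    define K where "K = fact l * \<bar>C\<bar> + 1"
    have K: "K > 0" by (simp add: K_def add_nonneg_pos)
    define s where "s = min (min (r / 2) 1) (e / K)"
    have s: "0 < s" "s < r" "s \<le> 1" "s \<le> e / K" using r e K by (auto simp: s_def)
    have "cmod ((deriv ^^ l) f a) \<le> fact l * \<bar>C\<bar> * s" by (rule C) (use s in auto)
    also have "\<dots> \<le> K * s" using s by (intro mult_right_mono) (auto simp: K_def)
    also have "\<dots> \<le> e" using s(4) K by (simp add: field_simps)
    finally show "cmod ((deriv ^^ l) f a) \<le> 0 + e" by simp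
  qed
  then show ?thesis by simp
qed

lemma higher_deriv_power_mult:
  assumes g: "g holomorphic_on UNIV"
  shows "(deriv ^^ m) (\<lambda>z. (z - a) ^ m * g z) a = fact m * g a"
proof -
  have "(deriv ^^ m) (\<lambda>z. (z - a) ^ m * g z) a
      = (\<Sum>i = 0..m. of_nat (m choose i) * (deriv ^^ i) (\<lambda>z. (z - a) ^ m) a * (deriv ^^ (m - i)) g a)"
    by (rule higher_deriv_mult[where S=UNIV]) (use g in \<open>auto intro!: holomorphic_intros\<close>)
  also have "\<dots> = (\<Sum>i\<in>{m}. of_nat (m choose i) * (deriv ^^ i) (\<lambda>z. (z - a) ^ m) a * (deriv ^^ (m - i)) g a)"
    by (rule sum.mono_neutral_right) (auto simp: higher_deriv_power)
  also have "\<dots> = fact m * g a"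
    by (simp add: higher_deriv_power pochhammer_fact[symmetric])
  finally show ?thesis .
qed

lemma entire_factor:
  assumes "f holomorphic_on UNIV" "\<And>l. l < m \<Longrightarrow> (deriv ^^ l) f a = 0"
  shows "\<exists>g. g holomorphic_on UNIV \<and> (\<forall>z. f z = (z - a) ^ m * g z)"
  using assms(2)
proof (induction m)
  case 0
  then show ?case using assms(1) by (intro exI[of _ f]) auto
next
  case (Suc m)
  then obtain g where g: "g holomorphic_on UNIV" "\<And>z. f z = (z - a) ^ m * g z" by auto
  have "f = (\<lambda>z. (z - a) ^ m * g z)" using g(2) by blast
  then have "fact m * g a = 0" using Suc.prems[of m] higher_deriv_power_mult[OF g(1), of m a] by simp
  then have ga: "g a = 0" by simp
  define h where "h z = (if z = a then deriv g a else (g z - g a) / (z - a))" for z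
  have "h holomorphic_on UNIV" unfolding h_def by (rule pole_lemma[OF g(1)]) simp
  moreover have "f z = (z - a) ^ Suc m * h z" for z
    using g(2)[of z] ga by (simp add: h_def)
  ultimately show ?case by blast
qed

lemma continuous_bounded_cball:
  fixes g :: "complex \<Rightarrow> complex"
  assumes "continuous_on (cball a r) g"
  obtains C where "\<And>z. z \<in> cball a r \<Longrightarrow> cmod (g z) \<le> C"
proof -
  have "bounded (g ` cball a r)"
    by (intro compact_imp_bounded compact_continuous_image assms compact_cball)
  then obtain C where C: "\<forall>x\<in>g ` cball a r. norm x \<le> C" unfolding bounded_iff by blast
  show ?thesis by (rule that[of C]) (use C in blast)
qed

lemma higher_deriv_zero_of_factor:
  assumes g: "g holomorphic_on UNIV" and f: "\<And>z. f z = (z - a) ^ m * g z" and l: "l < m"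
  shows "(deriv ^^ l) f a = 0"
proof -
  obtain C where C: "\<And>z. z \<in> cball a 1 \<Longrightarrow> cmod (g z) \<le> C"
    using continuous_bounded_cball[OF continuous_on_subset[OF holomorphic_on_imp_continuous_on[OF g] subset_UNIV], of a 1]
    by blast
  have fe: "f = (\<lambda>z. (z - a) ^ m * g z)" using f by blast
  show ?thesis
  proof (rule higher_deriv_zero_of_bound[where r=1 and C=C and m=m])
    show "f holomorphic_on UNIV" unfolding fe by (intro holomorphic_intros g)
    show "cmod (f z) \<le> C * cmod (z - a) ^ m" if "cmod (z - a) < 1" for z
    proof -
      have "cmod (f z) = cmod (g z) * cmod (z - a) ^ m" by (simp add: f norm_mult norm_power mult.commute)
      also have "\<dots> \<le> C * cmod (z - a) ^ m"
        using C[of z] that by (intro mult_right_mono) (auto simp: dist_norm norm_minus_commute)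
      finally show ?thesis .
    qed
  qed (use l in auto)
qed

text \<open>
  When the zeros at the other points have been split off, the product \<open>Pr\<close> of
  their factors does not vanish at \<open>\<zeta> x\<close>. So the quotient is still
  \<open>O(\<bar>z - \<zeta> x\<bar> ^ \<mu> x)\<close> there, and
  \<open>\<zeta> x\<close> can be split off as well.
\<close>

lemma entire_factor_finite:
  assumes "finite J" "inj_on \<zeta> J" "f holomorphic_on UNIV"
    and "\<And>j l. j \<in> J \<Longrightarrow> l < \<mu> j \<Longrightarrow> (deriv ^^ l) f (\<zeta> j) = 0"
  shows "\<exists>g. g holomorphic_on UNIV \<and> (\<forall>z. f z = (\<Prod>j\<in>J. (z - \<zeta> j) ^ \<mu> j) * g z)"
  using assms
proof (induction J rule: finite_induct)
  case empty
  then show ?case by (intro exI[of _ f]) auto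
next
  case (insert x F)
  then obtain g where g: "g holomorphic_on UNIV" "\<And>z. f z = (\<Prod>j\<in>F. (z - \<zeta> j) ^ \<mu> j) * g z"
    by auto
  define Pr where "Pr z = (\<Prod>j\<in>F. (z - \<zeta> j) ^ \<mu> j)" for z
  have "\<exists>h. h holomorphic_on UNIV \<and> (\<forall>z. f z = (z - \<zeta> x) ^ \<mu> x * h z)"
    by (rule entire_factor) (use insert in auto)
  then obtain h where h: "h holomorphic_on UNIV" "\<And>z. f z = (z - \<zeta> x) ^ \<mu> x * h z" by blast
  have "\<zeta> j \<noteq> \<zeta> x" if "j \<in> F" for j using insert.hyps insert.prems(1) that by (auto simp: inj_on_def)
  then have P0: "Pr (\<zeta> x) \<noteq> 0" using insert.hyps by (force simp: Pr_def)
  have "isCont Pr (\<zeta> x)" unfolding Pr_def by (intro continuous_intros)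
  moreover have "isCont h (\<zeta> x)"
    using h(1) holomorphic_on_imp_continuous_on continuous_on_eq_continuous_at by blast
  ultimately have "isCont (\<lambda>z. h z / Pr z) (\<zeta> x)" using P0 by (intro continuous_intros)
  then have "\<forall>\<^sub>F z in at (\<zeta> x). dist (h z / Pr z) (h (\<zeta> x) / Pr (\<zeta> x)) < 1"
    unfolding isCont_def by (rule tendstoD) simp
  moreover have "\<forall>\<^sub>F z in at (\<zeta> x). Pr z \<noteq> 0"
    using \<open>isCont Pr (\<zeta> x)\<close> P0 unfolding isCont_def by (rule tendsto_imp_eventually_ne)
  ultimately have "\<forall>\<^sub>F z in at (\<zeta> x). dist (h z / Pr z) (h (\<zeta> x) / Pr (\<zeta> x)) < 1 \<and> Pr z \<noteq> 0"
    by (rule eventually_conj)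
  then obtain r where r: "r > 0" "\<And>z. z \<noteq> \<zeta> x \<Longrightarrow> dist z (\<zeta> x) < r \<Longrightarrow>
      dist (h z / Pr z) (h (\<zeta> x) / Pr (\<zeta> x)) < 1 \<and> Pr z \<noteq> 0"
    unfolding eventually_at by auto
  define C where "C = cmod (h (\<zeta> x) / Pr (\<zeta> x)) + 1"
  have bd: "cmod (h z / Pr z) \<le> C \<and> Pr z \<noteq> 0" if "cmod (z - \<zeta> x) < r" for z
  proof (cases "z = \<zeta> x")
    case True then show ?thesis using P0 by (simp add: C_def)
  next
    case False
    then have "dist (h z / Pr z) (h (\<zeta> x) / Pr (\<zeta> x)) < 1 \<and> Pr z \<noteq> 0"
      using r(2) that by (simp add: dist_norm)
    then show ?thesis using norm_triangle_sub[of "h z / Pr z" "h (\<zeta> x) / Pr (\<zeta> x)"]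
      unfolding C_def dist_norm by linarith
  qed
  have "\<exists>k. k holomorphic_on UNIV \<and> (\<forall>z. g z = (z - \<zeta> x) ^ \<mu> x * k z)"
  proof (rule entire_factor[OF g(1)], rule higher_deriv_zero_of_bound[OF g(1) r(1)])
    fix z assume z: "cmod (z - \<zeta> x) < r"
    have "Pr z \<noteq> 0" using bd[OF z] by blast
    then have "g z = (z - \<zeta> x) ^ \<mu> x * (h z / Pr z)"
      using g(2)[of z] h(2)[of z] by (simp add: Pr_def[symmetric] field_simps)
    then have "cmod (g z) = cmod (h z / Pr z) * cmod (z - \<zeta> x) ^ \<mu> x"
      by (simp add: norm_mult norm_power norm_divide)
    also have "\<dots> \<le> C * cmod (z - \<zeta> x) ^ \<mu> x" using bd[OF z] by (intro mult_right_mono) auto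
    finally show "cmod (g z) \<le> C * cmod (z - \<zeta> x) ^ \<mu> x" .
  qed
  then obtain k where k: "k holomorphic_on UNIV" "\<And>z. g z = (z - \<zeta> x) ^ \<mu> x * k z" by blast
  have "f z = (\<Prod>j\<in>insert x F. (z - \<zeta> j) ^ \<mu> j) * k z" for z
    using g(2)[of z] k(2)[of z] insert.hyps by (simp add: mult.assoc mult.left_commute)
  then show ?case using k(1) by blast
qed

lemma continuous_eq_off_finite:
  assumes "continuous_on UNIV u" "continuous_on UNIV (v :: complex \<Rightarrow> complex)" "finite F" "\<And>z. z \<notin> F \<Longrightarrow> u z = v z"
  shows "u z = v z"
proof (rule tendsto_unique[OF trivial_limit_at])
  show "(u \<longlongrightarrow> u z) (at z)"
    using assms(1) by (simp add: continuous_on_eq_continuous_at isCont_def)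
  have "\<forall>\<^sub>F w in at z. w \<notin> F - {z}"
    using assms(3) by (metis eventually_at_topological finite_Diff finite_imp_closed open_Compl Compl_iff DiffD2 singletonI)
  then have "\<forall>\<^sub>F w in at z. v w = u w"
    by (rule eventually_mp[rotated]) (auto simp: eventually_at_filter assms(4))
  moreover have "(v \<longlongrightarrow> v z) (at z)"
    using assms(2) by (simp add: continuous_on_eq_continuous_at isCont_def)
  ultimately show "(u \<longlongrightarrow> v z) (at z)" by (rule Lim_transform_eventually[rotated])
qed

text \<open>
  A Weierstrass product over a sequence in which every point other than 0 is repeated
  according to its multiplicity, times a power of \<open>z\<close> for the point 0.
\<close>

lemma entire_function_with_divisor:
  assumes V: "multiplicity_variety \<zeta> m"
  shows "\<exists>G. G holomorphic_on UNIV \<and> (\<forall>z. G z = 0 \<longleftrightarrow> z \<in> range \<zeta>) \<and>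
    (\<forall>j. \<exists>g. g holomorphic_on UNIV \<and> g (\<zeta> j) \<noteq> 0 \<and> (\<forall>z. G z = (z - \<zeta> j) ^ m j * g z))"
proof -
  have inj: "inj \<zeta>" and mpos: "\<And>j. 0 < m j" using V by (auto simp: multiplicity_variety_def)
  have fin: "finite {j. cmod (\<zeta> j) \<le> R}" for R
    using finite_close_points[OF V, of 0 R] by simp
  \<comment> \<open>The pairs in \<open>S\<close> number the factors; \<open>e\<close>
    enumerates them.\<close>
  define S where "S = (SIGMA j:{j. \<zeta> j \<noteq> 0}. {..<m j})"
  have "finite {j. \<zeta> j = 0}" by (rule finite_subset[OF _ fin[of 0]]) auto
  then have "infinite {j. \<zeta> j \<noteq> 0}" by (metis finite_Collect_not infinite_UNIV_nat)
  moreover have "{j. \<zeta> j \<noteq> 0} = fst ` S" using mpos by (force simp: S_def)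
  ultimately have infS: "infinite S" by (metis finite_imageI)
  define e where "e = from_nat_into S"
  have e: "bij_betw e UNIV S" unfolding e_def by (rule bij_betw_from_nat_into[OF _ infS]) simp
  define a where "a n = \<zeta> (fst (e n))" for n
  have eS: "e n \<in> S" for n using e by (auto simp: bij_betw_def)
  have pre: "finite {n. fst (e n) \<in> J}" if "finite J" for J
  proof -
    have "finite (S \<inter> (SIGMA j:J. {..<m j}))" using that by auto
    moreover have "e ` {n. fst (e n) \<in> J} \<subseteq> S \<inter> (SIGMA j:J. {..<m j})"
    proof
      fix x assume "x \<in> e ` {n. fst (e n) \<in> J}"
      then obtain n where "x = e n" "fst (e n) \<in> J" by auto
      with eS[of n] show "x \<in> S \<inter> (SIGMA j:J. {..<m j})" by (auto simp: S_def)
    qed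
    ultimately show ?thesis using e by (meson bij_betw_def finite_imageD finite_subset inj_on_subset subset_UNIV)
  qed
  have cardz: "card (a -` {\<zeta> j}) = (if \<zeta> j = 0 then 0 else m j)" for j
  proof -
    have "bij_betw e (a -` {\<zeta> j}) (e ` (a -` {\<zeta> j}))"
      using e by (meson bij_betw_def bij_betw_subset subset_UNIV)
    then have "card (a -` {\<zeta> j}) = card (e ` (a -` {\<zeta> j}))" by (rule bij_betw_same_card)
    also have "e ` (a -` {\<zeta> j}) = {x \<in> S. fst x = j}"
    proof
      show "e ` (a -` {\<zeta> j}) \<subseteq> {x \<in> S. fst x = j}" using eS inj by (auto simp: a_def inj_def)
      show "{x \<in> S. fst x = j} \<subseteq> e ` (a -` {\<zeta> j})"
      proof
        fix x assume x: "x \<in> {x \<in> S. fst x = j}"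
        then obtain n where "x = e n" using e by (auto simp: bij_betw_def)
        then show "x \<in> e ` (a -` {\<zeta> j})" using x by (auto simp: a_def)
      qed
    qed
    also have "{x \<in> S. fst x = j} = (if \<zeta> j = 0 then {} else {j} \<times> {..<m j})" by (auto simp: S_def)
    finally show ?thesis by simp
  qed
  interpret weierstrass_product' a
  proof
    show "a n \<noteq> 0" for n using eS[of n] by (auto simp: a_def S_def)
    show "filterlim a at_infinity at_top"
      unfolding filterlim_at_infinity[OF order_refl]
    proof (intro allI impI)
      fix R :: real
      have "{n. \<not> R \<le> norm (a n)} \<subseteq> {n. fst (e n) \<in> {j. cmod (\<zeta> j) \<le> R}}" by (auto simp: a_def)
      then have "finite {n. \<not> R \<le> norm (a n)}" using pre[OF fin] finite_subset by blast
      then show "\<forall>\<^sub>F n in sequentially. R \<le> norm (a n)"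
        by (simp add: eventually_cofinite flip: cofinite_eq_sequentially)
    qed
    show "finite (a -` {z})" if z: "z \<in> range a" for z
    proof -
      obtain n where "z = \<zeta> (fst (e n))" using z unfolding a_def by blast
      moreover have "card (a -` {\<zeta> (fst (e n))}) \<noteq> 0"
        using cardz[of "fst (e n)"] eS[of n] mpos by (auto simp: S_def)
      ultimately show ?thesis using card.infinite by metis
    qed
  qed
  define m0 where "m0 = (\<Sum>j | \<zeta> j = 0. m j)"
  define G where "G z = z ^ m0 * f z" for z
  have G: "G holomorphic_on UNIV" unfolding G_def by (intro holomorphic_intros holomorphic)
  have m0: "m0 = m j" if "\<zeta> j = 0" for j
  proof -
    have "{j. \<zeta> j = 0} = {j}" using that inj by (auto simp: inj_def)
    then show ?thesis by (simp add: m0_def)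
  qed
  have ra: "z \<in> range a \<longleftrightarrow> z \<in> range \<zeta> \<and> z \<noteq> 0" for z
  proof
    assume "z \<in> range a"
    then obtain n where "z = \<zeta> (fst (e n))" unfolding a_def by blast
    then show "z \<in> range \<zeta> \<and> z \<noteq> 0" using eS[of n] by (auto simp: S_def)
  next
    assume "z \<in> range \<zeta> \<and> z \<noteq> 0"
    then obtain j where "z = \<zeta> j" "\<zeta> j \<noteq> 0" by auto
    then have "card (a -` {z}) \<noteq> 0" using cardz[of j] mpos[of j] by simp
    then have "a -` {z} \<noteq> {}" by force
    then show "z \<in> range a" by blast
  qed
  have f0: "f z = 0 \<longleftrightarrow> z \<in> range a" for z by (rule zero)
  have "G z = 0 \<longleftrightarrow> z \<in> range \<zeta>" for z
  proof (cases "z = 0")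
    case True
    have "m0 = 0 \<longleftrightarrow> {j. \<zeta> j = 0} = {}"
      using \<open>finite {j. \<zeta> j = 0}\<close> by (auto simp: m0_def mpos[THEN less_imp_neq, symmetric])
    moreover have "f 0 \<noteq> 0" using f0[of 0] ra[of 0] by blast
    ultimately show ?thesis using True by (auto simp: G_def power_0_left)
  next
    case False then show ?thesis using f0[of z] ra[of z] by (simp add: G_def)
  qed
  moreover have "\<exists>g. g holomorphic_on UNIV \<and> g (\<zeta> j) \<noteq> 0 \<and> (\<forall>z. G z = (z - \<zeta> j) ^ m j * g z)" for j
  proof (cases "\<zeta> j = 0")
    case True
    then show ?thesis using m0[OF True] f0[of 0] ra[of 0] holomorphic[of UNIV]
      by (intro exI[of _ f]) (auto simp: G_def)
  next
    case False
    have fh: "f holomorphic_on UNIV" by (rule holomorphic)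
    have zo: "zorder f (\<zeta> j) = int (m j)" using zorder[of "\<zeta> j"] cardz[of j] False by simp
    have nz: "\<exists>w\<in>UNIV. f w \<noteq> 0" using f0[of 0] ra[of 0] by blast
    obtain r where r: "r > 0" and gg0: "zor_poly f (\<zeta> j) holomorphic_on cball (\<zeta> j) r"
       "\<forall>w\<in>cball (\<zeta> j) r. f w = zor_poly f (\<zeta> j) w * (w - \<zeta> j) ^ nat (zorder f (\<zeta> j)) \<and> zor_poly f (\<zeta> j) w \<noteq> 0"
      using conjunct2[OF zorder_exist_zero[OF fh open_UNIV connected_UNIV UNIV_I nz]] by blast
    have gg: "zor_poly f (\<zeta> j) holomorphic_on cball (\<zeta> j) r" "zor_poly f (\<zeta> j) (\<zeta> j) \<noteq> 0"
       "\<And>w. w \<in> cball (\<zeta> j) r \<Longrightarrow> f w = zor_poly f (\<zeta> j) w * (w - \<zeta> j) ^ nat (zorder f (\<zeta> j)) \<and> zor_poly f (\<zeta> j) w \<noteq> 0"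
      using gg0 r by auto
    let ?g = "zor_poly f (\<zeta> j)"
    obtain C where C: "\<And>z. z \<in> cball (\<zeta> j) r \<Longrightarrow> cmod (?g z) \<le> C"
      using continuous_bounded_cball[OF holomorphic_on_imp_continuous_on[OF gg(1)]] by blast
    have "\<exists>g. g holomorphic_on UNIV \<and> (\<forall>z. f z = (z - \<zeta> j) ^ m j * g z)"
    proof (rule entire_factor[OF fh], rule higher_deriv_zero_of_bound[OF fh r])
      fix z assume "cmod (z - \<zeta> j) < r"
      then have z: "z \<in> cball (\<zeta> j) r" by (simp add: dist_norm norm_minus_commute)
      have "cmod (f z) = cmod (?g z) * cmod (z - \<zeta> j) ^ m j"
        using gg(3)[OF z] zo by (simp add: norm_mult norm_power)
      also have "\<dots> \<le> C * cmod (z - \<zeta> j) ^ m j" using C[OF z] by (intro mult_right_mono) auto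
      finally show "cmod (f z) \<le> C * cmod (z - \<zeta> j) ^ m j" .
    qed
    then obtain g where g: "g holomorphic_on UNIV" "\<And>z. f z = (z - \<zeta> j) ^ m j * g z" by blast
    have lim1: "(g \<longlongrightarrow> g (\<zeta> j)) (at (\<zeta> j))"
      using g(1) holomorphic_on_imp_continuous_on continuous_on_eq_continuous_at isCont_def by blast
    have "isCont ?g (\<zeta> j)"
      using holomorphic_on_imp_continuous_on[OF gg(1)] r
      by (metis centre_in_ball continuous_on_interior interior_cball)
    then have lim2: "(?g \<longlongrightarrow> ?g (\<zeta> j)) (at (\<zeta> j))" by (simp add: isCont_def)
    have "\<forall>\<^sub>F z in at (\<zeta> j). ?g z = g z"
      unfolding eventually_at
    proof (intro exI[of _ r] conjI ballI impI)
      fix z assume z: "z \<noteq> \<zeta> j \<and> dist z (\<zeta> j) < r"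
      then have "f z = ?g z * (z - \<zeta> j) ^ m j" using gg(3)[of z] zo by (simp add: dist_commute)
      then show "?g z = g z" using g(2)[of z] z by simp
    qed (rule r)
    from tendsto_unique[OF trivial_limit_at Lim_transform_eventually[OF lim2 this] lim1]
    have gne: "g (\<zeta> j) \<noteq> 0" using gg(2) by simp
    show ?thesis
    proof (intro exI[of _ "\<lambda>z. z ^ m0 * g z"] conjI allI)
      show "(\<lambda>z. z ^ m0 * g z) holomorphic_on UNIV" by (intro holomorphic_intros g)
      show "\<zeta> j ^ m0 * g (\<zeta> j) \<noteq> 0" using False gne by simp
      show "G z = (z - \<zeta> j) ^ m j * (z ^ m0 * g z)" for z using g(2)[of z] by (simp add: G_def)
    qed
  qed
  ultimately show ?thesis using G by blast
qed

lemma higher_deriv_polynomial: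
  fixes w :: "nat \<Rightarrow> complex"
  assumes l: "l < n"
  shows "(deriv ^^ l) (\<lambda>z. \<Sum>i<n. w i * (z - a) ^ i) a = fact l * w l"
proof -
  have hs: "(deriv ^^ l) (\<lambda>z. \<Sum>i\<in>I. w i * (z - a) ^ i) a = (\<Sum>i\<in>I. (deriv ^^ l) (\<lambda>z. w i * (z - a) ^ i) a)" if "finite I" for I
    using that
  proof (induction I rule: finite_induct)
    case (insert x F)
    have "(deriv ^^ l) (\<lambda>z. w x * (z - a) ^ x + (\<Sum>i\<in>F. w i * (z - a) ^ i)) a
       = (deriv ^^ l) (\<lambda>z. w x * (z - a) ^ x) a + (deriv ^^ l) (\<lambda>z. \<Sum>i\<in>F. w i * (z - a) ^ i) a"
      by (rule higher_deriv_add[where S=UNIV]) (auto intro!: holomorphic_intros)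
    then show ?case using insert by simp
  qed simp
  have trm: "(deriv ^^ l) (\<lambda>z. w i * (z - a) ^ i) a = (if i = l then fact l * w l else 0)" for i
  proof -
    have "(deriv ^^ l) (\<lambda>z. w i * (z - a) ^ i) a = w i * (deriv ^^ l) (\<lambda>z. (z - a) ^ i) a"
      by (rule higher_deriv_cmult[where A=UNIV]) (auto intro!: holomorphic_intros)
    then show ?thesis by (auto simp: higher_deriv_power pochhammer_fact[symmetric] power_0_left pochhammer_0_left not_less)
  qed
  show ?thesis unfolding hs[OF finite_lessThan] trm using l by simp
qed

definition zero_poly :: "(nat \<Rightarrow> complex) \<Rightarrow> (nat \<Rightarrow> nat) \<Rightarrow> nat set \<Rightarrow> complex \<Rightarrow> complex" where
  "zero_poly \<zeta> m J z = (\<Prod>k\<in>J. (z - \<zeta> k) ^ m k)"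

lemma zero_poly_entire: "zero_poly \<zeta> m J holomorphic_on S"
  unfolding zero_poly_def by (intro holomorphic_intros)

text \<open>
  \<open>Q J\<close> is what remains of \<open>G\<close> after removal of the zeros
  numbered by \<open>J\<close>. There is no bound on the size of \<open>G\<close>, but
  cofactors of nested sets differ by a polynomial factor, and all estimates will involve
  only quotients of cofactors.
\<close>

lemma divisor_cofactors:
  assumes V: "multiplicity_variety \<zeta> m"
  obtains G Q where "G holomorphic_on UNIV" "\<And>z. G z = 0 \<longleftrightarrow> z \<in> range \<zeta>"
    "\<And>J. finite J \<Longrightarrow> Q J holomorphic_on UNIV"
    "\<And>J z. finite J \<Longrightarrow> G z = zero_poly \<zeta> m J z * Q J z"
    "\<And>J z. finite J \<Longrightarrow> (\<And>k. \<zeta> k = z \<Longrightarrow> k \<in> J) \<Longrightarrow> Q J z \<noteq> 0"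
    "\<And>J J' z. finite J' \<Longrightarrow> J \<subseteq> J' \<Longrightarrow> Q J z = zero_poly \<zeta> m (J' - J) z * Q J' z"
proof -
  have inj: "inj \<zeta>" using V by (simp add: multiplicity_variety_def)
  obtain G where G: "G holomorphic_on UNIV" "\<And>z. G z = 0 \<longleftrightarrow> z \<in> range \<zeta>"
    and Gg: "\<And>j. \<exists>g. g holomorphic_on UNIV \<and> g (\<zeta> j) \<noteq> 0 \<and> (\<forall>z. G z = (z - \<zeta> j) ^ m j * g z)"
    using entire_function_with_divisor[OF V] by blast
  have "\<exists>Q. Q holomorphic_on UNIV \<and> (\<forall>z. G z = zero_poly \<zeta> m J z * Q z)" if "finite J" for J
    unfolding zero_poly_def
  proof (rule entire_factor_finite[OF that inj_on_subset[OF inj subset_UNIV] G(1)])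
    fix j l assume l: "l < m j"
    obtain g where "g holomorphic_on UNIV" "\<And>z. G z = (z - \<zeta> j) ^ m j * g z" using Gg by blast
    then show "(deriv ^^ l) G (\<zeta> j) = 0" using l by (rule higher_deriv_zero_of_factor)
  qed
  then have "\<forall>J. \<exists>Q. finite J \<longrightarrow> Q holomorphic_on UNIV \<and> (\<forall>z. G z = zero_poly \<zeta> m J z * Q z)" by blast
  then obtain Q where Q: "\<And>J. finite J \<Longrightarrow> Q J holomorphic_on UNIV"
    "\<And>J z. finite J \<Longrightarrow> G z = zero_poly \<zeta> m J z * Q J z" by metis
  have cont: "continuous_on UNIV f" if "f holomorphic_on UNIV" for f :: "complex \<Rightarrow> complex"
    using that by (rule holomorphic_on_imp_continuous_on)
  have ne: "Q J z \<noteq> 0" if J: "finite J" and z: "\<And>k. \<zeta> k = z \<Longrightarrow> k \<in> J" for J z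
  proof (cases "z \<in> range \<zeta>")
    case False
    then show ?thesis using G(2)[of z] Q(2)[OF J, of z] by auto
  next
    case True
    then obtain k where k: "z = \<zeta> k" by blast
    have kJ: "k \<in> J" using z k by blast
    obtain g where g: "g holomorphic_on UNIV" "g (\<zeta> k) \<noteq> 0" "\<And>z. G z = (z - \<zeta> k) ^ m k * g z" using Gg by blast
    have "g (\<zeta> k) = zero_poly \<zeta> m (J - {k}) (\<zeta> k) * Q J (\<zeta> k)"
    proof (rule continuous_eq_off_finite[where F="{\<zeta> k}" and u=g and v="\<lambda>z. zero_poly \<zeta> m (J - {k}) z * Q J z"])
      show "continuous_on UNIV g" by (rule cont[OF g(1)])
      show "continuous_on UNIV (\<lambda>z. zero_poly \<zeta> m (J - {k}) z * Q J z)"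
        by (intro cont holomorphic_intros zero_poly_entire Q(1)[OF J])
      fix w assume w: "w \<notin> {\<zeta> k}"
      have "zero_poly \<zeta> m J w = (w - \<zeta> k) ^ m k * zero_poly \<zeta> m (J - {k}) w"
        unfolding zero_poly_def by (rule prod.remove[OF J kJ])
      then have "(w - \<zeta> k) ^ m k * g w = (w - \<zeta> k) ^ m k * (zero_poly \<zeta> m (J - {k}) w * Q J w)"
        using g(3)[of w] Q(2)[OF J, of w] by (metis mult.assoc)
      then show "g w = zero_poly \<zeta> m (J - {k}) w * Q J w" using w by simp
    qed simp
    then show ?thesis using g(2) k by auto
  qed
  have rel: "Q J z = zero_poly \<zeta> m (J' - J) z * Q J' z" if J': "finite J'" "J \<subseteq> J'" for J J' z
  proof (rule continuous_eq_off_finite[where F="\<zeta> ` J" and u="Q J" and v="\<lambda>z. zero_poly \<zeta> m (J' - J) z * Q J' z"])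
    have J: "finite J" using J' finite_subset by blast
    show "finite (\<zeta> ` J)" using J by simp
    show "continuous_on UNIV (Q J)" by (rule cont[OF Q(1)[OF J]])
    show "continuous_on UNIV (\<lambda>z. zero_poly \<zeta> m (J' - J) z * Q J' z)"
      by (intro cont holomorphic_intros zero_poly_entire Q(1)[OF J'(1)])
    fix w assume w: "w \<notin> \<zeta> ` J"
    have "zero_poly \<zeta> m J' w = zero_poly \<zeta> m (J' - J) w * zero_poly \<zeta> m J w"
      unfolding zero_poly_def by (rule prod.subset_diff[OF J'(2,1)])
    then have "zero_poly \<zeta> m J w * Q J w = zero_poly \<zeta> m J w * (zero_poly \<zeta> m (J' - J) w * Q J' w)"
      using Q(2)[OF J, of w] Q(2)[OF J'(1), of w] by (metis mult.assoc mult.commute)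
    moreover have "zero_poly \<zeta> m J w \<noteq> 0" using w J by (auto simp: zero_poly_def)
    ultimately show "Q J w = zero_poly \<zeta> m (J' - J) w * Q J' w" by (metis mult_left_cancel)
  qed
  show ?thesis by (rule that[OF G Q ne rel])
qed

section \<open>Necessity of the counting condition\<close>

lemma N_count_at_point:
  assumes V: "multiplicity_variety \<zeta> m"
  shows "N_count \<zeta> m (\<zeta> j) (exp 1) = real (m j) +
    (\<Sum>k\<in>{k. cmod (\<zeta> j - \<zeta> k) \<le> exp 1} - {j}. real (m k) * (1 - ln (cmod (\<zeta> j - \<zeta> k))))"
proof -
  have inj: "inj \<zeta>" using V by (simp add: multiplicity_variety_def)
  have z: "cmod (\<zeta> j - \<zeta> k) \<le> 0 \<longleftrightarrow> k = j" for k using inj by (auto simp: inj_def)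
  have "{k. cmod (\<zeta> j - \<zeta> k) \<le> 0} = {j}" using z by auto
  then have n0: "n_count \<zeta> m (\<zeta> j) 0 = m j" by (simp add: n_count_def)
  have "{k. 0 < cmod (\<zeta> j - \<zeta> k) \<and> cmod (\<zeta> j - \<zeta> k) \<le> exp 1} = {k. cmod (\<zeta> j - \<zeta> k) \<le> exp 1} - {j}"
    using inj by (auto simp: inj_def)
  moreover have "ln (exp 1 / cmod (\<zeta> j - \<zeta> k)) = 1 - ln (cmod (\<zeta> j - \<zeta> k))" if "k \<noteq> j" for k
  proof -
    have "cmod (\<zeta> j - \<zeta> k) > 0" using that inj by (auto simp: inj_def)
    then show ?thesis by (simp add: ln_div)
  qed
  ultimately show ?thesis by (simp add: N_count_eq_sum[OF V] n0)
qed

text \<open>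
  Let \<open>g\<close> be the quotient of \<open>f\<close> by its prescribed zeros in the
  disc of radius \<open>e\<close> about \<open>\<zeta> j\<close>. At
  \<open>\<zeta> j\<close> its modulus is the inverse of the product of the
  \<open>cmod (\<zeta> j - \<zeta> k) ^ m k\<close> over the other points, as the
  leading coefficient of \<open>f\<close> there is 1. On the circle of radius
  \<open>2 e\<close> each of the removed factors has modulus at least \<open>e\<close>, and
  one of them is missing at \<open>\<zeta> j\<close>. So the maximum principle for
  \<open>g\<close> is the asserted inequality.
\<close>

lemma Jensen_counting_bound:
  assumes V: "multiplicity_variety \<zeta> m" and f: "f holomorphic_on UNIV"
    and M: "\<And>z. cmod (z - \<zeta> j) = 2 * exp 1 \<Longrightarrow> cmod (f z) \<le> M" and M0: "M > 0"
    and zero: "\<And>k l. cmod (\<zeta> j - \<zeta> k) \<le> exp 1 \<Longrightarrow> k \<noteq> j \<Longrightarrow> l < m k \<Longrightarrow> (deriv ^^ l) f (\<zeta> k) = 0"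
    and zj: "\<And>l. l < m j - 1 \<Longrightarrow> (deriv ^^ l) f (\<zeta> j) = 0"
    and one: "(deriv ^^ (m j - 1)) f (\<zeta> j) / fact (m j - 1) = 1"
  shows "N_count \<zeta> m (\<zeta> j) (exp 1) \<le> 1 + ln M"
proof -
  have inj: "inj \<zeta>" and mpos: "m j > 0" using V by (auto simp: multiplicity_variety_def)
  define J where "J = {k. cmod (\<zeta> j - \<zeta> k) \<le> exp 1}"
  have finJ: "finite J" unfolding J_def by (rule finite_close_points[OF V])
  have jJ: "j \<in> J" by (simp add: J_def)
  define \<mu> where "\<mu> k = (if k = j then m j - 1 else m k)" for k
  have "\<exists>g. g holomorphic_on UNIV \<and> (\<forall>z. f z = (\<Prod>k\<in>J. (z - \<zeta> k) ^ \<mu> k) * g z)"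
    by (rule entire_factor_finite[OF finJ inj_on_subset[OF inj subset_UNIV] f])
      (use zero zj in \<open>auto simp: \<mu>_def J_def split: if_splits\<close>)
  then obtain g where g: "g holomorphic_on UNIV" "\<And>z. f z = (\<Prod>k\<in>J. (z - \<zeta> k) ^ \<mu> k) * g z" by blast
  define S where "S = (\<Sum>k\<in>J. real (\<mu> k))"
  have gb: "cmod (g (\<zeta> j)) \<le> M / exp S"
  proof (rule maximum_modulus_frontier[where S="ball (\<zeta> j) (2 * exp 1)" and f=g and \<xi>="\<zeta> j"])
    show "g holomorphic_on interior (ball (\<zeta> j) (2 * exp 1))" using g(1) holomorphic_on_subset by blast
    show "continuous_on (closure (ball (\<zeta> j) (2 * exp 1))) g"
      using g(1) holomorphic_on_imp_continuous_on continuous_on_subset by blast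
    fix z assume "z \<in> frontier (ball (\<zeta> j) (2 * exp 1))"
    then have z: "cmod (z - \<zeta> j) = 2 * exp 1"
      by (simp add: frontier_ball dist_norm norm_minus_commute)
    have far: "exp 1 \<le> cmod (z - \<zeta> k)" if "k \<in> J" for k
    proof -
      have "cmod (z - \<zeta> j) \<le> cmod (z - \<zeta> k) + cmod (\<zeta> j - \<zeta> k)"
        using norm_triangle_ineq4[of "z - \<zeta> k" "\<zeta> j - \<zeta> k"] by simp
      then show ?thesis using z that by (simp add: J_def)
    qed
    have "exp S = (\<Prod>k\<in>J. exp 1 ^ \<mu> k)"
      using finJ by (simp add: S_def exp_sum flip: exp_of_nat_mult)
    also have "\<dots> \<le> (\<Prod>k\<in>J. cmod (z - \<zeta> k) ^ \<mu> k)"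
      using far by (intro prod_mono) (auto intro: power_mono)
    also have "\<dots> = cmod (\<Prod>k\<in>J. (z - \<zeta> k) ^ \<mu> k)" by (simp add: prod_norm[symmetric] norm_power)
    finally have "exp S * cmod (g z) \<le> cmod (\<Prod>k\<in>J. (z - \<zeta> k) ^ \<mu> k) * cmod (g z)"
      by (rule mult_right_mono) simp
    also have "\<dots> = cmod (f z)" by (simp add: g(2) norm_mult)
    also have "\<dots> \<le> M" by (rule M[OF z])
    finally show "cmod (g z) \<le> M / exp S" by (simp add: pos_le_divide_eq mult.commute)
  qed auto
  define Pr where "Pr z = (\<Prod>k\<in>J - {j}. (z - \<zeta> k) ^ m k)" for z
  have fz: "f = (\<lambda>z. (z - \<zeta> j) ^ (m j - 1) * (Pr z * g z))"
  proof
    fix z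
    have "(\<Prod>k\<in>J. (z - \<zeta> k) ^ \<mu> k) = (z - \<zeta> j) ^ \<mu> j * (\<Prod>k\<in>J - {j}. (z - \<zeta> k) ^ \<mu> k)"
      by (rule prod.remove[OF finJ jJ])
    also have "(\<Prod>k\<in>J - {j}. (z - \<zeta> k) ^ \<mu> k) = Pr z" unfolding Pr_def by (rule prod.cong) (auto simp: \<mu>_def)
    finally show "f z = (z - \<zeta> j) ^ (m j - 1) * (Pr z * g z)" by (simp add: g(2) \<mu>_def)
  qed
  have "(\<lambda>z. Pr z * g z) holomorphic_on UNIV" unfolding Pr_def by (intro holomorphic_intros g)
  from higher_deriv_power_mult[OF this, of "m j - 1" "\<zeta> j"]
  have "Pr (\<zeta> j) * g (\<zeta> j) = 1" using one unfolding fz[symmetric] by simp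
  then have "1 = cmod (Pr (\<zeta> j)) * cmod (g (\<zeta> j))" by (metis norm_mult norm_one)
  also have "\<dots> \<le> cmod (Pr (\<zeta> j)) * (M / exp S)" by (intro mult_left_mono gb) auto
  also have "cmod (Pr (\<zeta> j)) = exp (\<Sum>k\<in>J - {j}. real (m k) * ln (cmod (\<zeta> j - \<zeta> k)))"
  proof -
    have "cmod (Pr (\<zeta> j)) = (\<Prod>k\<in>J - {j}. cmod (\<zeta> j - \<zeta> k) ^ m k)"
      by (simp add: Pr_def prod_norm[symmetric] norm_power)
    also have "\<dots> = (\<Prod>k\<in>J - {j}. exp (real (m k) * ln (cmod (\<zeta> j - \<zeta> k))))"
    proof (rule prod.cong[OF refl])
      fix k assume "k \<in> J - {j}"
      then have "cmod (\<zeta> j - \<zeta> k) > 0" using inj by (auto simp: inj_def)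
      then show "cmod (\<zeta> j - \<zeta> k) ^ m k = exp (real (m k) * ln (cmod (\<zeta> j - \<zeta> k)))"
        by (simp add: exp_of_nat_mult)
    qed
    finally show ?thesis using finJ by (simp add: exp_sum)
  qed
  finally have "1 \<le> exp (\<Sum>k\<in>J - {j}. real (m k) * ln (cmod (\<zeta> j - \<zeta> k))) * (exp (ln M) / exp S)"
    using M0 by simp
  then have "exp 0 \<le> exp ((\<Sum>k\<in>J - {j}. real (m k) * ln (cmod (\<zeta> j - \<zeta> k))) + ln M - S)"
    by (simp add: exp_add exp_diff)
  then have "S \<le> (\<Sum>k\<in>J - {j}. real (m k) * ln (cmod (\<zeta> j - \<zeta> k))) + ln M" by simp
  moreover have "S = real (m j - 1) + (\<Sum>k\<in>J - {j}. real (m k))"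
  proof -
    have "S = real (\<mu> j) + (\<Sum>k\<in>J - {j}. real (\<mu> k))" unfolding S_def by (rule sum.remove[OF finJ jJ])
    also have "(\<Sum>k\<in>J - {j}. real (\<mu> k)) = (\<Sum>k\<in>J - {j}. real (m k))" by (rule sum.cong) (auto simp: \<mu>_def)
    finally show ?thesis by (simp add: \<mu>_def)
  qed
  moreover have "(\<Sum>k\<in>J - {j}. real (m k) * (1 - ln (cmod (\<zeta> j - \<zeta> k))))
      = (\<Sum>k\<in>J - {j}. real (m k)) - (\<Sum>k\<in>J - {j}. real (m k) * ln (cmod (\<zeta> j - \<zeta> k)))"
    by (simp add: right_diff_distrib sum_subtractf)
  moreover have "real (m j - 1) = real (m j) - 1" using mpos by simp
  ultimately show ?thesis unfolding N_count_at_point[OF V] J_def[symmetric] by linarith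
qed

text \<open>
  The data are concentrated on a sequence of points at distances larger than
  \<open>e\<close> from each other, with \<open>N\<close> larger than \<open>n * q\<close>
  at the \<open>n\<close>-th one. So in the disc of radius \<open>e\<close> about one of
  them, the interpolating function has all the other points as zeros of full multiplicity,
  as required by \<open>Jensen_counting_bound\<close>.
\<close>

theorem interpolating_imp_counting_bound:
  assumes q: "moderate_weight (\<lambda>z. p z + 1) \<kappa>" and V: "multiplicity_variety \<zeta> m"
    and I: "interpolating_variety p \<zeta> m"
  shows "\<exists>A>0. \<exists>B>0. \<forall>j. N_count \<zeta> m (\<zeta> j) (exp 1) \<le> A * p (\<zeta> j) + B"
proof (rule ccontr)
  interpret moderate_weight "\<lambda>z. p z + 1" \<kappa> by (rule q)
  let ?N = "\<lambda>j. N_count \<zeta> m (\<zeta> j) (exp 1)"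
  assume neg: "\<not> ?thesis"
  have p0: "0 \<le> p z" for z using q_ge_1[of z] by simp
  have large: "\<exists>j. ?N j > real n * (p (\<zeta> j) + 1) \<and> cmod (\<zeta> j) > r" for n :: nat and r
  proof (rule ccontr)
    assume no: "\<not> ?thesis"
    have fin: "finite {j. cmod (\<zeta> j) \<le> r}" using finite_close_points[OF V, of 0 r] by simp
    define B where "B = 1 + real n + (\<Sum>j | cmod (\<zeta> j) \<le> r. \<bar>?N j\<bar>)"
    have S0: "(\<Sum>j | cmod (\<zeta> j) \<le> r. \<bar>?N j\<bar>) \<ge> 0" by (rule sum_nonneg) simp
    have "?N j \<le> B * p (\<zeta> j) + B" for j
    proof (cases "cmod (\<zeta> j) \<le> r")
      case True
      have "\<bar>?N j\<bar> \<le> (\<Sum>j | cmod (\<zeta> j) \<le> r. \<bar>?N j\<bar>)"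
        using fin True by (intro member_le_sum) auto
      moreover have "0 \<le> B * p (\<zeta> j)" using S0 p0 by (simp add: B_def)
      ultimately show ?thesis by (simp add: B_def)
    next
      case False
      then have "?N j \<le> real n * (p (\<zeta> j) + 1)" using no by (meson not_le)
      also have "\<dots> \<le> B * (p (\<zeta> j) + 1)" using S0 p0 by (intro mult_right_mono) (auto simp: B_def intro: add_nonneg_nonneg)
      finally show ?thesis by (simp add: algebra_simps)
    qed
    moreover have "B > 0" using S0 of_nat_0_le_iff[of n, where 'a=real] unfolding B_def by linarith
    ultimately show False using neg by blast
  qed
  have "\<exists>s. \<forall>n. (?N (s n) > real n * (p (\<zeta> (s n)) + 1)) \<and> cmod (\<zeta> (s (Suc n))) > cmod (\<zeta> (s n)) + exp 1"
    using large by (intro dependent_nat_choice) blast+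
  then obtain s where s: "\<And>n. ?N (s n) > real n * (p (\<zeta> (s n)) + 1)"
    "\<And>n. cmod (\<zeta> (s (Suc n))) > cmod (\<zeta> (s n)) + exp 1" by blast
  have inc: "n < k \<Longrightarrow> cmod (\<zeta> (s k)) > cmod (\<zeta> (s n)) + exp 1" for n k
  proof (induction k)
    case (Suc k)
    have "cmod (\<zeta> (s n)) \<le> cmod (\<zeta> (s k))"
    proof (cases "n = k")
      case False
      then have "cmod (\<zeta> (s n)) + exp 1 < cmod (\<zeta> (s k))" using Suc by simp
      then show ?thesis using exp_gt_zero[of "1::real"] by linarith
    qed simp
    then show ?case using s(2)[of k] by linarith
  qed simp
  have sep: "cmod (\<zeta> (s n) - \<zeta> (s k)) > exp 1" if "n \<noteq> k" for n k
  proof -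
    have "n < k \<or> k < n" using that by auto
    then have "\<bar>cmod (\<zeta> (s n)) - cmod (\<zeta> (s k))\<bar> > exp 1" using inc[of n k] inc[of k n] by auto
    then show ?thesis using norm_triangle_ineq3[of "\<zeta> (s n)" "\<zeta> (s k)"] by linarith
  qed
  define w :: "nat \<Rightarrow> nat \<Rightarrow> complex" where "w k l = (if k \<in> range s \<and> l = m k - 1 then 1 else 0)" for k l
  have mpos: "0 < m k" for k using V by (simp add: multiplicity_variety_def)
  have "(\<Sum>l<m k. cmod (w k l)) \<le> 1 * exp (1 * p (\<zeta> k))" for k
  proof -
    have "(\<Sum>l<m k. cmod (w k l)) \<le> (\<Sum>l<m k. if l = m k - 1 then 1 else 0)"
      by (rule sum_mono) (simp add: w_def)
    also have "\<dots> \<le> 1" using mpos by simp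
    also have "\<dots> \<le> 1 * exp (1 * p (\<zeta> k))" using p0 by simp
    finally show ?thesis .
  qed
  then have "\<exists>A>0. \<exists>B>0. \<forall>j. (\<Sum>l<m j. cmod (w j l)) \<le> A * exp (B * p (\<zeta> j))"
    by (intro exI[of _ 1] conjI allI) auto
  then obtain f where f: "f \<in> A_space p" and fw: "\<And>j l. l < m j \<Longrightarrow> (deriv ^^ l) f (\<zeta> j) / fact l = w j l"
    using I unfolding interpolating_variety_def by blast
  obtain A B where AB: "A > 0" "B > 0" "\<And>z. cmod (f z) \<le> A * exp (B * p z)" and fh: "f holomorphic_on UNIV"
    using f by (auto simp: A_space_def)
  define C where "C = (\<kappa>\<^sup>2) ^ 3"
  have C0: "C \<ge> 0" by (simp add: C_def)
  have e3: "exp 1 \<le> (3::real)" using exp_le .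
  \<comment> \<open>The radius \<open>2 e\<close> is less than 6, and three steps of length
    2 lead from the centre to the circle.\<close>
  have pC: "p z + 1 \<le> C * (p a + 1)" if "cmod (z - a) \<le> 6" for z a
  proof -
    define d where "d = (z - a) / 3"
    have d: "cmod d \<le> 2" using that by (simp add: d_def norm_divide)
    have "p (a + d) + 1 \<le> \<kappa>\<^sup>2 * (p a + 1)" by (rule q_moderate_2) (use d in simp)
    moreover have "p (a + 2 * d) + 1 \<le> \<kappa>\<^sup>2 * (p (a + d) + 1)" by (rule q_moderate_2) (use d in simp)
    moreover have "p (a + 3 * d) + 1 \<le> \<kappa>\<^sup>2 * (p (a + 2 * d) + 1)" by (rule q_moderate_2) (use d in simp)
    ultimately have "p (a + 3 * d) + 1 \<le> \<kappa>\<^sup>2 * (\<kappa>\<^sup>2 * (\<kappa>\<^sup>2 * (p a + 1)))"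
      by (meson mult_left_mono order_trans zero_le_power2)
    moreover have az: "a + 3 * d = z" unfolding d_def by (simp add: field_simps)
    ultimately show ?thesis unfolding az C_def power3_eq_cube mult.assoc by simp
  qed
  have main: "?N (s n) \<le> (1 + \<bar>ln A\<bar> + B * C) * (p (\<zeta> (s n)) + 1)" for n
  proof -
    let ?j = "s n"
    have "?N ?j \<le> 1 + ln (A * exp (B * (C * (p (\<zeta> ?j) + 1))))"
    proof (rule Jensen_counting_bound[OF V fh])
      fix z assume "cmod (z - \<zeta> ?j) = 2 * exp 1"
      then have "p z + 1 \<le> C * (p (\<zeta> ?j) + 1)" using e3 by (intro pC) simp
      then have "A * exp (B * p z) \<le> A * exp (B * (C * (p (\<zeta> ?j) + 1)))"
        using AB by (intro mult_left_mono) auto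
      then show "cmod (f z) \<le> A * exp (B * (C * (p (\<zeta> ?j) + 1)))" using AB(3)[of z] by linarith
    next
      fix k l assume k: "cmod (\<zeta> ?j - \<zeta> k) \<le> exp 1" "k \<noteq> ?j" "l < m k"
      have "k \<notin> range s" using sep[of n] k by force
      then show "(deriv ^^ l) f (\<zeta> k) = 0" using fw[OF k(3)] by (simp add: w_def)
    next
      fix l assume "l < m ?j - 1"
      then show "(deriv ^^ l) f (\<zeta> ?j) = 0" using fw[of l ?j] by (simp add: w_def)
    next
      show "(deriv ^^ (m ?j - 1)) f (\<zeta> ?j) / fact (m ?j - 1) = 1"
        using fw[of "m ?j - 1" ?j] mpos[of ?j] by (simp add: w_def)
    qed (use AB in simp)
    also have "ln (A * exp (B * (C * (p (\<zeta> ?j) + 1)))) = ln A + B * (C * (p (\<zeta> ?j) + 1))"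
      using AB(1) by (simp add: ln_mult)
    finally have "?N ?j \<le> (1 + \<bar>ln A\<bar>) * 1 + B * C * (p (\<zeta> ?j) + 1)" by (simp add: mult.assoc)
    moreover have "(1 + \<bar>ln A\<bar>) * 1 \<le> (1 + \<bar>ln A\<bar>) * (p (\<zeta> ?j) + 1)" using p0 by (intro mult_left_mono) auto
    ultimately show ?thesis by (simp add: algebra_simps)
  qed
  obtain n :: nat where "1 + \<bar>ln A\<bar> + B * C \<le> real n" using real_arch_simple by blast
  then have "(1 + \<bar>ln A\<bar> + B * C) * (p (\<zeta> (s n)) + 1) \<le> real n * (p (\<zeta> (s n)) + 1)"
    using p0 by (intro mult_right_mono) (auto intro: add_nonneg_nonneg)
  then show False using main[of n] s(1)[of n] by linarith
qed

section \<open>Consequences of the counting condition\<close>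

locale counting_bound = moderate_weight +
  fixes \<zeta> :: "nat \<Rightarrow> complex" and m :: "nat \<Rightarrow> nat" and A :: real
  assumes V: "multiplicity_variety \<zeta> m" and A0: "A \<ge> 0"
    and N: "\<And>j. N_count \<zeta> m (\<zeta> j) (exp 1) \<le> A * q (\<zeta> j)"
begin

lemma inj: "inj \<zeta>" and mpos: "0 < m j"
  using V by (auto simp: multiplicity_variety_def)

lemma dist_pos: "j \<noteq> k \<Longrightarrow> 0 < cmod (\<zeta> j - \<zeta> k)"
  using inj by (auto simp: inj_def)

definition near :: "complex \<Rightarrow> real \<Rightarrow> nat set" where "near c r = {k. cmod (c - \<zeta> k) \<le> r}"

lemma finite_near: "finite (near c r)"
  unfolding near_def by (rule finite_close_points[OF V])

text \<open>
  Within distance \<open>e\<close> all terms of \<open>N\<close> are nonnegative, so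
  \<open>N\<close> bounds every partial sum.
\<close>

lemma log_sum_le:
  assumes K: "K \<subseteq> near (\<zeta> j) (exp 1) - {j}"
  shows "real (m j) + (\<Sum>k\<in>K. real (m k) * (1 - ln (cmod (\<zeta> j - \<zeta> k)))) \<le> A * q (\<zeta> j)"
proof -
  have "(\<Sum>k\<in>K. real (m k) * (1 - ln (cmod (\<zeta> j - \<zeta> k))))
      \<le> (\<Sum>k\<in>near (\<zeta> j) (exp 1) - {j}. real (m k) * (1 - ln (cmod (\<zeta> j - \<zeta> k))))"
  proof (rule sum_mono2)
    fix k assume "k \<in> near (\<zeta> j) (exp 1) - {j} - K"
    then have "cmod (\<zeta> j - \<zeta> k) \<le> exp 1" "0 < cmod (\<zeta> j - \<zeta> k)" using dist_pos by (auto simp: near_def)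
    then have "ln (cmod (\<zeta> j - \<zeta> k)) \<le> 1" by (metis ln_exp ln_mono)
    then show "0 \<le> real (m k) * (1 - ln (cmod (\<zeta> j - \<zeta> k)))" by simp
  qed (use finite_near K in auto)
  then show ?thesis using N[of j] unfolding N_count_at_point[OF V] near_def by linarith
qed

lemma m_le: "real (m j) \<le> A * q (\<zeta> j)"
  using log_sum_le[of "{}" j] by simp

lemma near_1_subset: "near (\<zeta> j) 1 \<subseteq> near (\<zeta> j) (exp 1)"
proof -
  have "1 \<le> exp (1::real)" by simp
  then show ?thesis by (auto simp: near_def intro: order_trans[of _ 1])
qed

lemma count_near_point: "(\<Sum>k\<in>near (\<zeta> j) 1. real (m k)) \<le> A * q (\<zeta> j)"
proof -
  have j: "j \<in> near (\<zeta> j) 1" by (simp add: near_def)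
  have "(\<Sum>k\<in>near (\<zeta> j) 1. real (m k)) = real (m j) + (\<Sum>k\<in>near (\<zeta> j) 1 - {j}. real (m k))"
    by (rule sum.remove[OF finite_near j])
  also have "(\<Sum>k\<in>near (\<zeta> j) 1 - {j}. real (m k)) \<le> (\<Sum>k\<in>near (\<zeta> j) 1 - {j}. real (m k) * (1 - ln (cmod (\<zeta> j - \<zeta> k))))"
  proof (rule sum_mono)
    fix k assume "k \<in> near (\<zeta> j) 1 - {j}"
    then have "ln (cmod (\<zeta> j - \<zeta> k)) \<le> 0" using dist_pos[of j k] by (auto simp: near_def)
    then have "real (m k) * 1 \<le> real (m k) * (1 - ln (cmod (\<zeta> j - \<zeta> k)))" by (intro mult_left_mono) auto
    then show "real (m k) \<le> real (m k) * (1 - ln (cmod (\<zeta> j - \<zeta> k)))" by simp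
  qed
  also have "real (m j) + \<dots> \<le> A * q (\<zeta> j)" using near_1_subset by (intro log_sum_le) blast
  finally show ?thesis by simp
qed

lemma count_near: "(\<Sum>k\<in>near c (1/2). real (m k)) \<le> A * \<kappa> * q c"
proof (cases "near c (1/2) = {}")
  case True
  then show ?thesis using A0 kappa_ge_1 q_ge_1[of c] by simp
next
  case False
  then obtain j where j: "cmod (c - \<zeta> j) \<le> 1/2" by (auto simp: near_def)
  have "near c (1/2) \<subseteq> near (\<zeta> j) 1"
  proof
    fix k assume "k \<in> near c (1/2)"
    then have "cmod (c - \<zeta> k) \<le> 1/2" by (simp add: near_def)
    then have "cmod (\<zeta> j - \<zeta> k) \<le> 1" using norm_triangle_ineq4[of "c - \<zeta> k" "c - \<zeta> j"] j by simp
    then show "k \<in> near (\<zeta> j) 1" by (simp add: near_def)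
  qed
  then have "(\<Sum>k\<in>near c (1/2). real (m k)) \<le> (\<Sum>k\<in>near (\<zeta> j) 1. real (m k))"
    by (intro sum_mono2 finite_near) auto
  also have "\<dots> \<le> A * q (\<zeta> j)" by (rule count_near_point)
  also have "\<dots> \<le> A * (\<kappa> * q c)" using A0 j by (intro mult_left_mono q_moderate) auto
  finally show ?thesis by (simp add: mult.assoc)
qed

text \<open>
  The term of \<open>\<zeta> j\<close> in \<open>N(\<zeta> k, e)\<close> alone bounds
  \<open>- ln (cmod (\<zeta> j - \<zeta> k))\<close> by
  \<open>A * \<kappa> * q (\<zeta> j) / m j\<close>, so
  \<open>4 * \<rho> j\<close> is a lower bound for the distance to the other points. The
  denominator \<open>m j\<close> is essential: it keeps \<open>\<rho> j ^ m j\<close>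
  from being smaller than \<open>exp (- O(q))\<close>.
\<close>

definition \<rho> :: "nat \<Rightarrow> real" where "\<rho> j = exp (- (A * \<kappa> * q (\<zeta> j) / real (m j))) / 4"

lemma rho_pos: "0 < \<rho> j" by (simp add: \<rho>_def)

lemma rho_le: "\<rho> j \<le> 1/4"
proof -
  have "0 \<le> A * \<kappa> * q (\<zeta> j) / real (m j)" using A0 kappa_ge_1 q_ge_1[of "\<zeta> j"] by simp
  then show ?thesis by (simp add: \<rho>_def)
qed

lemma inverse_rho_le: "1 / \<rho> j \<le> 4 * exp (A * \<kappa> * q (\<zeta> j))"
proof -
  have "1 / \<rho> j = 4 * exp (A * \<kappa> * q (\<zeta> j) / real (m j))" by (simp add: \<rho>_def exp_minus field_simps)
  moreover have "A * \<kappa> * q (\<zeta> j) / real (m j) \<le> A * \<kappa> * q (\<zeta> j) / 1"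
    using mpos[of j] A0 kappa_ge_1 q_ge_1[of "\<zeta> j"] by (intro divide_left_mono) auto
  ultimately show ?thesis by simp
qed

lemma separation_one: assumes "j \<noteq> k" shows "4 * \<rho> j \<le> cmod (\<zeta> j - \<zeta> k)"
proof (cases "cmod (\<zeta> j - \<zeta> k) \<le> 1")
  case False then show ?thesis using rho_le[of j] by linarith
next
  case True
  have d: "0 < cmod (\<zeta> j - \<zeta> k)" by (rule dist_pos[OF assms])
  have "{j} \<subseteq> near (\<zeta> k) (exp 1) - {k}"
    using True assms near_1_subset[of k] by (auto simp: near_def norm_minus_commute)
  from log_sum_le[OF this] have "real (m j) * (1 - ln (cmod (\<zeta> j - \<zeta> k))) \<le> A * q (\<zeta> k)"
    by (simp add: norm_minus_commute)
  also have "\<dots> \<le> A * (\<kappa> * q (\<zeta> j))" using A0 True by (intro mult_left_mono q_moderate) auto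
  finally have "1 - ln (cmod (\<zeta> j - \<zeta> k)) \<le> A * \<kappa> * q (\<zeta> j) / real (m j)"
    using mpos[of j] by (simp add: field_simps)
  then have "- (A * \<kappa> * q (\<zeta> j) / real (m j)) \<le> ln (cmod (\<zeta> j - \<zeta> k))" by linarith
  then have "exp (- (A * \<kappa> * q (\<zeta> j) / real (m j))) \<le> cmod (\<zeta> j - \<zeta> k)"
    using d by (metis exp_le_cancel_iff exp_ln)
  then show ?thesis by (simp add: \<rho>_def)
qed

lemma separation: assumes "j \<noteq> k" shows "4 * \<rho> j \<le> cmod (\<zeta> j - \<zeta> k)" "4 * \<rho> k \<le> cmod (\<zeta> j - \<zeta> k)"
  using separation_one[OF assms] separation_one[of k j] assms by (auto simp: norm_minus_commute)

lemma away_from_others: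
  assumes "cmod (z - \<zeta> j) \<le> \<rho> j" "k \<noteq> j"
  shows "cmod (\<zeta> j - \<zeta> k) / 2 \<le> cmod (z - \<zeta> k)" "\<rho> k \<le> cmod (z - \<zeta> k)"
proof -
  have "cmod (\<zeta> j - \<zeta> k) \<le> cmod (z - \<zeta> k) + cmod (z - \<zeta> j)"
    using norm_triangle_ineq4[of "z - \<zeta> k" "z - \<zeta> j"] by simp
  then show "cmod (\<zeta> j - \<zeta> k) / 2 \<le> cmod (z - \<zeta> k)" "\<rho> k \<le> cmod (z - \<zeta> k)"
    using separation[of j k] assms rho_pos[of k] rho_pos[of j] by linarith+
qed

text \<open>
  The factor of \<open>\<zeta> j\<close> is at least
  \<open>(\<rho> j / 2) ^ m j\<close>, where \<open>8 ^ m j\<close> is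
  \<open>exp (O(q))\<close> since \<open>m j \<le> A * q (\<zeta> j)\<close>. For
  the other points \<open>cmod (z - \<zeta> k)\<close> is at least
  \<open>cmod (\<zeta> j - \<zeta> k) / 2\<close>, hence at least
  \<open>cmod (\<zeta> j - \<zeta> k) / e\<close>, and the product of these powers is
  estimated by \<open>N\<close>.
\<close>

lemma zero_poly_lower_bound:
  assumes z: "\<rho> j / 2 \<le> cmod (z - \<zeta> j)" "cmod (z - \<zeta> j) \<le> \<rho> j"
  shows "exp (- (A * \<kappa> + 4 * A) * q (\<zeta> j)) \<le> cmod (zero_poly \<zeta> m (near z (1/4)) z)"
proof -
  let ?J = "near z (1/4)"
  have jJ: "j \<in> ?J" using z rho_le[of j] by (simp add: near_def)
  have l8: "ln (8::real) \<le> 3"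
  proof -
    have "(2::real) ^ 3 \<le> exp 1 ^ 3" using exp_ge_add_one_self[of 1] by (intro power_mono) auto
    also have "exp 1 ^ 3 = exp (3::real)" by (simp flip: exp_of_nat_mult)
    finally have "8 \<le> exp (3::real)" by simp
    then have "ln 8 \<le> ln (exp (3::real))" by (subst ln_le_cancel_iff) auto
    then show ?thesis by simp
  qed
  have "exp (- (A * \<kappa> * q (\<zeta> j)) - 3 * (A * q (\<zeta> j))) \<le> exp (- (A * \<kappa> * q (\<zeta> j)) - real (m j) * ln 8)"
  proof -
    have "real (m j) * ln 8 \<le> A * q (\<zeta> j) * 3" using m_le[of j] l8 by (intro mult_mono) auto
    then show ?thesis by simp
  qed
  also have "\<dots> = (\<rho> j / 2) ^ m j"
  proof -
    have "(\<rho> j / 2) ^ m j = exp (- (A * \<kappa> * q (\<zeta> j) / real (m j))) ^ m j / 8 ^ m j"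
      by (simp add: \<rho>_def power_divide)
    also have "exp (- (A * \<kappa> * q (\<zeta> j) / real (m j))) ^ m j = exp (- (A * \<kappa> * q (\<zeta> j)))"
      using mpos[of j] by (simp flip: exp_of_nat_mult)
    also have "(8::real) ^ m j = exp (real (m j) * ln 8)" by (simp add: exp_of_nat_mult)
    finally show ?thesis by (simp add: exp_diff)
  qed
  also have "\<dots> \<le> cmod (z - \<zeta> j) ^ m j" using z rho_pos[of j] by (intro power_mono) auto
  finally have one: "exp (- (A * \<kappa> * q (\<zeta> j)) - 3 * (A * q (\<zeta> j))) \<le> cmod (z - \<zeta> j) ^ m j" .
  have sub: "?J - {j} \<subseteq> near (\<zeta> j) 1 - {j}"
  proof
    fix k assume k: "k \<in> ?J - {j}"
    then have "cmod (\<zeta> j - \<zeta> k) / 2 \<le> 1/4" using away_from_others(1)[OF z(2), of k] by (auto simp: near_def)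
    then show "k \<in> near (\<zeta> j) 1 - {j}" using k by (simp add: near_def)
  qed
  have "exp (- (A * q (\<zeta> j))) \<le> exp (- (\<Sum>k\<in>?J - {j}. real (m k) * (1 - ln (cmod (\<zeta> j - \<zeta> k)))))"
    using log_sum_le[of "?J - {j}" j] sub near_1_subset[of j] by fastforce
  also have "\<dots> = (\<Prod>k\<in>?J - {j}. exp (- (real (m k) * (1 - ln (cmod (\<zeta> j - \<zeta> k))))))"
    using finite_near by (simp add: exp_sum flip: sum_negf)
  also have "\<dots> \<le> (\<Prod>k\<in>?J - {j}. cmod (z - \<zeta> k) ^ m k)"
  proof (rule prod_mono, intro conjI)
    fix k assume k: "k \<in> ?J - {j}"
    then have d: "0 < cmod (\<zeta> j - \<zeta> k)" by (intro dist_pos) auto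
    have "exp (- (real (m k) * (1 - ln (cmod (\<zeta> j - \<zeta> k))))) = (exp (ln (cmod (\<zeta> j - \<zeta> k)) - 1)) ^ m k"
      by (simp add: algebra_simps flip: exp_of_nat_mult)
    also have "\<dots> \<le> cmod (z - \<zeta> k) ^ m k"
    proof (intro power_mono)
      have "exp (ln (cmod (\<zeta> j - \<zeta> k)) - 1) = cmod (\<zeta> j - \<zeta> k) / exp 1" using d by (simp add: exp_diff)
      also have "\<dots> \<le> cmod (\<zeta> j - \<zeta> k) / 2"
        using exp_ge_add_one_self[of 1] by (intro divide_left_mono) auto
      also have "\<dots> \<le> cmod (z - \<zeta> k)" using k by (intro away_from_others(1)[OF z(2)]) auto
      finally show "exp (ln (cmod (\<zeta> j - \<zeta> k)) - 1) \<le> cmod (z - \<zeta> k)" .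
    qed simp
    finally show "exp (- (real (m k) * (1 - ln (cmod (\<zeta> j - \<zeta> k))))) \<le> cmod (z - \<zeta> k) ^ m k" .
  qed simp
  finally have two: "exp (- (A * q (\<zeta> j))) \<le> (\<Prod>k\<in>?J - {j}. cmod (z - \<zeta> k) ^ m k)" .
  have "cmod (zero_poly \<zeta> m ?J z) = (\<Prod>k\<in>?J. cmod (z - \<zeta> k) ^ m k)"
    by (simp add: zero_poly_def prod_norm[symmetric] norm_power)
  also have "\<dots> = cmod (z - \<zeta> j) ^ m j * (\<Prod>k\<in>?J - {j}. cmod (z - \<zeta> k) ^ m k)"
    by (rule prod.remove[OF finite_near jJ])
  also have "\<dots> \<ge> exp (- (A * \<kappa> * q (\<zeta> j)) - 3 * (A * q (\<zeta> j))) * exp (- (A * q (\<zeta> j)))"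
    by (rule mult_mono[OF one two]) auto
  finally show ?thesis by (simp add: algebra_simps flip: exp_add)
qed

lemma zero_poly_near_le:
  assumes z: "cmod (z - \<zeta> j) \<le> 1/4"
  shows "cmod (zero_poly \<zeta> m (near z (1/4)) z) \<le> cmod (z - \<zeta> j) ^ m j"
proof -
  let ?J = "near z (1/4)"
  have jJ: "j \<in> ?J" using z by (simp add: near_def)
  have "cmod (zero_poly \<zeta> m ?J z) = (\<Prod>k\<in>?J. cmod (z - \<zeta> k) ^ m k)"
    by (simp add: zero_poly_def prod_norm[symmetric] norm_power)
  also have "\<dots> = cmod (z - \<zeta> j) ^ m j * (\<Prod>k\<in>?J - {j}. cmod (z - \<zeta> k) ^ m k)"
    by (rule prod.remove[OF finite_near jJ])
  also have "\<dots> \<le> cmod (z - \<zeta> j) ^ m j * 1"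
    by (intro mult_left_mono prod_le_1) (auto simp: near_def intro!: power_le_one)
  finally show ?thesis by simp
qed

lemma zero_poly_le_1: "cmod (zero_poly \<zeta> m (near z (1/4)) z) \<le> 1"
  unfolding zero_poly_def prod_norm[symmetric] norm_power
  by (rule prod_le_1) (auto simp: near_def intro!: power_le_one)

text \<open>
  The factors lie between 1/4 and 1, and their number is \<open>O(q)\<close>. As a
  consequence the cofactors attached to \<open>z\<close> and to the centre \<open>c\<close>
  of a nearby cell are comparable.
\<close>

lemma zero_poly_difference_bounds:
  assumes z: "cmod (z - c) \<le> 1/8"
  defines "R \<equiv> cmod (zero_poly \<zeta> m (near c (1/2) - near z (1/4)) z)"
  shows "near z (1/4) \<subseteq> near c (1/2)" "R \<le> 1" "exp (- (2 * A * \<kappa> * q c)) \<le> R"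
proof -
  show "near z (1/4) \<subseteq> near c (1/2)"
  proof
    fix k assume "k \<in> near z (1/4)"
    then have "cmod (z - \<zeta> k) \<le> 1/4" by (simp add: near_def)
    then have "cmod (c - \<zeta> k) \<le> 1/2"
      using norm_triangle_ineq4[of "z - \<zeta> k" "z - c"] z by simp
    then show "k \<in> near c (1/2)" by (simp add: near_def)
  qed
  let ?K = "near c (1/2) - near z (1/4)"
  have Req: "R = (\<Prod>k\<in>?K. cmod (z - \<zeta> k) ^ m k)"
    by (simp add: R_def zero_poly_def prod_norm[symmetric] norm_power)
  have k1: "1/4 \<le> cmod (z - \<zeta> k) \<and> cmod (z - \<zeta> k) \<le> 1" if "k \<in> ?K" for k
  proof -
    have "cmod (z - \<zeta> k) \<le> cmod (c - \<zeta> k) + cmod (z - c)" using norm_triangle_ineq[of "c - \<zeta> k" "z - c"] by simp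
    then show ?thesis using that z by (auto simp: near_def)
  qed
  show "R \<le> 1" unfolding Req using k1 by (intro prod_le_1) (auto intro!: power_le_one)
  have q4: "exp (-2) \<le> (1/4::real)"
  proof -
    have "(2::real) ^ 2 \<le> exp 1 ^ 2" using exp_ge_add_one_self[of 1] by (intro power_mono) auto
    also have "exp 1 ^ 2 = exp (2::real)" by (simp flip: exp_of_nat_mult)
    finally show ?thesis by (simp add: exp_minus field_simps)
  qed
  have "(\<Sum>k\<in>?K. real (m k)) \<le> (\<Sum>k\<in>near c (1/2). real (m k))"
    by (intro sum_mono2 finite_near) auto
  also have "\<dots> \<le> A * \<kappa> * q c" by (rule count_near)
  finally have le: "(\<Sum>k\<in>?K. real (m k)) \<le> A * \<kappa> * q c" .
  have "(\<Sum>k\<in>?K. real (m k) * (-2)) = (\<Sum>k\<in>?K. real (m k)) * (-2)"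
    by (rule sum_distrib_right[symmetric])
  with le have "exp (- (2 * A * \<kappa> * q c)) \<le> exp (\<Sum>k\<in>?K. real (m k) * (-2))"
    by simp
  also have "\<dots> = (\<Prod>k\<in>?K. exp (-2) ^ m k)"
    using finite_near by (simp add: exp_sum flip: exp_of_nat_mult)
  also have "\<dots> \<le> R" unfolding Req
  proof (intro prod_mono conjI power_mono)
    fix k assume "k \<in> ?K"
    then show "exp (- 2) \<le> cmod (z - \<zeta> k)" using k1[of k] q4 by linarith
  qed auto
  finally show "exp (- (2 * A * \<kappa> * q c)) \<le> R" .
qed

end

section \<open>Sufficiency of the counting condition\<close>

context counting_bound
begin

lemma locally_finite_zeros: "locally_finite_points \<zeta> 1"
proof
  show "finite {i. cmod (z - \<zeta> i) < r}" for z r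
    by (rule finite_subset[OF _ finite_near[of z r]]) (auto simp: near_def)
qed simp

text \<open>
  The Taylor polynomials are cut off at radius \<open>\<rho> j\<close>; the discs are
  disjoint. The dbar derivative \<open>\<omega>\<close> lives in the annuli
  \<open>\<rho> j / 2 \<le> cmod (z - \<zeta> j) \<le> \<rho> j\<close>, where
  \<open>zero_poly_lower_bound\<close> permits inserting the nearby zeros as a factor in its
  bound. They will cancel when \<open>\<omega>\<close> is divided by \<open>G\<close>.
\<close>

lemma smooth_interpolant:
  fixes w :: "nat \<Rightarrow> nat \<Rightarrow> complex"
  assumes w: "\<And>j. (\<Sum>l<m j. cmod (w j l)) \<le> H * exp (b * q (\<zeta> j))" and H: "H > 0" and b: "b \<ge> 0"
    and D: "D > 0" "\<forall>c r z. r > 0 \<longrightarrow> cmod (dbump c r z) \<le> D / r"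
  obtains F \<omega> where "\<And>z. has_dbar F (\<omega> z) z" "C1_on UNIV \<omega>"
    "\<And>z. cmod (F z) \<le> H * exp (b * \<kappa> * q z)"
    "\<And>j z. cmod (z - \<zeta> j) \<le> \<rho> j / 2 \<Longrightarrow> F z = (\<Sum>l<m j. w j l * (z - \<zeta> j) ^ l) \<and> \<omega> z = 0"
    "\<And>z. cmod (\<omega> z) \<le> 4 * D * H * exp ((2 * A * \<kappa> + 4 * A + b) * \<kappa> * q z) * cmod (zero_poly \<zeta> m (near z (1/4)) z)"
proof -
  interpret locally_finite_points \<zeta> 1 by (rule locally_finite_zeros)
  define t where "t j z = (\<Sum>l<m j. w j l * (z - \<zeta> j) ^ l)" for j z
  have th: "t j holomorphic_on S" for j S unfolding t_def by (intro holomorphic_intros)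
  have tb: "cmod (t j z) \<le> H * exp (b * q (\<zeta> j))" if z: "cmod (z - \<zeta> j) \<le> 1" for j z
  proof -
    have "cmod (t j z) \<le> (\<Sum>l<m j. cmod (w j l))"
      unfolding t_def
    proof (rule sum_norm_le)
      fix l
      have "cmod (z - \<zeta> j) ^ l \<le> 1" using z by (intro power_le_one) auto
      then have "cmod (w j l) * cmod (z - \<zeta> j) ^ l \<le> cmod (w j l) * 1" by (intro mult_left_mono) auto
      then show "cmod (w j l * (z - \<zeta> j) ^ l) \<le> cmod (w j l)" by (simp add: norm_mult norm_power)
    qed
    then show ?thesis using w[of j] by linarith
  qed
  define f where "f j z = bump (\<zeta> j) (\<rho> j) z * t j z" for j z
  define g where "g j z = dbump (\<zeta> j) (\<rho> j) z * t j z" for j z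
  have out: "f j z = 0" "g j z = 0" if "\<rho> j \<le> cmod (z - \<zeta> j)" for j z
    using that rho_pos by (auto simp: f_def g_def bump_eq_0 dbump_eq_0)
  have out1: "f j z = 0" "g j z = 0" if "1 \<le> cmod (z - \<zeta> j)" for j z
    using out[of j z] rho_le[of j] that by auto
  define F where "F z = (\<Sum>j | cmod (z - \<zeta> j) < 1. f j z)" for z
  define \<omega> where "\<omega> z = (\<Sum>j | cmod (z - \<zeta> j) < 1. g j z)" for z
  have dF: "has_dbar F (\<omega> z) z" for z
    unfolding F_def \<omega>_def
  proof (rule has_dbar_local_sum)
    show "has_dbar (f j) (g j z) z" for j z
      using has_dbar_mult[OF has_dbar_bump has_dbar_holomorphic[OF th open_UNIV UNIV_I]]
      by (simp add: f_def[abs_def] g_def)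
  qed (use out1 in auto)
  have C\<omega>: "C1_on UNIV \<omega>"
    unfolding \<omega>_def
  proof (rule C1_local_sum)
    show "C1_on UNIV (g j)" for j
      unfolding g_def by (intro C1_on_mult C1_dbump C1_on_holomorphic th open_UNIV)
  qed (use out1 in auto)
  have single: "F z = f j z" "\<omega> z = g j z" if z: "cmod (z - \<zeta> j) \<le> \<rho> j" for j z
  proof -
    have "{k. cmod (z - \<zeta> k) < 1} \<subseteq> near z 1" by (auto simp: near_def)
    then have fin: "finite {k. cmod (z - \<zeta> k) < 1}" using finite_near finite_subset by blast
    have j: "j \<in> {k. cmod (z - \<zeta> k) < 1}" using z rho_le[of j] by simp
    have "\<rho> k \<le> cmod (z - \<zeta> k)" if "k \<noteq> j" for k by (rule away_from_others(2)[OF z that])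
    then have "f k z = 0" "g k z = 0" if "k \<noteq> j" for k using out that by auto
    then show "F z = f j z" "\<omega> z = g j z"
      unfolding F_def \<omega>_def using sum.remove[OF fin j, of "\<lambda>k. f k z"] sum.remove[OF fin j, of "\<lambda>k. g k z"]
      by (simp_all add: sum.neutral)
  qed
  have none: "F z = 0" "\<omega> z = 0" if "\<And>j. \<rho> j < cmod (z - \<zeta> j)" for z
    unfolding F_def \<omega>_def using out that by (simp_all add: less_imp_le)
  have qj: "q (\<zeta> j) \<le> \<kappa> * q z" if "cmod (z - \<zeta> j) \<le> \<rho> j" for j z
    by (rule q_moderate) (use that rho_le[of j] in simp)
  have Fb: "cmod (F z) \<le> H * exp (b * \<kappa> * q z)" for z
  proof (cases "\<exists>j. cmod (z - \<zeta> j) \<le> \<rho> j")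
    case True
    then obtain j where j: "cmod (z - \<zeta> j) \<le> \<rho> j" by blast
    have "cmod (F z) = cmod (bump (\<zeta> j) (\<rho> j) z) * cmod (t j z)"
      by (simp add: single(1)[OF j] f_def norm_mult)
    also have "\<dots> \<le> 1 * (H * exp (b * q (\<zeta> j)))"
      using j rho_le[of j] by (intro mult_mono norm_bump_le tb) auto
    also have "\<dots> \<le> H * exp (b * \<kappa> * q z)"
      using H mult_left_mono[OF qj[OF j] b] by (simp add: mult.assoc)
    finally show ?thesis .
  next
    case False
    then have "F z = 0" by (intro none) (simp add: not_le)
    then show ?thesis using H by simp
  qed
  have core: "F z = (\<Sum>l<m j. w j l * (z - \<zeta> j) ^ l) \<and> \<omega> z = 0" if z: "cmod (z - \<zeta> j) \<le> \<rho> j / 2" for j z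
  proof -
    have z': "cmod (z - \<zeta> j) \<le> \<rho> j" using z rho_pos[of j] by simp
    show ?thesis
      using single[OF z'] z rho_pos[of j] by (simp add: f_def g_def t_def bump_eq_1 dbump_eq_0)
  qed
  have \<omega>b: "cmod (\<omega> z) \<le> 4 * D * H * exp ((2 * A * \<kappa> + 4 * A + b) * \<kappa> * q z) * cmod (zero_poly \<zeta> m (near z (1/4)) z)" for z
  proof (cases "\<omega> z = 0")
    case True then show ?thesis using D(1) H by simp
  next
    case False
    then obtain j where j: "cmod (z - \<zeta> j) \<le> \<rho> j" using none(2)[of z] not_le by blast
    have j2: "\<rho> j / 2 \<le> cmod (z - \<zeta> j)" using core[of z j] False by fastforce
    let ?Z = "cmod (zero_poly \<zeta> m (near z (1/4)) z)"
    let ?q = "q (\<zeta> j)"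
    have "cmod (\<omega> z) = cmod (dbump (\<zeta> j) (\<rho> j) z) * cmod (t j z)"
      by (simp add: single(2)[OF j] g_def norm_mult)
    also have "\<dots> \<le> (D * (1 / \<rho> j)) * (H * exp (b * ?q))"
      using j rho_le[of j] rho_pos[of j] D by (intro mult_mono tb) auto
    also have "\<dots> \<le> (D * (4 * exp (A * \<kappa> * ?q))) * (H * exp (b * ?q))"
      using D(1) H by (intro mult_right_mono mult_left_mono inverse_rho_le) auto
    also have "\<dots> = (4 * D * H * exp ((2 * A * \<kappa> + 4 * A + b) * ?q)) * exp (- (A * \<kappa> + 4 * A) * ?q)"
      by (simp add: algebra_simps flip: exp_add)
    also have "\<dots> \<le> (4 * D * H * exp ((2 * A * \<kappa> + 4 * A + b) * ?q)) * ?Z"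
      using D(1) H by (intro mult_left_mono zero_poly_lower_bound[OF j2 j]) auto
    also have "\<dots> \<le> (4 * D * H * exp ((2 * A * \<kappa> + 4 * A + b) * \<kappa> * q z)) * ?Z"
    proof -
      have "0 \<le> 2 * A * \<kappa> + 4 * A + b" using A0 b kappa_ge_1 by (intro add_nonneg_nonneg mult_nonneg_nonneg) auto
      from mult_left_mono[OF qj[OF j] this]
      have "(2 * A * \<kappa> + 4 * A + b) * ?q \<le> (2 * A * \<kappa> + 4 * A + b) * \<kappa> * q z" by (simp add: mult.assoc)
      then show ?thesis using D(1) H by (intro mult_right_mono mult_left_mono) auto
    qed
    finally show ?thesis .
  qed
  show ?thesis by (rule that[OF dF C\<omega> Fb core \<omega>b])
qed

end

text \<open>
  The interpolating function is \<open>F - G * u\<close>, with \<open>u\<close> from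
  \<open>dbar_solve\<close> for the weight
  \<open>M z = exp (\<beta> * \<Phi> z) / cmod (Qz z)\<close> and the local
  functions \<open>exp (\<beta> * h) / Q\<close>. Near \<open>\<zeta> j\<close> the
  product \<open>G * u\<close> is bounded by a constant times
  \<open>cmod (z - \<zeta> j) ^ m j\<close>, because the bound for \<open>u\<close>
  contains no zero of \<open>G\<close> close to \<open>z\<close>; so it does not change the
  jets of \<open>F\<close>.
\<close>

theorem counting_bound_imp_interpolating:
  assumes p: "weight p" and C2: "C2_on p {z. cmod z > R0}" and O: "p \<in> O[at_infinity](laplacian p)"
    and V: "multiplicity_variety \<zeta> m"
    and cnt: "A > 0" "B > 0" "\<And>j. N_count \<zeta> m (\<zeta> j) (exp 1) \<le> A * p (\<zeta> j) + B"
  shows "interpolating_variety p \<zeta> m"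
proof -
  define q where "q z = p z + 1" for z
  have p0: "0 \<le> p z" for z using p by (simp add: weight_def)
  obtain \<kappa> where \<kappa>: "subharmonic_weight (\<lambda>z. p z + 1) \<kappa>" using weight_subharmonic_weight[OF p] by blast
  interpret moderate_weight q \<kappa>
    using \<kappa> unfolding q_def[abs_def] subharmonic_weight_def by blast
  interpret counting_bound q \<kappa> \<zeta> m "A + B"
  proof
    fix j
    have "A * p (\<zeta> j) + B \<le> (A + B) * q (\<zeta> j)" using cnt p0[of "\<zeta> j"] by (simp add: q_def algebra_simps)
    then show "N_count \<zeta> m (\<zeta> j) (exp 1) \<le> (A + B) * q (\<zeta> j)" using cnt(3)[of j] by linarith
  qed (use V cnt in auto)
  obtain \<Phi> A1 \<gamma> \<epsilon> \<delta> where A1: "A1 > 0" and \<gamma>: "\<gamma> > 0" and del: "0 < \<delta>" "\<delta> < \<epsilon> / 2" and eps: "\<epsilon> \<le> 1/8"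
    and Phi: "\<And>z. q z \<le> A1 * \<Phi> z" "\<And>z. \<Phi> z \<le> A1 * q z"
    and "\<forall>c. \<exists>h. h holomorphic_on ball c 1 \<and>
      (\<forall>z. cmod (z - c) < \<delta> \<longrightarrow> \<Phi> z - Re (h z) \<le> \<gamma> * q c) \<and>
      (\<forall>z. \<epsilon> / 2 \<le> cmod (z - c) \<and> cmod (z - c) < \<epsilon> \<longrightarrow> 2 * \<gamma> * q c \<le> \<Phi> z - Re (h z)) \<and>
      (\<forall>z. cmod (z - c) < \<epsilon> \<longrightarrow> - (A1 * q c) \<le> \<Phi> z - Re (h z))"
    using weight_local_peaks[OF p C2 O \<kappa>] unfolding q_def by blast
  then obtain h where hh: "\<And>c. h c holomorphic_on ball c 1"
    and h1: "\<And>c z. cmod (z - c) < \<delta> \<Longrightarrow> \<Phi> z - Re (h c z) \<le> \<gamma> * q c"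
    and h2: "\<And>c z. \<epsilon> / 2 \<le> cmod (z - c) \<Longrightarrow> cmod (z - c) < \<epsilon> \<Longrightarrow> 2 * \<gamma> * q c \<le> \<Phi> z - Re (h c z)"
    and h3: "\<And>c z. cmod (z - c) < \<epsilon> \<Longrightarrow> - (A1 * q c) \<le> \<Phi> z - Re (h c z)"
    by metis
  have e0: "0 < \<epsilon>" using del by simp
  have Phi0: "0 \<le> \<Phi> z" for z
  proof -
    have "0 < A1 * \<Phi> z" using Phi(1)[of z] q_ge_1[of z] by linarith
    then show ?thesis using A1 by (simp add: zero_less_mult_iff)
  qed
  obtain N where "cell_cover (lattice_point (\<delta> / 2)) \<epsilon> (lattice_hat (\<delta> / 2)) \<delta> N"
    using lattice_cell_cover[OF del] by blast
  then interpret cc: cell_cover "lattice_point (\<delta> / 2)" \<epsilon> "lattice_hat (\<delta> / 2)" \<delta> N .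
  define c where "c = lattice_point (\<delta> / 2)"
  obtain C where C: "C > 0" "\<And>c g. C1_on UNIV g \<Longrightarrow> (\<forall>w. cmod (w - c) \<ge> \<delta> \<longrightarrow> g w = 0) \<Longrightarrow>
      (\<exists>u. (\<forall>z. has_dbar u (g z) z) \<and>
       (\<forall>S z. (\<forall>w. cmod (g w) \<le> S) \<longrightarrow> cmod (z - c) \<le> \<epsilon> \<longrightarrow> cmod (u z) \<le> C * S))"
    using dbar_solution_compact[of \<delta> \<epsilon>] by blast
  obtain D where D: "D > 0" "\<And>c r z. r > 0 \<Longrightarrow> cmod (dbump c r z) \<le> D / r"
    using norm_dbump_le by blast
  have D2: "\<forall>c r z. r > 0 \<longrightarrow> cmod (dbump c r z) \<le> D / r" using D(2) by blast
  obtain G Q where G: "G holomorphic_on UNIV" "\<And>z. G z = 0 \<longleftrightarrow> z \<in> range \<zeta>"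
    and Qh: "\<And>J. finite J \<Longrightarrow> Q J holomorphic_on UNIV"
    and GQ: "\<And>J z. finite J \<Longrightarrow> G z = zero_poly \<zeta> m J z * Q J z"
    and Q0: "\<And>J z. finite J \<Longrightarrow> (\<And>k. \<zeta> k = z \<Longrightarrow> k \<in> J) \<Longrightarrow> Q J z \<noteq> 0"
    and Qrel: "\<And>J J' z. finite J' \<Longrightarrow> J \<subseteq> J' \<Longrightarrow> Q J z = zero_poly \<zeta> m (J' - J) z * Q J' z"
    by (fact divisor_cofactors[OF V])
  define T where "T = 2 * (A + B) * \<kappa>"
  have T0: "T \<ge> 0" using cnt kappa_ge_1 by (simp add: T_def)
  show ?thesis unfolding interpolating_variety_def
  proof (intro allI impI)
    fix w :: "nat \<Rightarrow> nat \<Rightarrow> complex"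
    assume "\<exists>A>0. \<exists>B>0. \<forall>j. (\<Sum>l<m j. cmod (w j l)) \<le> A * exp (B * p (\<zeta> j))"
    then obtain H b where H: "H > 0" "b > 0" "\<And>j. (\<Sum>l<m j. cmod (w j l)) \<le> H * exp (b * p (\<zeta> j))" by blast
    have wq: "(\<Sum>l<m j. cmod (w j l)) \<le> H * exp (b * q (\<zeta> j))" for j
    proof -
      have "H * exp (b * p (\<zeta> j)) \<le> H * exp (b * q (\<zeta> j))" using H(1,2) by (simp add: q_def)
      then show ?thesis using H(3)[of j] by linarith
    qed
    have b0: "b \<ge> 0" using H(2) by simp
    define X where "X = (2 * (A + B) * \<kappa> + 4 * (A + B) + b) * \<kappa>"
    obtain F \<omega> where dF: "\<And>z. has_dbar F (\<omega> z) z" and \<omega>C: "C1_on UNIV \<omega>"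
      and Fb: "\<And>z. cmod (F z) \<le> H * exp (b * \<kappa> * q z)"
      and Fcore: "\<And>j z. cmod (z - \<zeta> j) \<le> \<rho> j / 2 \<Longrightarrow> F z = (\<Sum>l<m j. w j l * (z - \<zeta> j) ^ l) \<and> \<omega> z = 0"
      and \<omega>b0: "\<And>z. cmod (\<omega> z) \<le> 4 * D * H * exp ((2 * (A + B) * \<kappa> + 4 * (A + B) + b) * \<kappa> * q z)
          * cmod (zero_poly \<zeta> m (near z (1/4)) z)"
      by (fact smooth_interpolant[OF wq H(1) b0 D(1) D2])
    note \<omega>b = \<omega>b0[folded X_def]
    have X0: "X \<ge> 0" unfolding X_def using cnt H(2) kappa_ge_1
      by (intro mult_nonneg_nonneg add_nonneg_nonneg) auto
    define Y where "Y = real N * (D / \<epsilon> * C) * 2 + 1"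
    have Y1: "Y \<ge> 1" using D(1) C(1) e0 by (simp add: Y_def)
    \<comment> \<open>There are two demands on \<open>\<beta>\<close>:
      \<open>exp (\<beta> * \<Phi>)\<close> has to dominate the size
      \<open>exp (X * q)\<close> of \<open>\<omega>\<close>, and the gain
      \<open>exp (- \<beta> * \<gamma>)\<close> in the annuli has to compensate for
      \<open>exp T\<close>, from the comparison of cofactors, and for the constant
      \<open>Y\<close> of the parametrix.\<close>
    define \<beta> where "\<beta> = (T + ln Y) / \<gamma> + X * A1"
    have lnY: "ln Y \<ge> 0" using Y1 by simp
    have beta: "\<beta> \<ge> 0" "X * A1 \<le> \<beta>" "T + ln Y \<le> \<beta> * \<gamma>"
    proof -
      show "\<beta> \<ge> 0" "X * A1 \<le> \<beta>" using T0 lnY \<gamma> X0 A1 by (auto simp: \<beta>_def)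
      have "0 \<le> X * A1 * \<gamma>" using X0 A1 \<gamma> by simp
      moreover have "(T + ln Y) / \<gamma> * \<gamma> = T + ln Y" using \<gamma> by simp
      ultimately show "T + ln Y \<le> \<beta> * \<gamma>" unfolding \<beta>_def distrib_right by linarith
    qed
    define Qz where "Qz z = Q (near z (1/4)) z" for z
    have Qz0: "Qz z \<noteq> 0" for z unfolding Qz_def by (rule Q0[OF finite_near]) (auto simp: near_def)
    define M where "M z = exp (\<beta> * \<Phi> z) / cmod (Qz z)" for z
    define E where "E i z = exp (of_real \<beta> * h (c i) z) / Q (near (c i) (1/2)) z" for i z
    have Qc0: "Q (near a (1/2)) z \<noteq> 0" if "cmod (z - a) < 1/2" for a z
      by (rule Q0[OF finite_near]) (use that in \<open>auto simp: near_def norm_minus_commute\<close>)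
    have ball2: "cmod (z - c i) < 1/4" if "z \<in> ball (c i) (2 * \<epsilon>)" for z i
      using that eps by (simp add: dist_norm norm_minus_commute)
    have cE: "cmod (E i z) = exp (\<beta> * Re (h (c i) z)) / cmod (Q (near (c i) (1/2)) z)" for i z
      by (simp add: E_def norm_divide)
    \<comment> \<open>The bound \<open>v\<close> is negative on the whole disc, which gives
      the loss \<open>W\<close>, and \<open>2 * \<gamma> * q (c i)\<close> on the
      annulus, which gives the gain.\<close>
    have ratio: "M x * cmod (E i z) \<le> exp (\<beta> * \<gamma> * q (c i) - \<beta> * v + T * q (c i)) * (M z * cmod (E i x))"
      if x: "cmod (x - c i) < \<delta>" and z: "cmod (z - c i) < \<epsilon>" and v: "v \<le> \<Phi> z - Re (h (c i) z)" for i x z v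
    proof -
      let ?J = "near (c i) (1/2)"
      let ?R = "\<lambda>x. cmod (zero_poly \<zeta> m (?J - near x (1/4)) x)"
      have rel: "cmod (Qz y) = ?R y * cmod (Q ?J y)" if "cmod (y - c i) \<le> 1/8" for y
        unfolding Qz_def by (subst Qrel[OF finite_near zero_poly_difference_bounds(1)[OF that]]) (simp add: norm_mult)
      have x8: "cmod (x - c i) \<le> 1/8" and z8: "cmod (z - c i) \<le> 1/8" using x z del eps by simp_all
      have Qx: "cmod (Q ?J x) > 0" and Qzz: "cmod (Q ?J z) > 0" using Qc0 x8 z8 by auto
      have Rx: "exp (- (T * q (c i))) \<le> ?R x" using zero_poly_difference_bounds(3)[OF x8] by (simp add: T_def)
      have Rx0: "?R x > 0" using Rx exp_gt_zero less_le_trans by blast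
      have Rz0: "?R z > 0" using zero_poly_difference_bounds(3)[OF z8] exp_gt_zero less_le_trans by blast
      have Rz: "?R z \<le> 1" by (rule zero_poly_difference_bounds(2)[OF z8])
      have a1: "\<beta> * (\<Phi> x - Re (h (c i) x)) \<le> \<beta> * (\<gamma> * q (c i))"
        using h1[OF x] beta(1) by (intro mult_left_mono) auto
      have a2: "\<beta> * v \<le> \<beta> * (\<Phi> z - Re (h (c i) z))" using v beta(1) by (intro mult_left_mono) auto
      have ex: "exp (\<beta> * \<Phi> x) * exp (\<beta> * Re (h (c i) z))
          \<le> exp (\<beta> * \<gamma> * q (c i) - \<beta> * v) * (exp (\<beta> * \<Phi> z) * exp (\<beta> * Re (h (c i) x)))"
        using a1 a2 by (simp add: algebra_simps flip: exp_add)
      have RR: "?R z \<le> exp (T * q (c i)) * ?R x"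
      proof -
        have "1 = exp (T * q (c i)) * exp (- (T * q (c i)))" by (simp flip: exp_add)
        also have "\<dots> \<le> exp (T * q (c i)) * ?R x" using Rx by (intro mult_left_mono) auto
        finally show ?thesis using Rz by linarith
      qed
      have "M x * cmod (E i z) = (exp (\<beta> * \<Phi> x) * exp (\<beta> * Re (h (c i) z))) / (?R x * cmod (Q ?J x) * cmod (Q ?J z))"
        by (simp add: M_def cE rel[OF x8])
      also have "\<dots> \<le> (exp (\<beta> * \<gamma> * q (c i) - \<beta> * v) * (exp (\<beta> * \<Phi> z) * exp (\<beta> * Re (h (c i) x)))) / (?R x * cmod (Q ?J x) * cmod (Q ?J z))"
        using Rx0 Qx Qzz by (intro divide_right_mono ex) auto
      also have "\<dots> = exp (\<beta> * \<gamma> * q (c i) - \<beta> * v) * (?R z / ?R x) * (M z * cmod (E i x))"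
        using Rx0 Rz0 Qx Qzz by (simp add: M_def cE rel[OF z8])
      also have "\<dots> \<le> exp (\<beta> * \<gamma> * q (c i) - \<beta> * v) * exp (T * q (c i)) * (M z * cmod (E i x))"
        using RR Rx0 by (intro mult_right_mono mult_left_mono) (auto simp: pos_divide_le_eq M_def)
      finally show ?thesis by (simp add: exp_add)
    qed
    define W where "W z = exp ((\<beta> * \<gamma> + \<beta> * A1 + T) * \<kappa> * q z)" for z
    define s where "s = 4 * D * H"
    define a where "a z = \<omega> z / G z" for z
    have aM: "cmod (a z) \<le> s * M z" for z
    proof (cases "\<omega> z = 0")
      case True then show ?thesis using D(1) H(1) by (simp add: a_def s_def M_def)
    next
      case False
      let ?Z = "cmod (zero_poly \<zeta> m (near z (1/4)) z)"
      have Z0: "?Z > 0" using \<omega>b[of z] False by (auto intro: ccontr)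
      have "cmod (a z) = cmod (\<omega> z) / (?Z * cmod (Qz z))"
        by (simp add: a_def norm_divide GQ[OF finite_near[of z "1/4"]] norm_mult Qz_def)
      also have "\<dots> \<le> (s * exp (X * q z) * ?Z) / (?Z * cmod (Qz z))"
        using \<omega>b[of z] by (intro divide_right_mono) (auto simp: s_def)
      also have "\<dots> = s * exp (X * q z) / cmod (Qz z)" using Z0 by simp
      also have "\<dots> \<le> s * exp (\<beta> * \<Phi> z) / cmod (Qz z)"
      proof -
        have "X * q z \<le> X * (A1 * \<Phi> z)" using X0 Phi(1) by (intro mult_left_mono) auto
        also have "\<dots> \<le> \<beta> * \<Phi> z" using mult_right_mono[OF beta(2) Phi0[of z]] by (simp add: mult.assoc)
        finally show ?thesis using D(1) H(1) by (intro divide_right_mono mult_left_mono) (auto simp: s_def)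
      qed
      finally show ?thesis by (simp add: M_def)
    qed
    have aC: "C1_on UNIV a"
    proof (rule C1_on_local)
      fix z
      have cG: "continuous_on UNIV G" by (rule holomorphic_on_imp_continuous_on[OF G(1)])
      show "\<exists>U. open U \<and> z \<in> U \<and> C1_on U a"
      proof (cases "G z = 0")
        case False
        have o: "open {z. G z \<noteq> 0}" using cG by (intro open_Collect_neq) auto
        have "C1_on {z. G z \<noteq> 0} (\<lambda>z. \<omega> z * (1 / G z))"
          by (intro C1_on_mult C1_on_subset[OF \<omega>C] C1_on_holomorphic[OF _ o] holomorphic_intros
              holomorphic_on_subset[OF G(1)]) auto
        then have "C1_on {z. G z \<noteq> 0} a" by (simp add: a_def[abs_def])
        then show ?thesis using False o by blast
      next
        case True
        then obtain j where j: "z = \<zeta> j" using G(2) by blast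
        have "C1_on (ball (\<zeta> j) (\<rho> j / 2)) a"
          by (rule C1_on_cong[OF C1_on_const[of _ 0]])
            (use Fcore[of _ j] in \<open>auto simp: a_def dist_norm norm_minus_commute\<close>)
        then show ?thesis using rho_pos[of j] j by (intro exI[of _ "ball (\<zeta> j) (\<rho> j / 2)"]) auto
      qed
    qed
    have Ga: "has_dbar F (G z * a z) z" for z
    proof (cases "G z = 0")
      case True
      then obtain j where j: "z = \<zeta> j" using G(2) by blast
      have "\<omega> z = 0" using Fcore[of z j] j rho_pos[of j] by simp
      then show ?thesis using dF[of z] True by simp
    next
      case False then show ?thesis using dF[of z] by (simp add: a_def)
    qed
    have "\<exists>u. (\<forall>z. cmod (u z) \<le> 2 * real N * C * s * (W z * M z)) \<and>
      (\<forall>F G. G holomorphic_on UNIV \<longrightarrow> (\<forall>z. has_dbar F (G z * a z) z) \<longrightarrow>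
        (\<lambda>z. F z - G z * u z) holomorphic_on UNIV)"
    proof (rule cc.dbar_solve[OF C D, folded c_def])
      show "E i holomorphic_on ball (c i) (2 * \<epsilon>)" for i
        unfolding E_def
      proof (intro holomorphic_intros)
        show "h (c i) holomorphic_on ball (c i) (2 * \<epsilon>)"
          by (rule holomorphic_on_subset[OF hh]) (use eps in auto)
        show "Q (near (c i) (1/2)) holomorphic_on ball (c i) (2 * \<epsilon>)"
          by (rule holomorphic_on_subset[OF Qh[OF finite_near]]) auto
        show "Q (near (c i) (1/2)) z \<noteq> 0" if "z \<in> ball (c i) (2 * \<epsilon>)" for z
          using ball2[OF that] by (intro Qc0) simp
      qed
      show "E i z \<noteq> 0" if "z \<in> ball (c i) (2 * \<epsilon>)" for i z
        using Qc0[of z "c i"] ball2[OF that] by (simp add: E_def)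
      show "M z > 0" for z using Qz0 by (simp add: M_def)
      show "M x * cmod (E i z) \<le> W z * M z * cmod (E i x)" if x: "cmod (x - c i) < \<delta>" and z: "cmod (z - c i) < \<epsilon>" for i x z
      proof -
        have "M x * cmod (E i z) \<le> exp (\<beta> * \<gamma> * q (c i) - \<beta> * - (A1 * q (c i)) + T * q (c i)) * (M z * cmod (E i x))"
          by (rule ratio[OF x z h3[OF z]])
        also have "\<dots> \<le> W z * (M z * cmod (E i x))"
        proof (rule mult_right_mono)
          have "q (c i) \<le> \<kappa> * q z" by (rule q_moderate) (use z eps in simp)
          then have "(\<beta> * \<gamma> + \<beta> * A1 + T) * q (c i) \<le> (\<beta> * \<gamma> + \<beta> * A1 + T) * (\<kappa> * q z)"
            using beta(1) \<gamma> A1 T0 by (intro mult_left_mono) auto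
          then show "exp (\<beta> * \<gamma> * q (c i) - \<beta> * - (A1 * q (c i)) + T * q (c i)) \<le> W z"
            by (simp add: W_def algebra_simps)
        qed (simp add: M_def)
        finally show ?thesis by (simp add: mult.assoc)
      qed
      show "M x * cmod (E i z) \<le> exp (T - \<beta> * \<gamma>) * (M z * cmod (E i x))"
        if x: "cmod (x - c i) < \<delta>" and z: "\<epsilon> / 2 \<le> cmod (z - c i)" "cmod (z - c i) < \<epsilon>" for i x z
      proof -
        have "M x * cmod (E i z) \<le> exp (\<beta> * \<gamma> * q (c i) - \<beta> * (2 * \<gamma> * q (c i)) + T * q (c i)) * (M z * cmod (E i x))"
          by (rule ratio[OF x z(2) h2[OF z]])
        also have "\<dots> \<le> exp (T - \<beta> * \<gamma>) * (M z * cmod (E i x))"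
        proof (rule mult_right_mono)
          have "(T - \<beta> * \<gamma>) * q (c i) \<le> (T - \<beta> * \<gamma>) * 1"
            using beta(3) lnY q_ge_1[of "c i"] by (intro mult_left_mono_neg) auto
          then show "exp (\<beta> * \<gamma> * q (c i) - \<beta> * (2 * \<gamma> * q (c i)) + T * q (c i)) \<le> exp (T - \<beta> * \<gamma>)"
            by (simp add: algebra_simps)
        qed (simp add: M_def)
        finally show ?thesis .
      qed
      show "0 \<le> W z" for z by (simp add: W_def)
      show "\<exists>Q. \<forall>z\<in>cball 0 R. W z \<le> Q" for R
      proof -
        obtain S where S: "\<And>z. cmod z \<le> R \<Longrightarrow> q z \<le> S" using q_bounded[of R] by blast
        show ?thesis
        proof (intro exI ballI)
          fix z :: complex assume "z \<in> cball 0 R"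
          then have "(\<beta> * \<gamma> + \<beta> * A1 + T) * \<kappa> * q z \<le> (\<beta> * \<gamma> + \<beta> * A1 + T) * \<kappa> * S"
            using beta(1) \<gamma> A1 T0 kappa_ge_1 by (intro mult_left_mono S) auto
          then show "W z \<le> exp ((\<beta> * \<gamma> + \<beta> * A1 + T) * \<kappa> * S)" by (simp add: W_def)
        qed
      qed
      show "0 \<le> exp (T - \<beta> * \<gamma>)" by simp
      show "0 \<le> s" using D(1) H(1) by (simp add: s_def)
      show "real N * (D / \<epsilon> * (C * exp (T - \<beta> * \<gamma>))) \<le> 1 / 2"
      proof -
        have "exp (T - \<beta> * \<gamma>) \<le> exp (- ln Y)" using beta(3) by simp
        also have "\<dots> = 1 / Y" using Y1 by (simp add: exp_minus inverse_eq_divide)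
        finally have "real N * (D / \<epsilon> * C) * exp (T - \<beta> * \<gamma>) \<le> real N * (D / \<epsilon> * C) * (1 / Y)"
          using D(1) C(1) e0 by (intro mult_left_mono) auto
        also have "\<dots> \<le> 1/2"
        proof -
          have half: "k * (1 / (k * 2 + 1)) \<le> 1 / 2" if "k \<ge> 0" for k :: real
            using that by (simp add: field_simps)
          show ?thesis unfolding Y_def by (rule half) (use D(1) C(1) e0 in auto)
        qed
        finally show ?thesis by (simp add: mult.assoc)
      qed
    qed (use aC aM in auto)
    then obtain u where u: "\<And>z. cmod (u z) \<le> 2 * real N * C * s * (W z * M z)"
      and fh: "(\<lambda>z. F z - G z * u z) holomorphic_on UNIV" using G(1) Ga by blast
    define f where "f z = F z - G z * u z" for z
    define L where "L = 2 * real N * C * s"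
    have L0: "L \<ge> 0" using C(1) D(1) H(1) by (simp add: L_def s_def)
    define Z where "Z = (\<beta> * \<gamma> + \<beta> * A1 + T) * \<kappa> + \<beta> * A1"
    have Z0: "Z \<ge> 0" using beta(1) \<gamma> A1 T0 kappa_ge_1 by (simp add: Z_def)
    have Gu: "cmod (G z * u z) \<le> L * exp (Z * q z) * cmod (zero_poly \<zeta> m (near z (1/4)) z)" for z
    proof -
      let ?P = "cmod (zero_poly \<zeta> m (near z (1/4)) z)"
      have "cmod (G z * u z) = ?P * cmod (Qz z) * cmod (u z)"
        by (simp add: GQ[OF finite_near[of z "1/4"]] norm_mult Qz_def)
      also have "\<dots> \<le> ?P * cmod (Qz z) * (L * (W z * M z))"
        using u[of z] by (intro mult_left_mono) (auto simp: L_def)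
      also have "\<dots> = L * (W z * exp (\<beta> * \<Phi> z)) * ?P" using Qz0[of z] by (simp add: M_def)
      also have "\<dots> \<le> L * exp (Z * q z) * ?P"
      proof (intro mult_right_mono mult_left_mono)
        have "\<beta> * \<Phi> z \<le> \<beta> * (A1 * q z)" by (intro mult_left_mono Phi beta)
        then show "W z * exp (\<beta> * \<Phi> z) \<le> exp (Z * q z)"
          by (simp add: W_def Z_def algebra_simps flip: exp_add)
      qed (use L0 in auto)
      finally show ?thesis .
    qed
    show "\<exists>f\<in>A_space p. \<forall>j. \<forall>l<m j. (deriv ^^ l) f (\<zeta> j) / fact l = w j l"
    proof (intro bexI[of _ f] allI impI)
      define S where "S = b * \<kappa> + Z"
      have S0: "S > 0" using H(2) kappa_ge_1 Z0 by (simp add: S_def add_pos_nonneg)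
      have "cmod (f z) \<le> (H + L) * exp S * exp (S * p z)" for z
      proof -
        have q0: "0 \<le> q z" using q_ge_1[of z] by simp
        have "cmod (f z) \<le> cmod (F z) + cmod (G z * u z)" unfolding f_def by (rule norm_triangle_ineq4)
        also have "cmod (F z) \<le> H * exp (S * q z)"
        proof -
          have "b * \<kappa> * q z \<le> S * q z" using Z0 q0 by (intro mult_right_mono) (auto simp: S_def)
          then have "H * exp (b * \<kappa> * q z) \<le> H * exp (S * q z)" using H(1) by simp
          then show ?thesis using Fb[of z] by linarith
        qed
        also have "cmod (G z * u z) \<le> L * exp (S * q z)"
        proof -
          have "Z * q z \<le> S * q z" using q0 H(2) kappa_ge_1 by (intro mult_right_mono) (auto simp: S_def)
          then have "L * exp (Z * q z) * cmod (zero_poly \<zeta> m (near z (1/4)) z) \<le> L * exp (S * q z) * 1"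
            using L0 by (intro mult_mono mult_left_mono zero_poly_le_1) auto
          then show ?thesis using Gu[of z] by simp
        qed
        finally have "cmod (f z) \<le> (H + L) * exp (S * q z)" by (simp add: algebra_simps)
        also have "exp (S * q z) = exp S * exp (S * p z)" by (simp add: q_def algebra_simps flip: exp_add)
        finally show ?thesis by (simp add: mult.assoc)
      qed
      moreover have "(H + L) * exp S > 0" using H(1) L0 by (intro mult_pos_pos add_pos_nonneg) auto
      ultimately show "f \<in> A_space p"
        unfolding A_space_def using fh S0 by (auto simp: f_def[abs_def])
    next
      fix j l assume l: "l < m j"
      define t where "t z = (\<Sum>l<m j. w j l * (z - \<zeta> j) ^ l)" for z
      have th: "t holomorphic_on UNIV" unfolding t_def by (intro holomorphic_intros)
      have fh': "f holomorphic_on UNIV" using fh by (simp add: f_def[abs_def])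
      have "(deriv ^^ l) (\<lambda>z. f z - t z) (\<zeta> j) = 0"
      proof (rule higher_deriv_zero_of_bound[OF _ _ _ l])
        show "(\<lambda>z. f z - t z) holomorphic_on UNIV" by (intro holomorphic_intros fh' th)
        show "\<rho> j / 2 > 0" using rho_pos[of j] by simp
        fix z assume z: "cmod (z - \<zeta> j) < \<rho> j / 2"
        have z4: "cmod (z - \<zeta> j) \<le> 1/4" using z rho_le[of j] rho_pos[of j] by simp
        have "f z - t z = - (G z * u z)" using Fcore[of z j] z by (simp add: f_def t_def)
        then have "cmod (f z - t z) \<le> L * exp (Z * q z) * cmod (zero_poly \<zeta> m (near z (1/4)) z)"
          using Gu[of z] by simp
        also have "\<dots> \<le> L * exp (Z * (\<kappa> * q (\<zeta> j))) * cmod (z - \<zeta> j) ^ m j"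
        proof (rule mult_mono)
          have "q z \<le> \<kappa> * q (\<zeta> j)" by (rule q_moderate) (use z4 in \<open>simp add: norm_minus_commute\<close>)
          then show "L * exp (Z * q z) \<le> L * exp (Z * (\<kappa> * q (\<zeta> j)))"
            using L0 Z0 by (intro mult_left_mono) (auto intro: mult_left_mono)
          show "cmod (zero_poly \<zeta> m (near z (1/4)) z) \<le> cmod (z - \<zeta> j) ^ m j" by (rule zero_poly_near_le[OF z4])
        qed (use L0 in auto)
        finally show "cmod (f z - t z) \<le> L * exp (Z * (\<kappa> * q (\<zeta> j))) * cmod (z - \<zeta> j) ^ m j" .
      qed
      moreover have "(deriv ^^ l) (\<lambda>z. f z - t z) (\<zeta> j) = (deriv ^^ l) f (\<zeta> j) - (deriv ^^ l) t (\<zeta> j)"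
        by (rule higher_deriv_diff[OF fh' th]) auto
      moreover have "(deriv ^^ l) t (\<zeta> j) = fact l * w j l"
        unfolding t_def by (rule higher_deriv_polynomial[OF l])
      ultimately show "(deriv ^^ l) f (\<zeta> j) / fact l = w j l" by simp
    qed
  qed
qed

theorem theorem1p12:
  fixes p :: "complex \<Rightarrow> real" and R0 :: real
    and \<zeta> :: "nat \<Rightarrow> complex" and m :: "nat \<Rightarrow> nat"
  assumes "weight p"
    and "R0 \<ge> 0" and "C2_on p {z. cmod z > R0}"
    and "p \<in> O[at_infinity](laplacian p)"
    and "multiplicity_variety \<zeta> m"
  shows "interpolating_variety p \<zeta> m \<longleftrightarrow>
    (\<exists>A>0. \<exists>B>0. \<forall>j. N_count \<zeta> m (\<zeta> j) (exp 1) \<le> A * p (\<zeta> j) + B)"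
proof
  assume "interpolating_variety p \<zeta> m"
  moreover obtain \<kappa> where "subharmonic_weight (\<lambda>z. p z + 1) \<kappa>"
    using weight_subharmonic_weight[OF assms(1)] by blast
  ultimately show "\<exists>A>0. \<exists>B>0. \<forall>j. N_count \<zeta> m (\<zeta> j) (exp 1) \<le> A * p (\<zeta> j) + B"
    using interpolating_imp_counting_bound assms(5) unfolding subharmonic_weight_def by blast
next
  assume "\<exists>A>0. \<exists>B>0. \<forall>j. N_count \<zeta> m (\<zeta> j) (exp 1) \<le> A * p (\<zeta> j) + B"
  then show "interpolating_variety p \<zeta> m"
    using counting_bound_imp_interpolating[OF assms(1,3,4,5)] by blast
qed

end
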